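(* Let $(X,Y)\in\mathbb{R}^2$ be a stable random vector with index $\alpha\in(0,2)$ and spectral measure $\tau$ on $\mathbb{R}/(2\pi\mathbb{Z})$. Let \[C_{++}=\int_{0}^{\frac{\pi}{2}}|\cos\theta\sin\theta|^{\frac{\alpha}{2}}\tau(\mathrm{d}\theta),\quad C_{+-}=\int_{\frac{3\pi}{2}}^{2\pi}|\cos\theta\sin\theta|^{\frac{\alpha}{2}}\tau(\mathrm{d}\theta),\] \[C_{-+}=\int_{\frac{\pi}{2}}^{\pi}|\cos\theta\sin\theta|^{\frac{\alpha}{2}}\tau(\mathrm{d}\theta),\quad C_{--}=\int_{\pi}^{\frac{3\pi}{2}}|\cos\theta\sin\theta|^{\frac{\alpha}{2}}\tau(\mathrm{d}\theta),\] \[D^{x}_{+}=\int_{-\frac{\pi}{2}}^{\frac{\pi}{2}}|\cos\theta|^{\alpha}\tau(\mathrm{d}\theta),\quad D^{x}_{-}=\int_{\frac{\pi}{2}}^{\frac{3\pi}{2}}|\cos\theta|^{\alpha}\tau(\mathrm{d}\theta),\quad D^{y}_{+}=\int_{0}^{\pi}|\sin\theta|^{\alpha}\tau(\mathrm{d}\theta),\quad D^{y}_{-}=\int_{\pi}^{2\pi}|\sin\theta|^{\alpha}\tau(\mathrm{d}\theta).\] Then \[R(X,Y)=\left\|\begin{pmatrix} C_{++}/\sqrt{D^{x}_{+}D^{y}_{+}} & C_{+-}/\sqrt{D^{x}_{+}D^{y}_{-}}\\ C_{-+}/\sqrt{D^{x}_{-}D^{y}_{+}} & C_{--}/\sqrt{D^{x}_{-}D^{y}_{-}}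 \end{pmatrix}\right\|_2\] with the convention $0/0=0$, where $\|\cdot\|_2$ denotes the spectral norm (largest singular value).
   Context: For two random elements $X,Y$, the maximal correlation coefficient is $R(X,Y)=\sup \rho(\varphi(X),\psi(Y))$, where $\rho$ denotes the Pearson correlation coefficient and the supremum is over all real-valued measurable functions $\varphi,\psi$ such that $\varphi(X)$ and $\psi(Y)$ are square-integrable with positive variance. If $X$ or $Y$ is degenerate (almost surely constant), one sets $R(X,Y)=0$. A stable random vector $(X,Y)$ of index $\alpha\in(0,2)$ (not necessarily strictly stable or symmetric) is infinitely divisible with no Gaussian part: for some $b\in\mathbb{R}^2$, \[E[e^{i(u_1X+u_2Y)}]=\exp\Big(i(b_1u_1+b_2u_2)+\int_{\mathbb{R}^2\setminus\{(0,0)\}}\big(e^{i(u_1x+u_2y)}-1-i(u_1x+u_2y)1_{\{0<x^2+y^2\le 1\}}\big)\nu(\mathrm{d}x,\mathrm{d}y)\Big),\] with Lévy measure \[\nu(B)=\int_{0}^{\infty}\int_{\mathbb{R}/(2\pi\mathbb{Z})}1_{B}(r\cos\theta,r\sin\theta)\frac{1}{r^{1+\alpha}}\,\mathrm{d}r\,\tau(\mathrm{d}\theta),\quad B\in\mathcal{B}(\mathbb{R}^2\setminus\{(0,0)\}),\] where the spectral measure $\tau$ is a finite Borel measure on $\mathbb{R}/(2\pi\mathbb{Z})$. Integrals over arcs are with respect to $\tau$ on the corresponding arc of the circle $\mathbb{R}/(2\pi\mathbb{Z})$ (the integrands vanish at the endpoints of the arcs, so inclusion of endpoints is immaterial). 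*)

theory Defs
  imports "HOL-Probability.Probability"
begin

section \<open>Maximal correlation\<close>

definition square_integrable :: "'a measure \<Rightarrow> ('a \<Rightarrow> real) \<Rightarrow> bool" where
  "square_integrable M U \<longleftrightarrow> U \<in> borel_measurable M \<and> integrable M (\<lambda>\<omega>. (U \<omega>)\<^sup>2)"

definition covar :: "'a measure \<Rightarrow> ('a \<Rightarrow> real) \<Rightarrow> ('a \<Rightarrow> real) \<Rightarrow> real" where
  "covar M U V = (LINT \<omega>|M. (U \<omega> - (LINT \<omega>'|M. U \<omega>')) * (V \<omega> - (LINT \<omega>'|M. V \<omega>')))"

definition pearson_correlation :: "'a measure \<Rightarrow> ('a \<Rightarrow> real) \<Rightarrow> ('a \<Rightarrow> real) \<Rightarrow> real" where
  "pearson_correlation M U V = covar M U V / sqrt (covar M U U * covar M V V)"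

definition degenerate :: "'a measure \<Rightarrow> ('a \<Rightarrow> 'b) \<Rightarrow> bool" where
  "degenerate M X \<longleftrightarrow> (\<exists>c. AE \<omega> in M. X \<omega> = c)"

text \<open>
  The random elements \<open>X\<close> and \<open>Y\<close> on the probability space \<open>M\<close> take values in the
  measurable spaces \<open>S\<close> and \<open>T\<close>.
\<close>
definition max_correlation ::
  "'a measure \<Rightarrow> 'b measure \<Rightarrow> 'c measure \<Rightarrow> ('a \<Rightarrow> 'b) \<Rightarrow> ('a \<Rightarrow> 'c) \<Rightarrow> real" where
  "max_correlation M S T X Y =
     (if degenerate M X \<or> degenerate M Y then 0
      else Sup {pearson_correlation M (\<phi> \<circ> X) (\<psi> \<circ> Y) | \<phi> \<psi>.
             \<phi> \<in> borel_measurable S \<and> \<psi> \<in> borel_measurable T \<and>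
             square_integrable M (\<phi> \<circ> X) \<and> covar M (\<phi> \<circ> X) (\<phi> \<circ> X) > 0 \<and>
             square_integrable M (\<psi> \<circ> Y) \<and> covar M (\<psi> \<circ> Y) (\<psi> \<circ> Y) > 0})"

section \<open>Stable random vectors in the plane\<close>

text \<open>
  The circle of angles modulo \<open>2\<pi>\<close> is represented by the fundamental domain \<open>[0, 2\<pi>)\<close>,
  whose Borel sets correspond to those of the circle under the quotient map.
\<close>
definition circle_borel :: "real measure" where
  "circle_borel = restrict_space borel {0..<2 * pi}"

text \<open>
  The closed arc from \<open>a\<close> to \<open>b\<close>, reduced modulo \<open>2\<pi>\<close>; thus \<open>circle_arc (-(pi/2)) (pi/2)\<close>
  consists of the representatives in \<open>[0, \<pi>/2]\<close> and in \<open>[3\<pi>/2, 2\<pi>)\<close>.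
\<close>
definition circle_arc :: "real \<Rightarrow> real \<Rightarrow> real set" where
  "circle_arc a b = {\<theta> \<in> {0..<2 * pi}. \<exists>k::int. \<theta> + 2 * pi * of_int k \<in> {a..b}}"

definition spectral_measure :: "real measure \<Rightarrow> bool" where
  "spectral_measure \<tau> \<longleftrightarrow> finite_measure \<tau> \<and> sets \<tau> = sets circle_borel"

text \<open>
  A measure on the whole plane; it gives no mass to the origin since the radial density
  vanishes for \<open>r \<le> 0\<close>. The familiar formula in polar coordinates is
  \<open>emeasure_stable_levy_measure\<close> below.
\<close>
definition stable_levy_measure :: "real \<Rightarrow> real measure \<Rightarrow> (real \<times> real) measure" where
  "stable_levy_measure \<alpha> \<tau> =
     distr (density (\<tau> \<Otimes>\<^sub>M lborel)
              (\<lambda>(\<theta>, r). ennreal (1 / r powr (1 + \<alpha>)) * indicator {0<..} r))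
       borel (\<lambda>(\<theta>, r). (r * cos \<theta>, r * sin \<theta>))"

lemma emeasure_stable_levy_measure:
  assumes "spectral_measure \<tau>" and B: "B \<in> sets borel"
  shows "emeasure (stable_levy_measure \<alpha> \<tau>) B =
    (\<integral>\<^sup>+\<theta>. (\<integral>\<^sup>+r\<in>{0<..}. indicator B (r * cos \<theta>, r * sin \<theta>) * ennreal (1 / r powr (1 + \<alpha>)) \<partial>lborel) \<partial>\<tau>)"
proof -
  have sets [measurable_cong]: "sets \<tau> = sets (restrict_space borel {0..<2 * pi})"
    using assms(1) by (simp add: spectral_measure_def circle_borel_def)
  have id: "(\<lambda>x. x) \<in> \<tau> \<rightarrow>\<^sub>M borel"
    using sets by (simp add: measurable_cong_sets[OF sets refl] measurable_restrict_space1)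
  have [measurable]: "cos \<in> borel_measurable \<tau>" "sin \<in> borel_measurable \<tau>"
    using measurable_compose[OF id, of cos borel] measurable_compose[OF id, of sin borel]
    by (auto simp: borel_measurable_continuous_onI continuous_intros)
  have f: "(\<lambda>(\<theta>, r). (r * cos \<theta>, r * sin \<theta>)) \<in> \<tau> \<Otimes>\<^sub>M lborel \<rightarrow>\<^sub>M (borel :: (real \<times> real) measure)"
    unfolding borel_prod[symmetric] by measurable
  have d: "(\<lambda>(\<theta>, r). ennreal (1 / r powr (1 + \<alpha>)) * indicator {0<..} r)
            \<in> borel_measurable (\<tau> \<Otimes>\<^sub>M lborel)"
    by measurable
  define A where "A = (\<lambda>(\<theta>, r). (r * cos \<theta>, r * sin \<theta>)) -` B \<inter> space (\<tau> \<Otimes>\<^sub>M lborel)"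
  have A [measurable]: "A \<in> sets (\<tau> \<Otimes>\<^sub>M lborel)"
    unfolding A_def using measurable_sets[OF f B] .
  have "emeasure (stable_levy_measure \<alpha> \<tau>) B =
      (\<integral>\<^sup>+p. (case p of (\<theta>, r) \<Rightarrow> ennreal (1 / r powr (1 + \<alpha>)) * indicator {0<..} r) * indicator A p
        \<partial>(\<tau> \<Otimes>\<^sub>M lborel))"
    unfolding stable_levy_measure_def using f B A d
    by (subst emeasure_distr) (auto simp: emeasure_density A_def)
  also have "\<dots> = (\<integral>\<^sup>+\<theta>. (\<integral>\<^sup>+r. ennreal (1 / r powr (1 + \<alpha>)) * indicator {0<..} r
      * indicator A (\<theta>, r) \<partial>lborel) \<partial>\<tau>)"
    using d by (subst lborel.nn_integral_fst[symmetric]) (auto intro: borel_measurable_times_ennreal)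
  also have "\<dots> = (\<integral>\<^sup>+\<theta>. (\<integral>\<^sup>+r\<in>{0<..}. indicator B (r * cos \<theta>, r * sin \<theta>)
      * ennreal (1 / r powr (1 + \<alpha>)) \<partial>lborel) \<partial>\<tau>)"
    by (intro nn_integral_cong) (auto simp: A_def space_pair_measure indicator_def)
  finally show ?thesis .
qed

definition stable_vector ::
  "'a measure \<Rightarrow> ('a \<Rightarrow> real) \<Rightarrow> ('a \<Rightarrow> real) \<Rightarrow> real \<Rightarrow> real measure \<Rightarrow> bool" where
  "stable_vector M X Y \<alpha> \<tau> \<longleftrightarrow>
     X \<in> borel_measurable M \<and> Y \<in> borel_measurable M \<and>
     (\<exists>b\<^sub>1 b\<^sub>2 :: real. \<forall>u\<^sub>1 u\<^sub>2 :: real.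
        (LINT \<omega>|M. exp (\<i> * of_real (u\<^sub>1 * X \<omega> + u\<^sub>2 * Y \<omega>))) =
        exp (\<i> * of_real (b\<^sub>1 * u\<^sub>1 + b\<^sub>2 * u\<^sub>2) +
          (LINT z:UNIV - {(0, 0)}|stable_levy_measure \<alpha> \<tau>.
             (case z of (x, y) \<Rightarrow>
               exp (\<i> * of_real (u\<^sub>1 * x + u\<^sub>2 * y)) - 1
               - \<i> * of_real (u\<^sub>1 * x + u\<^sub>2 * y)
                 * indicator {(x, y). 0 < x\<^sup>2 + y\<^sup>2 \<and> x\<^sup>2 + y\<^sup>2 \<le> 1} (x, y)))))"

section \<open>Spectral norm\<close>

definition singular_value :: "real ^ 'n ^ 'm \<Rightarrow> real \<Rightarrow> bool" where
  "singular_value A s \<longleftrightarrow>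
     s \<ge> 0 \<and> (\<exists>v. v \<noteq> 0 \<and> (transpose A ** A) *v v = s\<^sup>2 *\<^sub>R v)"

definition spectral_norm :: "real ^ 'n ^ 'm \<Rightarrow> real" where
  "spectral_norm A = Max {s. singular_value A s}"

end

(*
  Write e_u for the function x |-> exp(i u x). Because the compensators of the Levy-Khintchine
  exponent cancel, the covariance of e_u(X) and e_v(Y) is E e_u(X) E e_{-v}(Y) (exp(K(u, v)) - 1),
  where K(u, v) is the integral of (e_u(x) - 1)(e_{-v}(y) - 1) against the Levy measure; the same
  holds with X or Y in both places. "Correlation at most R" for all linear combinations is therefore
  positive semidefiniteness of a block kernel whose diagonal blocks are multiplied by R.

  Upper bound: Cauchy-Schwarz in the radial variable gives this property with R the spectral norm for
  the kernel K itself. Since K is a Gram kernel, multiplication by K preserves the property; hence it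
  holds for K^n with n >= 1 and for exp(K) - 1, and density of trigonometric polynomials in L^2 extends
  it to all test functions.

  Lower bound: replacing (u, v) by (c u, c v) and letting c tend to 0, self-similarity of the Levy
  measure turns the bound for the covariances back into the bound for K. Trigonometric polynomials
  vanishing at 0 are dense in L^2 of the Levy measure, so one may test with |x|^(alpha/2) on
  1 <= |x| <= T, with a separate weight for each sign of x; after division by log T the limit T -> oo
  gives exactly the bilinear form of the matrix.
*)

theory Submission
  imports Defs
begin

section \<open>Nonnegative forms\<close>

text \<open>Two features shape the proof. First, Cauchy-Schwarz is applied in the radial variable
  alone. On the ray at angle \<theta>, homogeneity of the radial density produces |cos \<theta>|
  powr \<alpha> and |sin \<theta>| powr \<alpha>, whose square roots multiply to the integrand of
  the C constants; only then is \<theta> integrated. The power |x| powr (\<alpha> / 2) is the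
  equality case: as functions of r, its values at r cos \<theta> and r sin \<theta> are proportional
  on every ray off the axes. Its square against the radial density is 1 / r, which just fails to be
  integrable at both ends; hence the cutoff and the division by log T. Second, correlation bounds
  are written additively, as R (|a|^2 + |b|^2) + 2 Re <a, b> >= 0, not as quotients. This makes
  sense for vanishing norms, passes to L^2 limits, and as a statement on kernels survives entrywise
  multiplication by a Gram kernel. The pattern with R on the diagonal and 1 off it is not itself
  nonnegative when R < 1, so the exponential series must lack its constant term; centring the
  exponentials is what removes it.\<close>

abbreviation herm_form :: "'i set \<Rightarrow> ('i \<Rightarrow> complex) \<Rightarrow> ('i \<Rightarrow> 'i \<Rightarrow> complex) \<Rightarrow> complex" where
  "herm_form S a K \<equiv> \<Sum>i\<in>S. \<Sum>j\<in>S. a i * cnj (a j) * K i j"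

text \<open>Positive semidefiniteness for hermitian kernels; with the real part the condition also
  makes sense for kernels whose symmetry has not been established.\<close>

definition nonneg_form :: "'i set \<Rightarrow> ('i \<Rightarrow> 'i \<Rightarrow> complex) \<Rightarrow> bool" where
  "nonneg_form S K \<longleftrightarrow> (\<forall>a. 0 \<le> Re (herm_form S a K))"

lemma nonneg_form_cong:
  assumes "\<And>i j. i \<in> S \<Longrightarrow> j \<in> S \<Longrightarrow> K i j = L i j" "nonneg_form S L"
  shows "nonneg_form S K"
proof -
  have "herm_form S a K = herm_form S a L" for a
    using assms(1) by (intro sum.cong) auto
  then show ?thesis
    using assms(2) by (simp add: nonneg_form_def)
qed

lemma nonneg_form_add:
  assumes "nonneg_form S K" "nonneg_form S L"
  shows "nonneg_form S (\<lambda>i j. K i j + L i j)"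
  using assms by (simp add: nonneg_form_def distrib_left sum.distrib)

lemma nonneg_form_sum:
  assumes "\<And>k. k \<in> T \<Longrightarrow> nonneg_form S (K k)"
  shows "nonneg_form S (\<lambda>i j. \<Sum>k\<in>T. K k i j)"
  using assms
proof (induction T rule: infinite_finite_induct)
  case (insert x F)
  then show ?case
    by (simp add: nonneg_form_add)
qed (auto simp: nonneg_form_def)

lemma nonneg_form_scale:
  assumes "nonneg_form S K" "0 \<le> c"
  shows "nonneg_form S (\<lambda>i j. complex_of_real c * K i j)"
  unfolding nonneg_form_def
proof
  fix a
  have "herm_form S a (\<lambda>i j. complex_of_real c * K i j) =
      complex_of_real c * herm_form S a K"
    by (simp add: sum_distrib_left mult_ac)
  then show "0 \<le> Re (herm_form S a (\<lambda>i j. complex_of_real c * K i j))"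
    using assms by (simp add: nonneg_form_def)
qed

text \<open>The factors are absorbed into the coefficients. This disposes of the characteristic
  functions in front of \<open>exp (kern u v) - 1\<close>.\<close>

lemma nonneg_form_congruence:
  assumes "nonneg_form S K"
  shows "nonneg_form S (\<lambda>i j. b i * cnj (b j) * K i j)"
  unfolding nonneg_form_def
proof
  fix a
  show "0 \<le> Re (herm_form S a (\<lambda>i j. b i * cnj (b j) * K i j))"
    using assms[unfolded nonneg_form_def, rule_format, of "\<lambda>i. a i * b i"] by (simp add: mult_ac)
qed

lemma nonneg_form_limit:
  assumes "\<And>n. nonneg_form S (K n)" "\<And>i j. i \<in> S \<Longrightarrow> j \<in> S \<Longrightarrow> (\<lambda>n. K n i j) \<longlonglongrightarrow> L i j"
  shows "nonneg_form S L"
  unfolding nonneg_form_def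
proof
  fix a
  have "(\<lambda>n. Re (herm_form S a (K n))) \<longlonglongrightarrow> Re (herm_form S a L)"
    by (intro tendsto_intros assms(2)) auto
  then show "0 \<le> Re (herm_form S a L)"
    using assms(1) by (intro LIMSEQ_le_const) (auto simp: nonneg_form_def)
qed

text \<open>The flag \<open>fst i\<close> tells to which of the two coordinates the function with
  index \<open>i\<close> belongs. The form of \<open>block R\<close> times a Gram kernel is then a
  \<open>corr_form\<close>, see \<open>Re_block_gram\<close>.\<close>

definition block :: "real \<Rightarrow> bool \<times> 'b \<Rightarrow> bool \<times> 'b \<Rightarrow> complex" where
  "block R i j = (if fst i = fst j then of_real R else 1)"

section \<open>The spectral norm\<close>

text \<open>Test the bound with \<open>x = A *v v\<close> and \<open>y = v\<close>, where
  \<open>v\<close> is an eigenvector belonging to \<open>s\<close>, so that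
  \<open>norm (A *v v) = s * norm v\<close>.\<close>

lemma singular_value_bilinear_le:
  fixes A :: "real ^ 'n ^ 'm"
  assumes "\<And>x y. x \<bullet> (A *v y) \<le> R * norm x * norm y" and "singular_value A s" and R: "0 \<le> R"
  shows "s \<le> R"
proof -
  obtain v where s: "0 \<le> s" and v: "v \<noteq> 0" "(transpose A ** A) *v v = s\<^sup>2 *\<^sub>R v"
    using assms(2) by (auto simp: singular_value_def)
  have "(norm (A *v v))\<^sup>2 = v \<bullet> ((transpose A ** A) *v v)"
    by (metis dot_lmul_matrix inner_commute matrix_vector_mul_assoc power2_norm_eq_inner transpose_matrix_vector)
  also have "\<dots> = (s * norm v)\<^sup>2"
    by (simp add: v power_mult_distrib power2_norm_eq_inner)
  finally have sv: "norm (A *v v) = s * norm v"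
    using s by (simp add: power2_eq_iff_nonneg)
  have "norm (A *v v) * norm (A *v v) \<le> R * norm (A *v v) * norm v"
    using assms(1)[of "A *v v" v] by (simp add: power2_norm_eq_inner[symmetric] power2_eq_square)
  then have "s * norm v = 0 \<or> s * norm v \<le> R * norm v"
    unfolding sv using s v
    by (metis mult.assoc mult.left_commute mult_le_cancel_left_pos mult_eq_0_iff norm_ge_zero
        order_le_less zero_le_mult_iff)
  then show ?thesis
    using v s R by auto
qed

text \<open>\<open>spectral_norm\<close> is a \<open>Max\<close>, which is meaningful only for a
  finite set. Distinct nonnegative \<open>s\<close> have distinct squares, so their eigenvectors are
  orthogonal, hence independent, hence finite in number.\<close>

lemma finite_singular_values:
  fixes A :: "real ^ 'n ^ 'm"
  shows "finite {s. singular_value A s}"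
proof -
  let ?B = "transpose A ** A"
  have "\<forall>s. \<exists>v. singular_value A s \<longrightarrow> 0 \<le> s \<and> v \<noteq> 0 \<and> ?B *v v = s\<^sup>2 *\<^sub>R v"
    by (auto simp: singular_value_def)
  from choice[OF this] obtain v where
    v: "\<And>s. singular_value A s \<Longrightarrow> 0 \<le> s \<and> v s \<noteq> 0 \<and> ?B *v v s = s\<^sup>2 *\<^sub>R v s"
    by metis
  have sym: "x \<bullet> (?B *v y) = (?B *v x) \<bullet> y" for x y
    by (metis dot_lmul_matrix matrix_transpose_mul transpose_transpose transpose_matrix_vector)
  have orth: "v s \<bullet> v t = 0" if "singular_value A s" "singular_value A t" "s \<noteq> t" for s t
  proof -
    have "t\<^sup>2 * (v s \<bullet> v t) = s\<^sup>2 * (v s \<bullet> v t)"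
      using sym[of "v s" "v t"] v that by simp
    moreover have "t\<^sup>2 \<noteq> s\<^sup>2"
      using that v by (metis power2_eq_iff_nonneg)
    ultimately show ?thesis by auto
  qed
  have inj: "inj_on v {s. singular_value A s}"
    using orth v by (intro inj_onI) (metis inner_eq_zero_iff mem_Collect_eq)
  have "pairwise orthogonal (v ` {s. singular_value A s})"
    using orth by (auto simp: pairwise_def orthogonal_def)
  moreover have "0 \<notin> v ` {s. singular_value A s}"
    using v by auto
  ultimately have "independent (v ` {s. singular_value A s})"
    by (rule pairwise_orthogonal_independent)
  then have "finite (v ` {s. singular_value A s})"
    by (rule independent_imp_finite)
  then show ?thesis
    using inj by (rule finite_imageD)
qed

text \<open>A maximizer \<open>v\<close> of \<open>norm (A *v y)\<close> on the unit sphere is an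
  eigenvector: the form of \<open>C\<close>, that is of \<open>s\<close> squared minus the Gram
  matrix of \<open>A\<close>, is nonnegative and vanishes at \<open>v\<close>, and a nonnegative
  quadratic form can vanish at \<open>v\<close> only if \<open>C v = 0\<close>.\<close>

lemma exists_dominating_singular_value:
  fixes A :: "real ^ 'n ^ 'm"
  shows "\<exists>s. singular_value A s \<and> (\<forall>y. norm (A *v y) \<le> s * norm y)"
proof -
  let ?B = "transpose A ** A"
  have AB: "(A *v x) \<bullet> (A *v y) = x \<bullet> (?B *v y)" for x y
    by (metis dot_lmul_matrix matrix_vector_mul_assoc transpose_matrix_vector inner_commute)
  have "\<exists>v\<in>sphere 0 1. \<forall>y\<in>sphere 0 1. norm (A *v y) \<le> norm (A *v v)"
    by (intro continuous_attains_sup continuous_intros matrix_vector_mult_linear_continuous_on compact_sphere) auto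
  then obtain v where v: "norm v = 1" "\<And>y. norm y = 1 \<Longrightarrow> norm (A *v y) \<le> norm (A *v v)"
    by auto
  define s where "s = norm (A *v v)"
  have dom: "norm (A *v y) \<le> s * norm y" for y
  proof (cases "y = 0")
    case False
    then have "norm (A *v ((1 / norm y) *\<^sub>R y)) \<le> s"
      unfolding s_def by (intro v) simp
    then show ?thesis
      using False by (simp add: matrix_vector_mult_scaleR field_simps)
  qed simp
  define C where "C x = s\<^sup>2 *\<^sub>R x - ?B *v x" for x
  have form: "x \<bullet> C x = (s * norm x)\<^sup>2 - (norm (A *v x))\<^sup>2" for x
    by (simp add: C_def inner_diff_right AB[symmetric] power_mult_distrib power2_norm_eq_inner)
  have "0 \<le> x \<bullet> C x" for x
    unfolding form using dom[of x] by (simp add: power_mono)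
  have vC: "v \<bullet> C v = 0"
    unfolding form by (simp add: v s_def)
  have sym: "x \<bullet> (?B *v y) = y \<bullet> (?B *v x)" for x y
    unfolding AB[symmetric] by (rule inner_commute)
  have symC: "x \<bullet> C y = y \<bullet> C x" for x y
    by (simp add: C_def inner_diff_right sym[of x y] inner_commute[of x y])
  let ?w = "C v"
  \<comment> \<open>Perturb \<open>v\<close> in the direction \<open>C v\<close>; by symmetry of
    \<open>C\<close> the linear term in \<open>t\<close> is twice the squared norm of
    \<open>C v\<close>.\<close>
  have q: "0 \<le> 2 * t * (norm ?w)\<^sup>2 + t\<^sup>2 * (?w \<bullet> C ?w)" for t
  proof -
    have "(v + t *\<^sub>R ?w) \<bullet> C (v + t *\<^sub>R ?w) = v \<bullet> C v + t * (v \<bullet> C ?w) + t * (?w \<bullet> C v) + t\<^sup>2 * (?w \<bullet> C ?w)"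
      by (simp add: C_def vec.add matrix_vector_mult_scaleR inner_add_left inner_add_right inner_diff_right
          inner_diff_left algebra_simps power2_eq_square)
    also have "v \<bullet> C ?w = ?w \<bullet> C v"
      by (rule symC)
    finally show ?thesis
      using \<open>\<And>x. 0 \<le> x \<bullet> C x\<close>[of "v + t *\<^sub>R ?w"] vC by (simp add: power2_norm_eq_inner)
  qed
  have "?w = 0"
  proof (rule ccontr)
    assume "?w \<noteq> 0"
    define n where "n = (norm ?w)\<^sup>2"
    define c where "c = ?w \<bullet> C ?w"
    have "n > 0" "0 \<le> c"
      using \<open>?w \<noteq> 0\<close> \<open>\<And>x. 0 \<le> x \<bullet> C x\<close> by (auto simp: n_def c_def)
    \<comment> \<open>The minimizer of the quadratic would be \<open>t = - n / c\<close>; adding 1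
      to the denominator keeps it positive when \<open>c = 0\<close> and still gives a negative
      value.\<close>
    have "0 \<le> 2 * (- n / (c + 1)) * n + (- n / (c + 1))\<^sup>2 * c"
      using q[of "- n / (c + 1)"] by (simp add: n_def c_def)
    also have "\<dots> = n\<^sup>2 / (c + 1) * (c / (c + 1) - 2)"
    proof -
      have "2 * (- n / k) * n + (- n / k)\<^sup>2 * c = n\<^sup>2 / k * (c / k - 2)" if "k \<noteq> 0" for k
        using that by (simp add: field_simps power2_eq_square)
      then show ?thesis
        using \<open>0 \<le> c\<close> by simp
    qed
    also have "\<dots> < 0"
      using \<open>n > 0\<close> \<open>0 \<le> c\<close> by (intro mult_pos_neg) (auto simp: field_simps)
    finally show False by simp
  qed
  then have "singular_value A s"
    unfolding singular_value_def C_def using v by (intro conjI exI[of _ v]) (auto simp: s_def)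
  with dom show ?thesis by blast
qed

lemma bilinear_le_spectral_norm:
  fixes A :: "real ^ 'n ^ 'm"
  shows "x \<bullet> (A *v y) \<le> spectral_norm A * norm x * norm y"
proof -
  obtain s where s: "singular_value A s" "\<And>y. norm (A *v y) \<le> s * norm y"
    using exists_dominating_singular_value by blast
  have "x \<bullet> (A *v y) \<le> norm x * norm (A *v y)"
    by (rule norm_cauchy_schwarz)
  also have "\<dots> \<le> norm x * (s * norm y)"
    by (intro mult_left_mono s) auto
  also have "\<dots> \<le> norm x * (spectral_norm A * norm y)"
    unfolding spectral_norm_def using finite_singular_values s
    by (intro mult_left_mono mult_right_mono Max_ge) auto
  finally show ?thesis by (simp add: mult_ac)
qed

lemma spectral_norm_le:
  fixes A :: "real ^ 'n ^ 'm"
  assumes "0 \<le> R" "\<And>x y. x \<bullet> (A *v y) \<le> R * norm x * norm y"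
  shows "spectral_norm A \<le> R"
proof -
  have "{s. singular_value A s} \<noteq> {}"
    using exists_dominating_singular_value by blast
  then show ?thesis
    unfolding spectral_norm_def using singular_value_bilinear_le[OF assms(2) _ assms(1)] finite_singular_values
    by (subst Max_le_iff) auto
qed

lemma spectral_norm_nonneg: "0 \<le> spectral_norm (A :: real ^ 'n ^ 'm)"
proof -
  obtain s where "singular_value A s"
    using exists_dominating_singular_value by blast
  then have "0 \<le> s" "s \<le> spectral_norm A"
    using finite_singular_values[of A] by (auto simp: spectral_norm_def intro: Max_ge) (simp add: singular_value_def)
  then show ?thesis by simp
qed

section \<open>Square-integrable functions\<close>

abbreviation sqnorm :: "'a measure \<Rightarrow> ('a \<Rightarrow> complex) \<Rightarrow> real" where
  "sqnorm N f \<equiv> \<integral>x. (cmod (f x))\<^sup>2 \<partial>N"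

definition sq_int :: "'a measure \<Rightarrow> ('a \<Rightarrow> complex) \<Rightarrow> bool" where
  "sq_int N f \<longleftrightarrow> f \<in> borel_measurable N \<and> integrable N (\<lambda>x. (cmod (f x))\<^sup>2)"

lemma sq_intD [dest]:
  assumes "sq_int N f"
  shows "f \<in> borel_measurable N" "integrable N (\<lambda>x. (cmod (f x))\<^sup>2)"
  using assms by (auto simp: sq_int_def)

text \<open>For positive \<open>a\<close> and \<open>b\<close> the best \<open>t\<close> is
  \<open>sqrt b / sqrt a\<close>. If one of them is 0, the infimum 0 is only approached as
  \<open>t\<close> tends to infinity or to 0; the explicit choices of \<open>t\<close> then make the
  right side at most \<open>c\<close>, contradicting \<open>c > 0\<close>.\<close>

lemma real_le_sqrt_mult_sqrt:
  fixes a b c :: real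
  assumes "\<And>t. t > 0 \<Longrightarrow> 2 * c \<le> t * a + b / t" "0 \<le> a" "0 \<le> b"
  shows "c \<le> sqrt a * sqrt b"
proof (cases "a = 0 \<or> b = 0")
  case True
  have "\<not> c > 0"
  proof
    assume "c > 0"
    show False
    proof (cases "a = 0")
      case a: True
      have "2 * c \<le> b / ((b + 1) / c)"
        using assms(1)[of "(b + 1) / c"] \<open>c > 0\<close> assms a by simp
      also have "\<dots> \<le> c"
        using \<open>c > 0\<close> assms by (simp add: field_simps)
      finally show False using \<open>c > 0\<close> by simp
    next
      case False
      have "2 * c \<le> c / (a + 1) * a"
        using assms(1)[of "c / (a + 1)"] \<open>c > 0\<close> assms False True by simp
      also have "\<dots> \<le> c"
        using \<open>c > 0\<close> assms by (simp add: field_simps)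
      finally show False using \<open>c > 0\<close> by simp
    qed
  qed
  then show ?thesis using True by auto
next
  case False
  define x y where "x = sqrt a" and "y = sqrt b"
  have xy: "x > 0" "y > 0" "a = x\<^sup>2" "b = y\<^sup>2"
    using False assms by (auto simp: x_def y_def)
  show ?thesis
    using assms(1)[of "y / x"] xy by (simp add: x_def[symmetric] y_def[symmetric] power2_eq_square field_simps)
qed

lemma integrable_mult_of_squares:
  fixes f g :: "'a \<Rightarrow> real"
  assumes [measurable]: "f \<in> borel_measurable N" "g \<in> borel_measurable N"
    and "integrable N (\<lambda>x. (f x)\<^sup>2)" "integrable N (\<lambda>x. (g x)\<^sup>2)"
  shows "integrable N (\<lambda>x. f x * g x)"
proof (rule Bochner_Integration.integrable_bound)
  show "integrable N (\<lambda>x. (f x)\<^sup>2 + (g x)\<^sup>2)"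
    using assms by simp
  have "\<bar>a * b\<bar> \<le> a\<^sup>2 + b\<^sup>2" for a b :: real
  proof -
    have "2 * \<bar>a * b\<bar> \<le> a\<^sup>2 + b\<^sup>2" "0 \<le> \<bar>a * b\<bar>"
      using sum_squares_bound[of "\<bar>a\<bar>" "\<bar>b\<bar>"] by (simp_all add: abs_mult)
    then show ?thesis by linarith
  qed
  then show "AE x in N. norm (f x * g x) \<le> norm ((f x)\<^sup>2 + (g x)\<^sup>2)"
    by simp
qed simp

lemma integral_Cauchy_Schwarz:
  fixes f g :: "'a \<Rightarrow> real"
  assumes m: "f \<in> borel_measurable N" "g \<in> borel_measurable N"
    and i: "integrable N (\<lambda>x. (f x)\<^sup>2)" "integrable N (\<lambda>x. (g x)\<^sup>2)"
  shows "(\<integral>x. f x * g x \<partial>N) \<le> sqrt (\<integral>x. (f x)\<^sup>2 \<partial>N) * sqrt (\<integral>x. (g x)\<^sup>2 \<partial>N)"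
proof (rule real_le_sqrt_mult_sqrt)
  fix t :: real assume t: "t > 0"
  have *: "2 * (a * b) \<le> t * a\<^sup>2 + b\<^sup>2 / t" for a b
    using sum_squares_bound[of "sqrt t * a" "b / sqrt t"] t
    by (simp add: power_mult_distrib power_divide)
  have "2 * (\<integral>x. f x * g x \<partial>N) = (\<integral>x. 2 * (f x * g x) \<partial>N)"
    by simp
  also have "\<dots> \<le> (\<integral>x. t * (f x)\<^sup>2 + (g x)\<^sup>2 / t \<partial>N)"
    using integrable_mult_of_squares[OF m i] i by (intro integral_mono *) auto
  also have "\<dots> = t * (\<integral>x. (f x)\<^sup>2 \<partial>N) + (\<integral>x. (g x)\<^sup>2 \<partial>N) / t"
    using i by simp
  finally show "2 * (\<integral>x. f x * g x \<partial>N) \<le> t * (\<integral>x. (f x)\<^sup>2 \<partial>N) + (\<integral>x. (g x)\<^sup>2 \<partial>N) / t" .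
qed auto

lemma sq_int_integrable_mult:
  assumes "sq_int N f" "sq_int N g"
  shows "integrable N (\<lambda>x. f x * cnj (g x))"
proof (rule Bochner_Integration.integrable_bound)
  show "integrable N (\<lambda>x. cmod (f x) * cmod (g x))"
    using assms by (intro integrable_mult_of_squares) auto
  show "(\<lambda>x. f x * cnj (g x)) \<in> borel_measurable N"
    using assms by (auto intro!: borel_measurable_times measurable_compose[of _ N borel cnj]
        borel_measurable_continuous_onI continuous_intros)
qed (simp add: norm_mult)

lemma sq_int_Cauchy_Schwarz:
  assumes "sq_int N f" "sq_int N g"
  shows "cmod (\<integral>x. f x * cnj (g x) \<partial>N) \<le>
    sqrt (sqnorm N f) * sqrt (sqnorm N g)"
proof -
  have "cmod (\<integral>x. f x * cnj (g x) \<partial>N) \<le> (\<integral>x. cmod (f x * cnj (g x)) \<partial>N)"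
    by (rule integral_norm_bound)
  also have "\<dots> = (\<integral>x. cmod (f x) * cmod (g x) \<partial>N)"
    by (simp add: norm_mult)
  also have "\<dots> \<le> sqrt (sqnorm N f) * sqrt (sqnorm N g)"
    using assms by (intro integral_Cauchy_Schwarz) auto
  finally show ?thesis .
qed

lemma cmod_add_square_le: "(cmod (a + b))\<^sup>2 \<le> 2 * (cmod a)\<^sup>2 + 2 * (cmod b)\<^sup>2"
proof -
  have "(cmod (a + b))\<^sup>2 \<le> (cmod a + cmod b)\<^sup>2"
    by (intro power_mono norm_triangle_ineq) auto
  also have "\<dots> \<le> 2 * (cmod a)\<^sup>2 + 2 * (cmod b)\<^sup>2"
    using sum_squares_bound[of "cmod a" "cmod b"] by (simp add: power2_sum)
  finally show ?thesis .
qed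

lemma sq_int_add:
  assumes "sq_int N f" "sq_int N g"
  shows "sq_int N (\<lambda>x. f x + g x)"
proof -
  have int: "integrable N (\<lambda>x. 2 * (cmod (f x))\<^sup>2 + 2 * (cmod (g x))\<^sup>2)"
    using assms by (simp add: sq_int_def)
  have m: "(\<lambda>x. f x + g x) \<in> borel_measurable N"
    using assms by (auto simp: sq_int_def)
  have "integrable N (\<lambda>x. (cmod (f x + g x))\<^sup>2)"
    by (rule Bochner_Integration.integrable_bound[OF int]) (use m cmod_add_square_le in auto)
  with m show ?thesis
    by (simp add: sq_int_def)
qed

lemma integral_cmod_add_square_le:
  assumes "sq_int N f" "sq_int N g"
  shows "(sqnorm N (\<lambda>x. f x + g x)) \<le> 2 * sqnorm N f + 2 * sqnorm N g"
proof -
  have "(sqnorm N (\<lambda>x. f x + g x)) \<le> (\<integral>x. 2 * (cmod (f x))\<^sup>2 + 2 * (cmod (g x))\<^sup>2 \<partial>N)"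
    using assms sq_int_add[OF assms] by (intro integral_mono cmod_add_square_le) (auto simp: sq_int_def)
  then show ?thesis
    using assms by (simp add: sq_int_def)
qed

lemma sq_int_cmult: "sq_int N f \<Longrightarrow> sq_int N (\<lambda>x. c * f x)"
  by (auto simp: sq_int_def norm_mult power_mult_distrib)

lemma sq_int_diff:
  assumes "sq_int N f" "sq_int N g"
  shows "sq_int N (\<lambda>x. f x - g x)"
  using sq_int_add[OF assms(1) sq_int_cmult[OF assms(2), of "-1"]] by simp

lemma (in finite_measure) sq_int_bounded:
  assumes "f \<in> borel_measurable M" "\<And>x. x \<in> space M \<Longrightarrow> cmod (f x) \<le> C"
  shows "sq_int M f"
  unfolding sq_int_def
proof (intro conjI integrable_const_bound[where B = "C\<^sup>2"] AE_I2)
  fix x assume "x \<in> space M"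
  then show "norm ((cmod (f x))\<^sup>2) \<le> C\<^sup>2"
    using assms(2)[of x] by (simp add: power_mono)
qed (use assms in auto)

lemma L2_inner_tendsto:
  assumes A: "\<And>n. sq_int N (A n)" "sq_int N a" and B: "\<And>n. sq_int N (B n)" "sq_int N b"
    and lim: "(\<lambda>n. sqnorm N (\<lambda>x. A n x - a x)) \<longlonglongrightarrow> 0" "(\<lambda>n. sqnorm N (\<lambda>x. B n x - b x)) \<longlonglongrightarrow> 0"
  shows "(\<lambda>n. \<integral>x. A n x * cnj (B n x) \<partial>N) \<longlonglongrightarrow> (\<integral>x. a x * cnj (b x) \<partial>N)"
proof -
  define \<alpha> where "\<alpha> n = sqrt (sqnorm N (\<lambda>x. A n x - a x))" for n
  define \<beta> where "\<beta> n = sqrt (sqnorm N (\<lambda>x. B n x - b x))" for n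
  define p where "p = sqrt (sqnorm N a)"
  define r where "r = sqrt (sqnorm N b)"
  have "\<alpha> \<longlonglongrightarrow> sqrt 0" "\<beta> \<longlonglongrightarrow> sqrt 0"
    unfolding \<alpha>_def \<beta>_def by (intro tendsto_intros lim)+
  then have "(\<lambda>n. \<alpha> n * \<beta> n + \<alpha> n * r + p * \<beta> n) \<longlonglongrightarrow> 0 * 0 + 0 * r + p * 0"
    by (intro tendsto_intros) auto
  then have *: "(\<lambda>n. \<alpha> n * \<beta> n + \<alpha> n * r + p * \<beta> n) \<longlonglongrightarrow> 0"
    by simp
  have "(\<lambda>n. (\<integral>x. A n x * cnj (B n x) \<partial>N) - (\<integral>x. a x * cnj (b x) \<partial>N)) \<longlonglongrightarrow> 0"
  proof (rule Lim_null_comparison[OF always_eventually *], rule allI)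
    fix n
    note d = sq_int_diff[OF A(1)[of n] A(2)] sq_int_diff[OF B(1)[of n] B(2)]
    have "(\<integral>x. A n x * cnj (B n x) \<partial>N) - (\<integral>x. a x * cnj (b x) \<partial>N) =
       (\<integral>x. A n x * cnj (B n x) - a x * cnj (b x) \<partial>N)"
      using A B by (intro Bochner_Integration.integral_diff[symmetric] sq_int_integrable_mult)
    also have "\<dots> = (\<integral>x. (A n x - a x) * cnj (B n x - b x) + (A n x - a x) * cnj (b x)
        + a x * cnj (B n x - b x) \<partial>N)"
      by (intro Bochner_Integration.integral_cong) (auto simp: algebra_simps)
    also have "\<dots> = (\<integral>x. (A n x - a x) * cnj (B n x - b x) \<partial>N) + (\<integral>x. (A n x - a x) * cnj (b x) \<partial>N)
        + (\<integral>x. a x * cnj (B n x - b x) \<partial>N)"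
      using sq_int_integrable_mult[OF d] sq_int_integrable_mult[OF d(1) B(2)]
        sq_int_integrable_mult[OF A(2) d(2)]
      by (subst Bochner_Integration.integral_add, auto)
    finally have "cmod ((\<integral>x. A n x * cnj (B n x) \<partial>N) - (\<integral>x. a x * cnj (b x) \<partial>N)) \<le>
       cmod (\<integral>x. (A n x - a x) * cnj (B n x - b x) \<partial>N) + cmod (\<integral>x. (A n x - a x) * cnj (b x) \<partial>N) + cmod (\<integral>x. a x * cnj (B n x - b x) \<partial>N)"
      by (simp only:) (intro order_trans[OF norm_triangle_ineq] add_mono norm_triangle_ineq order_refl)
    also have "\<dots> \<le> \<alpha> n * \<beta> n + \<alpha> n * r + p * \<beta> n"
      unfolding \<alpha>_def \<beta>_def p_def r_def using d A B
      by (intro add_mono sq_int_Cauchy_Schwarz)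
    finally show "cmod ((\<integral>x. A n x * cnj (B n x) \<partial>N) - (\<integral>x. a x * cnj (b x) \<partial>N)) \<le>
        \<alpha> n * \<beta> n + \<alpha> n * r + p * \<beta> n" .
  qed
  then show ?thesis
    by (rule LIM_zero_cancel)
qed

text \<open>\<open>corr_form N R a b \<ge> 0\<close> for all multiples of \<open>a\<close> and \<open>b\<close> expresses that the correlation of
  \<open>a\<close> and \<open>b\<close> with respect to \<open>N\<close> is at most \<open>R\<close>.\<close>

definition corr_form :: "'a measure \<Rightarrow> real \<Rightarrow> ('a \<Rightarrow> complex) \<Rightarrow> ('a \<Rightarrow> complex) \<Rightarrow> real" where
  "corr_form N R a b = R * ((sqnorm N a) + sqnorm N b)
     + 2 * Re (\<integral>x. a x * cnj (b x) \<partial>N)"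

text \<open>Closedness under L^2 limits is what allows the inequality to be tested on trigonometric
  polynomials only.\<close>

lemma corr_form_limit:
  assumes A: "\<And>n. sq_int N (A n)" "sq_int N a" and B: "\<And>n. sq_int N (B n)" "sq_int N b"
    and lim: "(\<lambda>n. sqnorm N (\<lambda>x. A n x - a x)) \<longlonglongrightarrow> 0" "(\<lambda>n. sqnorm N (\<lambda>x. B n x - b x)) \<longlonglongrightarrow> 0"
    and nonneg: "\<And>n. 0 \<le> corr_form N R (A n) (B n)"
  shows "0 \<le> corr_form N R a b"
proof -
  have *: "sqnorm N f = Re (\<integral>x. f x * cnj (f x) \<partial>N)" for f
    by (simp add: complex_norm_square[symmetric] del: of_real_power)
  have "(\<lambda>n. corr_form N R (A n) (B n)) \<longlonglongrightarrow> corr_form N R a b"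
    unfolding corr_form_def *
    by (intro tendsto_intros L2_inner_tendsto A B lim)
  then show ?thesis
    using nonneg by (intro LIMSEQ_le_const) auto
qed

section \<open>Density of trigonometric polynomials\<close>

text \<open>Arbitrary real frequencies are allowed, so sums and products of polynomials with
  different periods stay in the class; approximating an interval needs periods that grow.\<close>

definition trig_poly :: "(real \<Rightarrow> complex) \<Rightarrow> bool" where
  "trig_poly q \<longleftrightarrow> (\<exists>S a. finite S \<and> q = (\<lambda>x. \<Sum>u\<in>S. a u * cis (u * x)))"

lemma trig_poly_cis: "trig_poly (\<lambda>x. c * cis (u * x))"
  unfolding trig_poly_def by (rule exI[of _ "{u}"]) auto

lemma trig_poly_const: "trig_poly (\<lambda>x. c)"
  using trig_poly_cis[of c 0] by simp

lemma trig_poly_add: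
  assumes "trig_poly p" "trig_poly q"
  shows "trig_poly (\<lambda>x. p x + q x)"
proof -
  obtain S a where p: "finite S" "p = (\<lambda>x. \<Sum>u\<in>S. a u * cis (u * x))"
    using assms(1) by (auto simp: trig_poly_def)
  obtain T b where q: "finite T" "q = (\<lambda>x. \<Sum>u\<in>T. b u * cis (u * x))"
    using assms(2) by (auto simp: trig_poly_def)
  define c where "c u = (if u \<in> S then a u else 0) + (if u \<in> T then b u else 0)" for u
  have "p x + q x = (\<Sum>u\<in>S\<union>T. c u * cis (u * x))" for x
  proof -
    have "p x = (\<Sum>u\<in>S\<union>T. (if u \<in> S then a u else 0) * cis (u * x))"
      unfolding p(2) using p q by (intro sum.mono_neutral_cong_left) auto
    moreover have "q x = (\<Sum>u\<in>S\<union>T. (if u \<in> T then b u else 0) * cis (u * x))"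
      unfolding q(2) using p q by (intro sum.mono_neutral_cong_left) auto
    ultimately show ?thesis
      by (simp add: c_def distrib_right sum.distrib)
  qed
  with p q show ?thesis
    unfolding trig_poly_def by (intro exI[of _ "S \<union> T"] exI[of _ c]) auto
qed

lemma trig_poly_sum:
  assumes "\<And>i. i \<in> I \<Longrightarrow> trig_poly (p i)"
  shows "trig_poly (\<lambda>x. \<Sum>i\<in>I. p i x)"
  using assms
proof (induction I rule: infinite_finite_induct)
  case (insert i I)
  then show ?case by (simp add: trig_poly_add)
qed (auto simp: trig_poly_const)

lemma trig_poly_mult:
  assumes "trig_poly p" "trig_poly q"
  shows "trig_poly (\<lambda>x. p x * q x)"
proof -
  obtain S a where p: "finite S" "p = (\<lambda>x. \<Sum>u\<in>S. a u * cis (u * x))"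
    using assms(1) by (auto simp: trig_poly_def)
  obtain T b where q: "finite T" "q = (\<lambda>x. \<Sum>u\<in>T. b u * cis (u * x))"
    using assms(2) by (auto simp: trig_poly_def)
  have "p x * q x = (\<Sum>u\<in>S. \<Sum>v\<in>T. (a u * b v) * cis ((u + v) * x))" for x
  proof -
    have "cis ((u + v) * x) = cis (u * x) * cis (v * x)" for u v
      by (simp add: cis_mult distrib_right)
    then show ?thesis
      by (simp add: p q sum_product mult_ac)
  qed
  then show ?thesis
    by (simp only:) (intro trig_poly_sum trig_poly_cis)
qed

lemma trig_poly_cos: "trig_poly (\<lambda>x. of_real (cos (w * (x - c))))"
proof -
  have "complex_of_real (cos (w * (x - c))) =
      (cis (- (w * c)) / 2) * cis (w * x) + (cis (w * c) / 2) * cis ((- w) * x)" for x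
  proof -
    have "complex_of_real (cos t) = (cis t + cis (- t)) / 2" for t
      by (simp add: complex_eq_iff)
    moreover have "cis (w * (x - c)) = cis (- (w * c)) * cis (w * x)"
      "cis (- (w * (x - c))) = cis (w * c) * cis ((- w) * x)"
      by (simp_all add: cis_mult algebra_simps)
    ultimately show ?thesis
      by (simp add: add_divide_distrib)
  qed
  then show ?thesis
    by (simp only:) (intro trig_poly_add trig_poly_cis)
qed

lemma trig_poly_real_polynomial_cos:
  assumes "real_polynomial_function g"
  shows "trig_poly (\<lambda>x. of_real (g (cos (w * (x - c)))))"
  using assms
proof induction
  case (linear f)
  have "f y = f 1 * y" for y
    using linear_cmul[OF bounded_linear.linear[OF linear], of y 1] by simp
  then have "complex_of_real (f (cos (w * (x - c)))) = of_real (f 1) * of_real (cos (w * (x - c)))" for x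
    by (metis of_real_mult)
  then show ?case
    by (simp only:) (intro trig_poly_mult trig_poly_const trig_poly_cos)
qed (simp_all add: trig_poly_const trig_poly_add trig_poly_mult)

lemma trig_poly_bounded:
  assumes "trig_poly q"
  obtains C where "\<And>x. cmod (q x) \<le> C"
proof -
  obtain S a where q: "finite S" "q = (\<lambda>x. \<Sum>u\<in>S. a u * cis (u * x))"
    using assms by (auto simp: trig_poly_def)
  have "cmod (q x) \<le> (\<Sum>u\<in>S. cmod (a u))" for x
    unfolding q by (rule order_trans[OF norm_sum]) (simp add: norm_mult)
  then show ?thesis ..
qed

lemma trig_poly_continuous: "trig_poly q \<Longrightarrow> continuous_on UNIV q"
  by (auto simp: trig_poly_def cis_conv_exp intro!: continuous_intros)

lemma trig_poly_measurable: "trig_poly q \<Longrightarrow> q \<in> borel_measurable borel"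
  by (intro borel_measurable_continuous_onI trig_poly_continuous)

definition trig_approx :: "real measure \<Rightarrow> (real \<Rightarrow> real) \<Rightarrow> bool" where
  "trig_approx m f \<longleftrightarrow> (\<forall>e>0. \<exists>q. trig_poly q \<and> (sqnorm m (\<lambda>x. of_real (f x) - q x)) < e)"

section \<open>Density in L^2 of a finite Borel measure on the line\<close>

locale finite_real_measure = finite_measure m for m :: "real measure" +
  assumes sets_borel [measurable_cong, simp]: "sets m = sets borel"
begin

lemma space_UNIV [simp]: "space m = UNIV"
  using sets_eq_imp_space_eq[OF sets_borel] by simp

lemma trig_poly_sq_int: "trig_poly q \<Longrightarrow> sq_int m q"
  by (metis sq_int_bounded trig_poly_bounded trig_poly_measurable measurable_cong_sets sets_borel)

lemma sq_int_of_real: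
  assumes "f \<in> borel_measurable borel" "integrable m (\<lambda>x. (f x)\<^sup>2)"
  shows "sq_int m (\<lambda>x. of_real (f x))"
  using assms by (auto simp: sq_int_def)

lemma trig_approx_closed:
  assumes f: "f \<in> borel_measurable borel" "integrable m (\<lambda>x. (f x)\<^sup>2)"
    and g: "\<And>e. e > 0 \<Longrightarrow> \<exists>g. g \<in> borel_measurable borel \<and> integrable m (\<lambda>x. (g x)\<^sup>2) \<and> trig_approx m g
      \<and> (\<integral>x. (f x - g x)\<^sup>2 \<partial>m) < e"
  shows "trig_approx m f"
  unfolding trig_approx_def
proof (intro allI impI)
  fix e :: real assume "e > 0"
  then obtain g where g': "g \<in> borel_measurable borel" "integrable m (\<lambda>x. (g x)\<^sup>2)" "trig_approx m g"
     "(\<integral>x. (f x - g x)\<^sup>2 \<partial>m) < e / 4"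
    using g[of "e / 4"] by auto
  then obtain q where q: "trig_poly q" "(sqnorm m (\<lambda>x. of_real (g x) - q x)) < e / 4"
    using \<open>e > 0\<close> by (auto simp: trig_approx_def dest!: spec[of _ "e / 4"])
  note s = sq_int_of_real[OF f] sq_int_of_real[OF g'(1,2)] trig_poly_sq_int[OF q(1)]
  have "(sqnorm m (\<lambda>x. of_real (f x) - q x)) \<le>
      2 * (\<integral>x. (f x - g x)\<^sup>2 \<partial>m) + 2 * (sqnorm m (\<lambda>x. of_real (g x) - q x))"
    using integral_cmod_add_square_le[OF sq_int_diff[OF s(1,2)] sq_int_diff[OF s(2,3)]]
    unfolding of_real_diff[symmetric] norm_of_real power2_abs by simp
  also have "\<dots> < e"
    using g' q by simp
  finally show "\<exists>q. trig_poly q \<and> (sqnorm m (\<lambda>x. of_real (f x) - q x)) < e"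
    using q by blast
qed

lemma trig_approx_limit:
  assumes [measurable]: "f \<in> borel_measurable borel" "\<And>k. F k \<in> borel_measurable borel"
    and F: "\<And>k. trig_approx m (F k)" and lim: "\<And>x. (\<lambda>k. F k x) \<longlonglongrightarrow> f x"
    and g: "\<And>k x. \<bar>F k x\<bar> \<le> g x" "integrable m (\<lambda>x. (g x)\<^sup>2)" "g \<in> borel_measurable borel"
  shows "trig_approx m f"
proof -
  have fg: "\<bar>f x\<bar> \<le> g x" for x
    using g(1)[of _ x] tendsto_rabs[OF lim[of x]] by (intro LIMSEQ_le_const2) auto
  have le: "u\<^sup>2 \<le> v\<^sup>2" if "\<bar>u\<bar> \<le> v" for u v :: real
    using that by (metis abs_ge_zero power2_abs power_mono)
  have int: "integrable m (\<lambda>x. (h x)\<^sup>2)" if [measurable]: "h \<in> borel_measurable borel" and "\<And>x. \<bar>h x\<bar> \<le> g x" for h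
    using that(2) by (intro Bochner_Integration.integrable_bound[OF g(2)]) (auto intro: le)
  have "(\<lambda>k. \<integral>x. (f x - F k x)\<^sup>2 \<partial>m) \<longlonglongrightarrow> (\<integral>x. 0 \<partial>m)"
  proof (rule integral_dominated_convergence[where w = "\<lambda>x. 4 * (g x)\<^sup>2"])
    show "AE x in m. norm ((f x - F k x)\<^sup>2) \<le> 4 * (g x)\<^sup>2" for k
    proof (rule AE_I2)
      fix x
      have "\<bar>f x - F k x\<bar> \<le> 2 * g x"
        using fg[of x] g(1)[of k x] by simp
      from le[OF this] show "norm ((f x - F k x)\<^sup>2) \<le> 4 * (g x)\<^sup>2"
        by (simp add: power_mult_distrib)
    qed
    show "AE x in m. (\<lambda>k. (f x - F k x)\<^sup>2) \<longlonglongrightarrow> 0"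
    proof (rule AE_I2)
      fix x
      have "(\<lambda>k. (f x - F k x)\<^sup>2) \<longlonglongrightarrow> (f x - f x)\<^sup>2"
        by (intro tendsto_intros lim)
      then show "(\<lambda>k. (f x - F k x)\<^sup>2) \<longlonglongrightarrow> 0" by simp
    qed
  qed (use g in auto)
  then have lim0: "(\<lambda>k. \<integral>x. (f x - F k x)\<^sup>2 \<partial>m) \<longlonglongrightarrow> 0"
    by simp
  show ?thesis
  proof (rule trig_approx_closed)
    fix e :: real assume "e > 0"
    then obtain k where "(\<integral>x. (f x - F k x)\<^sup>2 \<partial>m) < e"
      using order_tendstoD(2)[OF lim0, of e] by (auto simp: eventually_sequentially)
    then show "\<exists>g. g \<in> borel_measurable borel \<and> integrable m (\<lambda>x. (g x)\<^sup>2) \<and> trig_approx m g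
      \<and> (\<integral>x. (f x - g x)\<^sup>2 \<partial>m) < e"
      using int[of "F k"] g F by (intro exI[of _ "F k"]) auto
  qed (use int[of f] fg in auto)
qed

lemma trig_approx_cmult:
  assumes "trig_approx m f"
  shows "trig_approx m (\<lambda>x. c * f x)"
  unfolding trig_approx_def
proof (intro allI impI)
  fix e :: real assume "e > 0"
  then have "e / (c\<^sup>2 + 1) > 0"
    by (simp add: add_nonneg_pos)
  then obtain q where q: "trig_poly q" "(sqnorm m (\<lambda>x. of_real (f x) - q x)) < e / (c\<^sup>2 + 1)"
    using assms by (auto simp: trig_approx_def)
  have "(sqnorm m (\<lambda>x. of_real (c * f x) - of_real c * q x)) =
      c\<^sup>2 * (sqnorm m (\<lambda>x. of_real (f x) - q x))"
    by (simp add: norm_mult power_mult_distrib flip: right_diff_distrib)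
  also have "\<dots> \<le> c\<^sup>2 * (e / (c\<^sup>2 + 1))"
    using q by (intro mult_left_mono) auto
  also have "\<dots> < e"
  proof -
    have pos: "0 < c\<^sup>2 + 1" by (simp add: add_nonneg_pos)
    show ?thesis
      unfolding times_divide_eq_right pos_divide_less_eq[OF pos] using \<open>e > 0\<close> by (simp add: distrib_left)
  qed
  finally show "\<exists>q. trig_poly q \<and> (sqnorm m (\<lambda>x. of_real (c * f x) - q x)) < e"
    using trig_poly_mult[OF trig_poly_const q(1)] by blast
qed

lemma trig_approx_add:
  assumes f: "f \<in> borel_measurable borel" "integrable m (\<lambda>x. (f x)\<^sup>2)" "trig_approx m f"
    and g: "g \<in> borel_measurable borel" "integrable m (\<lambda>x. (g x)\<^sup>2)" "trig_approx m g"
  shows "trig_approx m (\<lambda>x. f x + g x)"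
  unfolding trig_approx_def
proof (intro allI impI)
  fix e :: real assume "e > 0"
  then obtain p where p: "trig_poly p" "(sqnorm m (\<lambda>x. of_real (f x) - p x)) < e / 4"
    using f by (auto simp: trig_approx_def dest!: spec[of _ "e / 4"])
  obtain q where q: "trig_poly q" "(sqnorm m (\<lambda>x. of_real (g x) - q x)) < e / 4"
    using \<open>e > 0\<close> g by (auto simp: trig_approx_def dest!: spec[of _ "e / 4"])
  define a where "a x = of_real (f x) - p x" for x
  define b where "b x = of_real (g x) - q x" for x
  have ab: "sq_int m a" "sq_int m b"
    unfolding a_def b_def by (intro sq_int_diff sq_int_of_real f g trig_poly_sq_int p q)+
  have "(sqnorm m (\<lambda>x. a x + b x)) \<le> 2 * sqnorm m a + 2 * sqnorm m b"
    by (rule integral_cmod_add_square_le[OF ab])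
  also have "\<dots> < e"
    using p(2) q(2) by (simp add: a_def b_def)
  finally have "(sqnorm m (\<lambda>x. of_real (f x + g x) - (p x + q x))) < e"
    by (simp add: a_def b_def algebra_simps)
  then show "\<exists>q. trig_poly q \<and> (sqnorm m (\<lambda>x. of_real (f x + g x) - q x)) < e"
    using trig_poly_add[OF p(1) q(1)] by blast
qed

lemma integrable_square_bounded:
  assumes "f \<in> borel_measurable borel" "\<And>x. \<bar>f x\<bar> \<le> C"
  shows "integrable m (\<lambda>x. (f x)\<^sup>2 :: real)"
proof (rule integrable_const_bound[where B = "C\<^sup>2"])
  show "AE x in m. norm ((f x)\<^sup>2) \<le> C\<^sup>2"
  proof (rule AE_I2)
    fix x
    have "\<bar>f x\<bar>\<^sup>2 \<le> C\<^sup>2"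
      by (rule power_mono) (use assms(2) in auto)
    then show "norm ((f x)\<^sup>2) \<le> C\<^sup>2" by simp
  qed
qed (use assms in auto)

lemma trig_approx_const: "trig_approx m (\<lambda>x. c)"
  unfolding trig_approx_def using trig_poly_const[of "of_real c"] by force

text \<open>Weierstrass approximation on [-1, 1] in the variable \<open>cos (w * (x - c))\<close>: a
  polynomial in a cosine is a trigonometric polynomial.\<close>

lemma trig_approx_continuous_cos:
  assumes "continuous_on {-1..1} G"
  shows "trig_approx m (\<lambda>x. G (cos (w * (x - c))))"
  unfolding trig_approx_def
proof (intro allI impI)
  fix e :: real assume "e > 0"
  \<comment> \<open>The \<open>+ 1\<close> keeps \<open>e / K\<close> meaningful for the zero
    measure and makes the last estimate strict.\<close>
  define K where "K = measure m (space m) + 1"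
  have K: "K > 0" by (simp add: K_def add_nonneg_pos)
  define d where "d = sqrt (e / K)"
  have d: "d > 0" using \<open>e > 0\<close> K by (simp add: d_def)
  obtain g where g: "real_polynomial_function g" "\<And>x. x \<in> {-1..1} \<Longrightarrow> \<bar>G x - g x\<bar> < d"
    using Stone_Weierstrass_real_polynomial_function[OF _ assms d] by auto
  have "(sqnorm m (\<lambda>x. of_real (G (cos (w * (x - c)))) - of_real (g (cos (w * (x - c)))))) \<le>
      d\<^sup>2 * measure m (space m)"
  proof (rule order_trans[OF _ eq_refl])
    show "(sqnorm m (\<lambda>x. of_real (G (cos (w * (x - c)))) - of_real (g (cos (w * (x - c)))))) \<le> (\<integral>x. d\<^sup>2 \<partial>m)"
    proof (rule Bochner_Integration.integral_mono')
      fix x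
      have "\<bar>G (cos (w * (x - c))) - g (cos (w * (x - c)))\<bar> \<le> d"
        using g(2)[of "cos (w * (x - c))"] by simp
      then show "(cmod (of_real (G (cos (w * (x - c)))) - of_real (g (cos (w * (x - c))))))\<^sup>2 \<le> d\<^sup>2"
        using d by (simp add: abs_le_square_iff[symmetric] flip: of_real_diff)
    qed auto
  qed (simp add: mult.commute)
  also have "\<dots> < d\<^sup>2 * K"
    using d by (simp add: K_def)
  also have "\<dots> = e"
    using \<open>e > 0\<close> K by (simp add: d_def)
  finally show "\<exists>q. trig_poly q \<and> (sqnorm m (\<lambda>x. of_real (G (cos (w * (x - c)))) - q x)) < e"
    using trig_poly_real_polynomial_cos[OF g(1)] by blast
qed

text \<open>The ramps \<open>G k\<close> are continuous, vanish up to \<open>\<kappa>\<close>, and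
  at each point above \<open>\<kappa>\<close> are eventually 1.\<close>

lemma trig_approx_indicator_cos: "trig_approx m (indicator {x. cos (w * (x - c)) > \<kappa>})"
proof (rule trig_approx_limit[where g = "\<lambda>_. 1"])
  define G where "G k y = min 1 (real k * max 0 (y - \<kappa>))" for k y
  have "continuous_on S (G k)" for S k
    unfolding G_def by (intro continuous_intros)
  then show "trig_approx m (\<lambda>x. G k (cos (w * (x - c))))" for k
    by (rule trig_approx_continuous_cos)
  have [measurable]: "G k \<in> borel_measurable borel" for k
    unfolding G_def by measurable
  show "(\<lambda>x. G k (cos (w * (x - c)))) \<in> borel_measurable borel" for k
    by measurable
  show "indicator {x. \<kappa> < cos (w * (x - c))} \<in> borel_measurable borel"
    by measurable
  show "(\<lambda>k. G k (cos (w * (x - c)))) \<longlonglongrightarrow> indicator {x. \<kappa> < cos (w * (x - c))} x" for x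
  proof (cases "\<kappa> < cos (w * (x - c))")
    case True
    define t where "t = cos (w * (x - c)) - \<kappa>"
    have t: "t > 0" using True by (simp add: t_def)
    obtain k0 where k0: "1 / t < real k0"
      using reals_Archimedean2 by blast
    have "G k (cos (w * (x - c))) = 1" if "k \<ge> k0" for k
    proof -
      have "1 \<le> real k0 * t"
        using k0 t by (simp add: field_simps)
      also have "\<dots> \<le> real k * t"
        using that t by simp
      finally show ?thesis
        using t by (simp add: G_def t_def[symmetric])
    qed
    then have "\<forall>\<^sub>F k in sequentially. G k (cos (w * (x - c))) = indicator {x. \<kappa> < cos (w * (x - c))} x"
      using True by (auto simp: eventually_sequentially)
    then show ?thesis
      by (rule tendsto_eventually)
  qed (simp add: G_def)
  show "\<bar>G k (cos (w * (x - c)))\<bar> \<le> 1" for k x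
    by (auto simp: G_def min_def)
qed auto

text \<open>A superlevel set of a cosine with period \<open>2 * N k\<close> is the union of all
  translates of the interval by multiples of that period. As the period grows, the copies other than
  the one around the midpoint \<open>c\<close> move past any given point.\<close>

lemma trig_approx_indicator_interval: "trig_approx m (indicator {a<..<b})"
proof (cases "a < b")
  case False
  then show ?thesis
    using trig_approx_const[of 0] by (simp add: indicator_def[abs_def])
next
  case True
  define c d where "c = (a + b) / 2" and "d = (b - a) / 2"
  have d: "d > 0" using True by (simp add: d_def)
  \<comment> \<open>Starting at \<open>d\<close> ensures that the half-length \<open>d\<close> never
    exceeds half a period, where the cosine is decreasing and comparison of cosines is comparison of
    distances.\<close>
  define N where "N k = d + real k" for k
  show ?thesis
  proof (rule trig_approx_limit[where g = "\<lambda>_. 1"])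
    show "trig_approx m (indicator {x. cos (pi / N k * (x - c)) > cos (pi / N k * d)})" for k
      by (rule trig_approx_indicator_cos)
    show "(\<lambda>k. indicator {x. cos (pi / N k * (x - c)) > cos (pi / N k * d)} x :: real) \<longlonglongrightarrow> indicator {a<..<b} x" for x
    proof (rule tendsto_eventually)
      obtain k0 where k0: "\<bar>x - c\<bar> < real k0"
        using reals_Archimedean2 by blast
      have "(cos (pi / N k * (x - c)) > cos (pi / N k * d)) \<longleftrightarrow> x \<in> {a<..<b}" if "k \<ge> k0" for k
      proof -
        have N: "N k > 0" "\<bar>x - c\<bar> \<le> N k" "d \<le> N k"
          using that k0 d by (auto simp: N_def)
        have r: "0 \<le> pi / N k * y \<and> pi / N k * y \<le> pi" if "0 \<le> y" "y \<le> N k" for y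
          using that N by (auto simp: field_simps)
        have "cos (pi / N k * (x - c)) = cos (pi / N k * \<bar>x - c\<bar>)"
          by (cases "x \<ge> c") (auto simp: abs_real_def minus_diff_eq[symmetric, of x] simp del: minus_diff_eq)
        also have "\<dots> > cos (pi / N k * d) \<longleftrightarrow> pi / N k * \<bar>x - c\<bar> < pi / N k * d"
          using r[of d] r[of "\<bar>x - c\<bar>"] d N by (intro cos_mono_less_eq) auto
        also have "\<dots> \<longleftrightarrow> \<bar>x - c\<bar> < d"
          using N by (simp add: divide_strict_right_mono field_simps)
        also have "\<dots> \<longleftrightarrow> x \<in> {a<..<b}"
          by (auto simp: c_def d_def abs_real_def field_simps)
        finally show ?thesis .
      qed
      then show "\<forall>\<^sub>F k in sequentially. indicator {x. cos (pi / N k * (x - c)) > cos (pi / N k * d)} x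
          = (indicator {a<..<b} x :: real)"
        by (auto simp: eventually_sequentially indicator_def)
    qed
  qed auto
qed

text \<open>The open intervals are stable under intersection and generate the Borel sets;
  complements use that constants are approximable, and disjoint unions are pointwise limits of
  finite sums bounded by 1.\<close>

lemma trig_approx_indicator:
  assumes "A \<in> sets borel"
  shows "trig_approx m (indicator A)"
proof -
  have borel: "(borel :: real measure) = sigma UNIV (range (\<lambda>(a, b). {a <..< b}))"
    unfolding borel_eq_box by (simp add: box_real split_def)
  have sets: "sets (borel :: real measure) = sigma_sets UNIV (range (\<lambda>(a, b). {a <..< b}))"
    unfolding borel by (simp add: sets_measure_of)
  have "Int_stable (range (\<lambda>(a, b). {a <..< b :: real}))"
    by (auto simp: Int_stable_def)
  moreover have "range (\<lambda>(a, b). {a <..< b :: real}) \<subseteq> Pow UNIV"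
    by simp
  moreover note assms[unfolded sets]
  ultimately show ?thesis
  proof (induction rule: sigma_sets_induct_disjoint)
    case (basic A)
    then show ?case
      using trig_approx_indicator_interval by auto
  next
    case empty
    then show ?case
      using trig_approx_const[of 0] by (simp add: indicator_def[abs_def])
  next
    case (compl A)
    then have A: "A \<in> sets borel" by (simp add: sets)
    have "trig_approx m (\<lambda>x. 1 + (-1) * indicator A x)"
      using A by (intro trig_approx_add trig_approx_const trig_approx_cmult compl
          integrable_square_bounded[of _ 1]) (auto simp: indicator_def)
    also have "(\<lambda>x. 1 + (-1) * indicator A x) = (indicator (UNIV - A) :: real \<Rightarrow> real)"
      by (auto simp: indicator_def)
    finally show ?case .
  next
    case (union A)
    then have A [measurable]: "A i \<in> sets borel" for i by (auto simp: sets)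
    have I: "(\<Sum>i<k. indicator (A i) x) = (indicator (\<Union>i<k. A i) x :: real)" for k x
      using union(1) by (subst indicator_UN_disjoint) (auto simp: disjoint_family_on_def)
    have fin: "trig_approx m (\<lambda>x. \<Sum>i<k. indicator (A i) x)" for k
    proof (induction k)
      case 0
      then show ?case using trig_approx_const[of 0] by simp
    next
      case (Suc k)
      have "integrable m (\<lambda>x. (\<Sum>i<k. indicator (A i) x :: real)\<^sup>2)"
        unfolding I by (rule integrable_square_bounded[of _ 1]) (auto simp: indicator_def)
      moreover have "integrable m (\<lambda>x. (indicator (A k) x :: real)\<^sup>2)"
        by (rule integrable_square_bounded[of _ 1]) (auto simp: indicator_def)
      ultimately show ?case
        using Suc union(3)[of k] by (simp add: trig_approx_add)
    qed
    show ?case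
    proof (rule trig_approx_limit[where g = "\<lambda>_. 1", OF _ _ fin])
      show "(\<lambda>k. \<Sum>i<k. indicator (A i) x :: real) \<longlonglongrightarrow> indicator (\<Union>i. A i) x" for x
        unfolding I by (rule LIMSEQ_indicator_UN)
      show "\<bar>\<Sum>i<k. indicator (A i) x\<bar> \<le> (1::real)" for k x
        unfolding I by (simp add: indicator_def)
    qed auto
  qed
qed

lemma trig_approx_nonneg:
  assumes "f \<in> borel_measurable borel" "\<And>x. 0 \<le> f x" "integrable m (\<lambda>x. (f x)\<^sup>2)"
  shows "trig_approx m f"
  using assms(1,2,3)
proof (induction rule: borel_measurable_induct_real)
  case (set A)
  then show ?case by (simp add: trig_approx_indicator)
next
  case (mult u c)
  show ?case
  proof (cases "c = 0")
    case True
    then show ?thesis using trig_approx_const[of 0] by simp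
  next
    case False
    then show ?thesis using mult by (intro trig_approx_cmult mult) (simp add: power_mult_distrib)
  qed
next
  case (add u v)
  have "integrable m (\<lambda>x. (u x)\<^sup>2)" "integrable m (\<lambda>x. (v x)\<^sup>2)"
    using add by (auto intro!: Bochner_Integration.integrable_bound[OF add.prems] power_mono AE_I2)
  then show ?case
    using add by (auto simp: add.commute intro!: trig_approx_add)
next
  case (seq U)
  have le: "U k x \<le> f x" for k x
    using seq.hyps by (intro incseq_le) (auto simp: incseq_def le_fun_def)
  have "integrable m (\<lambda>x. (U k x)\<^sup>2)" for k
    using seq.hyps le by (auto intro!: Bochner_Integration.integrable_bound[OF seq.prems] power_mono AE_I2)
  then have "trig_approx m (U k)" for k
    by (rule seq.IH)
  note approx = this
  have [measurable]: "U k \<in> borel_measurable borel" for k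
    using seq.hyps by simp
  show ?case
  proof (rule trig_approx_limit[of _ U f, OF assms(1) _ approx])
    show "\<bar>U k x\<bar> \<le> f x" for k x
      using le seq.hyps by (simp add: abs_of_nonneg)
  qed (use seq assms(1) in auto)
qed

lemma trig_approx:
  assumes [measurable]: "f \<in> borel_measurable borel" and f: "integrable m (\<lambda>x. (f x)\<^sup>2)"
  shows "trig_approx m f"
proof -
  have le: "(max 0 y)\<^sup>2 \<le> y\<^sup>2" for y :: real
    by (auto simp: max_def)
  have i: "integrable m (\<lambda>x. (max 0 (f x))\<^sup>2)" "integrable m (\<lambda>x. (max 0 (- f x))\<^sup>2)"
    using le[of "f _"] le[of "- f _"]
    by (auto intro!: Bochner_Integration.integrable_bound[OF f] AE_I2)
  have "trig_approx m (\<lambda>x. max 0 (f x) + (-1) * max 0 (- f x))"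
    using i by (intro trig_approx_add trig_approx_cmult trig_approx_nonneg) (auto simp: power_mult_distrib)
  also have "(\<lambda>x. max 0 (f x) + (-1) * max 0 (- f x)) = f"
    by (auto simp: max_def)
  finally show ?thesis .
qed

lemma trig_poly_dense:
  assumes "f \<in> borel_measurable borel" "integrable m (\<lambda>x. (f x)\<^sup>2)"
  obtains q where "\<And>n. trig_poly (q n)" "(\<lambda>n. sqnorm m (\<lambda>x. of_real (f x) - q n x)) \<longlonglongrightarrow> 0"
proof -
  have "\<forall>n. \<exists>q. trig_poly q \<and> (sqnorm m (\<lambda>x. of_real (f x) - q x)) < 1 / real (Suc n)"
    using trig_approx[OF assms] unfolding trig_approx_def by simp
  then obtain q where q: "\<And>n. trig_poly (q n)"
      "\<And>n. (sqnorm m (\<lambda>x. of_real (f x) - q n x)) < 1 / real (Suc n)"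
    by metis
  have "(\<lambda>n. sqnorm m (\<lambda>x. of_real (f x) - q n x)) \<longlonglongrightarrow> 0"
  proof (rule tendsto_sandwich[OF _ _ tendsto_const LIMSEQ_Suc[OF lim_1_over_n]])
    show "\<forall>\<^sub>F n in sequentially. (sqnorm m (\<lambda>x. of_real (f x) - q n x)) \<le> 1 / real (Suc n)"
      using q(2) by (intro always_eventually allI less_imp_le)
  qed simp
  with q(1) show ?thesis ..
qed

end

section \<open>The Levy measure in polar coordinates\<close>

definition radial :: "real \<Rightarrow> real measure" where
  "radial \<alpha> = density lborel (\<lambda>r. ennreal (1 / r powr (1 + \<alpha>)) * indicator {0<..} r)"

lemma radial_density_real: "radial \<alpha> = density lborel (\<lambda>r. ennreal (1 / r powr (1 + \<alpha>) * indicator {0<..} r))"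
  unfolding radial_def by (intro density_cong) (auto simp: indicator_def)

lemma sets_radial [measurable_cong, simp]: "sets (radial \<alpha>) = sets borel"
  by (simp add: radial_def)

lemma space_radial [simp]: "space (radial \<alpha>) = UNIV"
  by (simp add: radial_def)

lemma nn_integral_radial:
  assumes [measurable]: "f \<in> borel_measurable borel"
  shows "(\<integral>\<^sup>+r. f r \<partial>radial \<alpha>) = (\<integral>\<^sup>+r. ennreal (1 / r powr (1 + \<alpha>)) * indicator {0<..} r * f r \<partial>lborel)"
  unfolding radial_def by (subst nn_integral_density) auto

lemma sigma_finite_radial: "sigma_finite_measure (radial \<alpha>)"
  unfolding radial_def
  by (subst sigma_finite_measure.sigma_finite_iff_density_finite[OF sigma_finite_lborel])
    (auto simp: indicator_def)

lemma AE_radial_pos: "AE r in radial \<alpha>. r > 0"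
  unfolding radial_def by (subst AE_density) (auto simp: indicator_def)

text \<open>Self-similarity of index \<alpha>: the substitution contributes the factor
  \<open>c\<close> and the density the factor \<open>1 / c powr (1 + \<alpha>)\<close>.\<close>

lemma nn_integral_radial_scale:
  assumes c: "c > 0" and [measurable]: "f \<in> borel_measurable borel"
  shows "(\<integral>\<^sup>+r. f (c * r) \<partial>radial \<alpha>) = ennreal (c powr \<alpha>) * (\<integral>\<^sup>+r. f r \<partial>radial \<alpha>)"
proof -
  have "(\<integral>\<^sup>+r. f r \<partial>radial \<alpha>) =
      \<bar>c\<bar> * (\<integral>\<^sup>+r. ennreal (1 / (c * r) powr (1 + \<alpha>)) * indicator {0<..} (c * r) * f (c * r) \<partial>lborel)"
    using c nn_integral_real_affine[of "\<lambda>r. ennreal (1 / r powr (1 + \<alpha>)) * indicator {0<..} r * f r" c 0]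
    by (simp add: nn_integral_radial)
  also have "(\<integral>\<^sup>+r. ennreal (1 / (c * r) powr (1 + \<alpha>)) * indicator {0<..} (c * r) * f (c * r) \<partial>lborel) =
     (\<integral>\<^sup>+r. ennreal (1 / c powr (1 + \<alpha>)) * (ennreal (1 / r powr (1 + \<alpha>)) * indicator {0<..} r * f (c * r)) \<partial>lborel)"
    using c by (intro nn_integral_cong)
      (auto simp: indicator_def powr_mult zero_less_mult_iff mult.assoc[symmetric] ennreal_mult'[symmetric])
  also have "\<dots> = ennreal (1 / c powr (1 + \<alpha>)) * (\<integral>\<^sup>+r. f (c * r) \<partial>radial \<alpha>)"
    by (subst nn_integral_cmult) (auto simp: nn_integral_radial)
  finally have "(\<integral>\<^sup>+r. f r \<partial>radial \<alpha>) = ennreal (c / c powr (1 + \<alpha>)) * (\<integral>\<^sup>+r. f (c * r) \<partial>radial \<alpha>)"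
    using c by (simp add: mult.assoc[symmetric] ennreal_mult'[symmetric])
  also have "c / c powr (1 + \<alpha>) = 1 / c powr \<alpha>"
    using c by (simp add: powr_add)
  finally show ?thesis
    using c by (simp add: mult.assoc[symmetric] ennreal_mult'[symmetric])
qed

lemma distr_radial_scale:
  assumes c: "c > 0"
  shows "distr (radial \<alpha>) borel (\<lambda>r. c * r) = density (radial \<alpha>) (\<lambda>_. ennreal (c powr \<alpha>))"
proof (rule measure_eqI)
  fix A assume "A \<in> sets (distr (radial \<alpha>) borel (\<lambda>r. c * r))"
  then have A [measurable]: "A \<in> sets borel" by simp
  have "emeasure (distr (radial \<alpha>) borel (\<lambda>r. c * r)) A = (\<integral>\<^sup>+r. indicator A r \<partial>distr (radial \<alpha>) borel (\<lambda>r. c * r))"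
    by simp
  also have "\<dots> = (\<integral>\<^sup>+r. indicator A (c * r) \<partial>radial \<alpha>)"
    by (subst nn_integral_distr) auto
  also have "\<dots> = emeasure (density (radial \<alpha>) (\<lambda>_. ennreal (c powr \<alpha>))) A"
    by (simp add: nn_integral_radial_scale c emeasure_density nn_integral_cmult)
  finally show "emeasure (distr (radial \<alpha>) borel (\<lambda>r. c * r)) A = emeasure (density (radial \<alpha>) (\<lambda>_. ennreal (c powr \<alpha>))) A" .
qed simp

lemma radial_scale:
  fixes f :: "real \<Rightarrow> 'b :: {banach, second_countable_topology}"
  assumes c: "c > 0" and [measurable]: "f \<in> borel_measurable borel"
  shows "(\<integral>r. f (c * r) \<partial>radial \<alpha>) = c powr \<alpha> *\<^sub>R (\<integral>r. f r \<partial>radial \<alpha>)"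
    and "integrable (radial \<alpha>) (\<lambda>r. f (c * r)) \<longleftrightarrow> integrable (radial \<alpha>) f"
proof -
  have "(\<integral>r. f (c * r) \<partial>radial \<alpha>) = (\<integral>r. f r \<partial>distr (radial \<alpha>) borel (\<lambda>r. c * r))"
    by (subst integral_distr) auto
  also have "\<dots> = (\<integral>r. c powr \<alpha> *\<^sub>R f r \<partial>radial \<alpha>)"
    unfolding distr_radial_scale[OF c] by (subst integral_density) auto
  finally show "(\<integral>r. f (c * r) \<partial>radial \<alpha>) = c powr \<alpha> *\<^sub>R (\<integral>r. f r \<partial>radial \<alpha>)"
    by simp
  have "integrable (radial \<alpha>) (\<lambda>r. f (c * r)) \<longleftrightarrow> integrable (distr (radial \<alpha>) borel (\<lambda>r. c * r)) f"
    by (subst integrable_distr_eq) auto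
  also have "\<dots> \<longleftrightarrow> integrable (radial \<alpha>) (\<lambda>r. c powr \<alpha> *\<^sub>R f r)"
    unfolding distr_radial_scale[OF c] by (subst integrable_density) auto
  also have "\<dots> \<longleftrightarrow> integrable (radial \<alpha>) f"
  proof
    assume "integrable (radial \<alpha>) (\<lambda>r. c powr \<alpha> *\<^sub>R f r)"
    then have "integrable (radial \<alpha>) (\<lambda>r. (1 / c powr \<alpha>) *\<^sub>R (c powr \<alpha> *\<^sub>R f r))"
      by (rule integrable_scaleR_right)
    then show "integrable (radial \<alpha>) f"
      using c by simp
  qed (rule integrable_scaleR_right)
  finally show "integrable (radial \<alpha>) (\<lambda>r. f (c * r)) \<longleftrightarrow> integrable (radial \<alpha>) f" .
qed

text \<open>The two bounds on \<alpha> serve the two ends: \<alpha> < 2 makes r powr (1 - \<alpha>)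
  integrable at 0, and \<alpha> > 0 makes r powr (-1 - \<alpha>) integrable at infinity.\<close>

lemma integrable_radial_min:
  assumes \<alpha>: "0 < \<alpha>" "\<alpha> < 2"
  shows "integrable (radial \<alpha>) (\<lambda>r. min 1 (r\<^sup>2))"
proof -
  have 1: "(\<integral>\<^sup>+r. ennreal (r powr (1 - \<alpha>)) * indicator {0..1} r \<partial>lborel) < \<infinity>"
  proof -
    have "((\<lambda>r::real. r powr (1 - \<alpha>)) has_integral 1 powr (1 - \<alpha> + 1) / (1 - \<alpha> + 1)) {0..1}"
      using \<alpha> by (intro has_integral_powr_from_0) auto
    then have "(\<integral>\<^sup>+r. ennreal (indicator {0..1} r * r powr (1 - \<alpha>)) \<partial>lborel) = ennreal (1 powr (1 - \<alpha> + 1) / (1 - \<alpha> + 1))"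
      by (intro nn_integral_has_integral_lebesgue) auto
    moreover have "(\<integral>\<^sup>+r. ennreal (r powr (1 - \<alpha>)) * indicator {0..1} r \<partial>lborel) =
        (\<integral>\<^sup>+r. ennreal (indicator {0..1} r * r powr (1 - \<alpha>)) \<partial>lborel)"
      by (intro nn_integral_cong) (auto simp: indicator_def)
    ultimately show ?thesis
      by simp
  qed
  have 2: "(\<integral>\<^sup>+r. ennreal (1 / r powr (1 + \<alpha>)) * indicator {1..} r \<partial>lborel) < \<infinity>"
  proof -
    have "(\<integral>\<^sup>+r. ennreal (1 / r powr (1 + \<alpha>)) * indicator {1..} r \<partial>lborel) = ennreal (0 - (- (1 powr (-\<alpha>)) / \<alpha>))"
    proof (rule nn_integral_FTC_atLeast)
      show "((\<lambda>r. - (r powr (-\<alpha>)) / \<alpha>) has_real_derivative 1 / x powr (1 + \<alpha>)) (at x)" if "1 \<le> x" for x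
        using that \<alpha> by (auto intro!: derivative_eq_intros simp: powr_minus powr_diff powr_add field_simps)
      have "((\<lambda>r. - (r powr (-\<alpha>)) / \<alpha>) \<longlongrightarrow> - 0 / \<alpha>) at_top"
        using \<alpha> by (intro tendsto_intros tendsto_neg_powr filterlim_ident) auto
      then show "((\<lambda>r. - (r powr (-\<alpha>)) / \<alpha>) \<longlongrightarrow> 0) at_top"
        by simp
    qed auto
    then show ?thesis by simp
  qed
  have "(\<integral>\<^sup>+r. ennreal (min 1 (r\<^sup>2)) \<partial>radial \<alpha>) \<le>
      (\<integral>\<^sup>+r. ennreal (r powr (1 - \<alpha>)) * indicator {0..1} r + ennreal (1 / r powr (1 + \<alpha>)) * indicator {1..} r \<partial>lborel)"
    unfolding nn_integral_radial[of "\<lambda>r. ennreal (min 1 (r\<^sup>2))", simplified]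
  proof (intro nn_integral_mono)
    fix r :: real
    consider "r \<le> 0" | "0 < r" "r \<le> 1" | "r > 1" by linarith
    then show "ennreal (1 / r powr (1 + \<alpha>)) * indicator {0<..} r * ennreal (min 1 (r\<^sup>2)) \<le>
      ennreal (r powr (1 - \<alpha>)) * indicator {0..1} r + ennreal (1 / r powr (1 + \<alpha>)) * indicator {1..} r"
    proof cases
      case 2
      have "1 / r powr (1 + \<alpha>) * r\<^sup>2 = r powr (1 - \<alpha>)"
        using 2 by (simp add: powr_add powr_diff powr_numeral[symmetric] power2_eq_square)
      moreover have "min 1 (r\<^sup>2) = r\<^sup>2"
        using 2 by (intro min_absorb2 power_le_one) auto
      ultimately show ?thesis
        using 2 by (simp add: ennreal_mult'[symmetric] indicator_def)
    next
      case 3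
      then have "min 1 (r\<^sup>2) = 1"
        by (simp add: min_def)
      with 3 show ?thesis by simp
    qed simp
  qed
  also have "\<dots> < \<infinity>"
    using 1 2 by (subst nn_integral_add) auto
  finally show ?thesis
    by (intro integrableI_bounded) auto
qed

text \<open>Against the radial density the power r powr \<alpha> becomes 1 / r; this logarithm is
  the normalization by which the lower bound is divided.\<close>

lemma radial_window:
  assumes "0 < a" "a \<le> b"
  shows "has_bochner_integral (radial \<alpha>) (\<lambda>r. r powr \<alpha> * indicator {a..b} r) (ln b - ln a)"
proof -
  have "has_bochner_integral lborel (\<lambda>r. (1 / r) * indicator {a..b} r) (ln b - ln a)"
    using assms by (intro has_bochner_integral_FTC_Icc_real) (auto intro!: derivative_eq_intros continuous_intros)
  also have "(\<lambda>r. (1 / r) * indicator {a..b} r) =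
     (\<lambda>r. (1 / r powr (1 + \<alpha>) * indicator {0<..} r) *\<^sub>R (r powr \<alpha> * indicator {a..b} r))"
    using assms by (auto simp: fun_eq_iff indicator_def powr_add field_simps)
  finally show ?thesis
    unfolding radial_density_real by (intro has_bochner_integral_density) auto
qed

text \<open>Signs are encoded as \<open>s = 1\<close> and \<open>s = -1\<close>; since \<open>0 powr \<beta> = 0\<close>, the power below vanishes unless
  \<open>y\<close> has sign \<open>s\<close>.\<close>

definition ppow :: "real \<Rightarrow> real \<Rightarrow> real \<Rightarrow> real" where
  "ppow \<beta> s y = max 0 (s * y) powr \<beta>"

lemma ppow_nonneg [simp]: "0 \<le> ppow \<beta> s y"
  by (simp add: ppow_def)

lemma ppow_measurable [measurable]: "ppow \<beta> s \<in> borel_measurable borel"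
  unfolding ppow_def by measurable

lemma ppow_le_one: "0 \<le> \<beta> \<Longrightarrow> \<bar>s * y\<bar> \<le> 1 \<Longrightarrow> ppow \<beta> s y \<le> 1"
  unfolding ppow_def by (intro powr_le1) auto

lemma ppow_half_square: "(ppow (\<beta> / 2) s y)\<^sup>2 = ppow \<beta> s y"
  by (simp add: ppow_def power2_eq_square powr_add[symmetric])

abbreviation signs :: "real set" where "signs \<equiv> {1, -1}"

lemma sum_signs: "(\<Sum>s\<in>signs. f s) = f 1 + f (-1)"
  by simp

lemma ppow_cases:
  obtains (pos) "x > 0" "\<And>\<beta>. ppow \<beta> 1 x = x powr \<beta>" "\<And>\<beta>. ppow \<beta> (-1) x = 0"
  | (neg) "x < 0" "\<And>\<beta>. ppow \<beta> 1 x = 0" "\<And>\<beta>. ppow \<beta> (-1) x = (-x) powr \<beta>"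
  | (zero) "x = 0" "\<And>\<beta> s. ppow \<beta> s x = 0"
  by (cases "x > 0"; cases "x < 0") (auto simp: ppow_def)

lemma borel_measurable_fst_snd:
  assumes "f \<in> borel_measurable borel"
  shows "(\<lambda>z :: real \<times> real. f (fst z)) \<in> borel_measurable borel"
    and "(\<lambda>z :: real \<times> real. f (snd z)) \<in> borel_measurable borel"
  by (rule measurable_compose[OF _ assms], simp add: borel_measurable_continuous_onI continuous_on_fst continuous_on_snd)+

locale stable_spectrum =
  fixes \<alpha> :: real and \<tau> :: "real measure"
  assumes \<alpha>: "0 < \<alpha>" "\<alpha> < 2" and spectral: "spectral_measure \<tau>"
begin

abbreviation \<nu> :: "(real \<times> real) measure" where
  "\<nu> \<equiv> stable_levy_measure \<alpha> \<tau>"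

sublocale tau: finite_measure \<tau>
  using spectral by (simp add: spectral_measure_def)

sublocale rad: sigma_finite_measure "radial \<alpha>"
  by (rule sigma_finite_radial)

sublocale tau_rad: pair_sigma_finite \<tau> "radial \<alpha>" ..

lemma measurable_tau:
  assumes "f \<in> borel \<rightarrow>\<^sub>M N"
  shows "f \<in> \<tau> \<rightarrow>\<^sub>M N"
proof -
  have "sets \<tau> = sets (restrict_space borel {0..<2 * pi})"
    using spectral unfolding spectral_measure_def circle_borel_def by blast
  from measurable_cong_sets[OF this refl] show ?thesis
    using measurable_restrict_space1[OF assms] by blast
qed

lemma cos_sin_measurable_tau [measurable]: "cos \<in> borel_measurable \<tau>" "sin \<in> borel_measurable \<tau>"
  by (rule measurable_tau, measurable)+

lemma space_tau: "space \<tau> = {0..<2 * pi}"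
  using spectral sets_eq_imp_space_eq[of \<tau> circle_borel]
  by (auto simp: spectral_measure_def circle_borel_def space_restrict_space)

definition polar :: "real \<times> real \<Rightarrow> real \<times> real" where
  "polar p = (snd p * cos (fst p), snd p * sin (fst p))"

lemma polar_measurable [measurable]: "polar \<in> \<tau> \<Otimes>\<^sub>M radial \<alpha> \<rightarrow>\<^sub>M borel"
proof -
  have [measurable]: "(\<lambda>p. cos (fst p)) \<in> borel_measurable (\<tau> \<Otimes>\<^sub>M radial \<alpha>)"
    "(\<lambda>p. sin (fst p)) \<in> borel_measurable (\<tau> \<Otimes>\<^sub>M radial \<alpha>)"
    "snd \<in> borel_measurable (\<tau> \<Otimes>\<^sub>M radial \<alpha>)"
    using measurable_compose[OF measurable_fst cos_sin_measurable_tau(1)]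
      measurable_compose[OF measurable_fst cos_sin_measurable_tau(2)]
      measurable_snd[of \<tau> "radial \<alpha>"] measurable_cong_sets[OF refl sets_radial]
    by blast+
  show ?thesis
    unfolding polar_def borel_prod[symmetric] by measurable
qed

lemma levy_eq_distr: "\<nu> = distr (\<tau> \<Otimes>\<^sub>M radial \<alpha>) borel polar"
proof -
  have "\<tau> \<Otimes>\<^sub>M radial \<alpha> = density \<tau> (\<lambda>_. 1) \<Otimes>\<^sub>M radial \<alpha>"
    by (simp add: density_1)
  also have "\<dots> = density (\<tau> \<Otimes>\<^sub>M lborel) (\<lambda>(\<theta>, r). 1 * (ennreal (1 / r powr (1 + \<alpha>)) * indicator {0<..} r))"
    unfolding radial_def
    by (rule pair_measure_density) (auto simp: sigma_finite_lborel sigma_finite_radial[unfolded radial_def])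
  finally show ?thesis
    unfolding stable_levy_measure_def polar_def by (simp add: split_def)
qed

lemma sets_levy [measurable_cong, simp]: "sets \<nu> = sets borel"
  by (simp add: levy_eq_distr)

lemma integrable_pair_min: "integrable (\<tau> \<Otimes>\<^sub>M radial \<alpha>) (\<lambda>p. min 1 ((snd p)\<^sup>2))"
proof (rule integrableI_bounded)
  have "(\<integral>\<^sup>+p. ennreal (norm (min 1 ((snd p)\<^sup>2))) \<partial>(\<tau> \<Otimes>\<^sub>M radial \<alpha>)) =
      (\<integral>\<^sup>+\<theta>. (\<integral>\<^sup>+r. ennreal (min 1 (r\<^sup>2)) \<partial>radial \<alpha>) \<partial>\<tau>)"
    by (subst rad.nn_integral_fst[symmetric]) auto
  also have "\<dots> = (\<integral>\<^sup>+r. ennreal (min 1 (r\<^sup>2)) \<partial>radial \<alpha>) * emeasure \<tau> (space \<tau>)"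
    by simp
  also have "\<dots> < \<infinity>"
  proof -
    have "emeasure \<tau> (space \<tau>) < \<top>"
      by (simp add: less_top[symmetric])
    then show ?thesis
      using integrable_radial_min[OF \<alpha>] by (simp add: integrable_iff_bounded ennreal_mult_less_top)
  qed
  finally show "(\<integral>\<^sup>+p. ennreal (norm (min 1 ((snd p)\<^sup>2))) \<partial>(\<tau> \<Otimes>\<^sub>M radial \<alpha>)) < \<infinity>" .
qed measurable

lemma integrable_levyI:
  fixes f :: "real \<times> real \<Rightarrow> 'b :: {banach, second_countable_topology}"
  assumes [measurable]: "f \<in> borel_measurable borel"
    and le: "\<And>z. norm (f z) \<le> C * min 1 ((fst z)\<^sup>2 + (snd z)\<^sup>2)"
  shows "integrable \<nu> f"
proof -
  have "integrable (\<tau> \<Otimes>\<^sub>M radial \<alpha>) (\<lambda>p. f (polar p))"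
  proof (rule Bochner_Integration.integrable_bound)
    show "integrable (\<tau> \<Otimes>\<^sub>M radial \<alpha>) (\<lambda>p. C * min 1 ((snd p)\<^sup>2))"
      by (intro integrable_mult_right integrable_pair_min)
    have "(fst (polar p))\<^sup>2 + (snd (polar p))\<^sup>2 = (snd p)\<^sup>2" for p
      by (simp add: polar_def power_mult_distrib flip: distrib_left)
    then show "AE p in \<tau> \<Otimes>\<^sub>M radial \<alpha>. norm (f (polar p)) \<le> norm (C * min 1 ((snd p)\<^sup>2))"
      using le by (intro AE_I2) (metis abs_ge_self order_trans real_norm_def)
  qed measurable
  then show ?thesis
    unfolding levy_eq_distr by (subst integrable_distr_eq) auto
qed

lemma integral_levy:
  fixes f :: "real \<times> real \<Rightarrow> 'b :: {banach, second_countable_topology}"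
  assumes "integrable \<nu> f"
  shows "(\<integral>z. f z \<partial>\<nu>) = (\<integral>\<theta>. (\<integral>r. f (r * cos \<theta>, r * sin \<theta>) \<partial>radial \<alpha>) \<partial>\<tau>)"
    and "integrable \<tau> (\<lambda>\<theta>. \<integral>r. f (r * cos \<theta>, r * sin \<theta>) \<partial>radial \<alpha>)"
proof -
  have [measurable]: "f \<in> borel_measurable borel"
    using assms by (auto dest: borel_measurable_integrable)
  have int: "integrable (\<tau> \<Otimes>\<^sub>M radial \<alpha>) (\<lambda>p. f (polar p))"
    using assms unfolding levy_eq_distr by (subst (asm) integrable_distr_eq) auto
  have "(\<integral>z. f z \<partial>\<nu>) = (\<integral>p. f (polar p) \<partial>(\<tau> \<Otimes>\<^sub>M radial \<alpha>))"
    unfolding levy_eq_distr by (subst integral_distr) auto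
  also have "\<dots> = (\<integral>\<theta>. (\<integral>r. f (r * cos \<theta>, r * sin \<theta>) \<partial>radial \<alpha>) \<partial>\<tau>)"
    by (subst tau_rad.integral_fst'[OF int, symmetric]) (simp add: polar_def)
  finally show "(\<integral>z. f z \<partial>\<nu>) = (\<integral>\<theta>. (\<integral>r. f (r * cos \<theta>, r * sin \<theta>) \<partial>radial \<alpha>) \<partial>\<tau>)" .
  show "integrable \<tau> (\<lambda>\<theta>. \<integral>r. f (r * cos \<theta>, r * sin \<theta>) \<partial>radial \<alpha>)"
    using tau_rad.integrable_fst'[OF int] by (simp add: polar_def)
qed

lemma levy_scale:
  fixes f :: "real \<times> real \<Rightarrow> 'b :: {banach, second_countable_topology}"
  assumes c: "c > 0" and f: "integrable \<nu> f" "integrable \<nu> (\<lambda>z. f (c * fst z, c * snd z))"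
  shows "(\<integral>z. f (c * fst z, c * snd z) \<partial>\<nu>) = c powr \<alpha> *\<^sub>R (\<integral>z. f z \<partial>\<nu>)"
proof -
  have [measurable]: "f \<in> borel_measurable borel"
    using f(1) by (auto dest: borel_measurable_integrable)
  have "(\<integral>r. f (c * (r * cos \<theta>), c * (r * sin \<theta>)) \<partial>radial \<alpha>) =
      c powr \<alpha> *\<^sub>R (\<integral>r. f (r * cos \<theta>, r * sin \<theta>) \<partial>radial \<alpha>)" for \<theta>
  proof -
    have "(\<lambda>r. (r * cos \<theta>, r * sin \<theta>)) \<in> borel \<rightarrow>\<^sub>M (borel :: (real \<times> real) measure)"
      unfolding borel_prod[symmetric] by measurable
    then have "(\<lambda>r. f (r * cos \<theta>, r * sin \<theta>)) \<in> borel_measurable borel"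
      by measurable
    from radial_scale(1)[OF c this] show ?thesis
      by (simp add: mult.assoc)
  qed
  then show ?thesis
    unfolding integral_levy(1)[OF f(1)] integral_levy(1)[OF f(2)] by simp
qed

text \<open>A ray sees \<open>h\<close> only on the half-line with the sign of \<open>c\<close>,
  rescaled by \<open>\<bar>c\<bar>\<close>, so at most one of the two summands is nonzero. For
  \<open>c = 0\<close> both sides vanish because \<open>h 0 = 0\<close>.\<close>

lemma radial_ray:
  fixes h :: "real \<Rightarrow> real"
  assumes [measurable]: "h \<in> borel_measurable borel" and "h 0 = 0"
  shows "(\<integral>r. h (r * c) \<partial>radial \<alpha>) = (\<Sum>s\<in>signs. ppow \<alpha> s c * (\<integral>r. h (s * r) \<partial>radial \<alpha>))"
proof (cases rule: ppow_cases[of c])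
  case pos
  then show ?thesis
    using radial_scale(1)[of c h \<alpha>] by (simp add: mult.commute)
next
  case neg
  then show ?thesis
    using radial_scale(1)[of "- c" "\<lambda>r. h (- r)" \<alpha>] by (simp add: mult.commute)
next
  case zero
  then show ?thesis
    using assms by simp
qed

text \<open>\<open>Dx\<close>, \<open>Dy\<close> and \<open>Cxy\<close> are the constants of the
  theorem indexed by signs. Arcs are replaced by powers of positive parts, which vanish off the arc,
  so one formula serves all signs; the identification is \<open>arc_integrals\<close>.\<close>

definition Dx :: "real \<Rightarrow> real" where "Dx s = (\<integral>\<theta>. ppow \<alpha> s (cos \<theta>) \<partial>\<tau>)"
definition Dy :: "real \<Rightarrow> real" where "Dy s = (\<integral>\<theta>. ppow \<alpha> s (sin \<theta>) \<partial>\<tau>)"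
definition Cxy :: "real \<Rightarrow> real \<Rightarrow> real" where
  "Cxy s t = (\<integral>\<theta>. ppow (\<alpha> / 2) s (cos \<theta>) * ppow (\<alpha> / 2) t (sin \<theta>) \<partial>\<tau>)"

lemma integrable_ppow:
  assumes "s \<in> signs" "0 \<le> \<beta>"
  shows "integrable \<tau> (\<lambda>\<theta>. ppow \<beta> s (cos \<theta>))" "integrable \<tau> (\<lambda>\<theta>. ppow \<beta> s (sin \<theta>))"
proof -
  have "ppow \<beta> s (cos \<theta>) \<le> 1" "ppow \<beta> s (sin \<theta>) \<le> 1" for \<theta>
    using assms by (auto intro!: ppow_le_one simp: abs_mult)
  then show "integrable \<tau> (\<lambda>\<theta>. ppow \<beta> s (cos \<theta>))" "integrable \<tau> (\<lambda>\<theta>. ppow \<beta> s (sin \<theta>))"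
    by (auto intro!: tau.integrable_const_bound[where B = 1])
qed

lemma integrable_ppow_mult:
  assumes "s \<in> signs" "t \<in> signs"
  shows "integrable \<tau> (\<lambda>\<theta>. ppow (\<alpha> / 2) s (cos \<theta>) * ppow (\<alpha> / 2) t (sin \<theta>))"
  using assms \<alpha> by (intro integrable_mult_of_squares) (auto simp: ppow_half_square integrable_ppow)

lemma D_nonneg [simp]: "0 \<le> Dx s" "0 \<le> Dy s"
  by (simp_all add: Dx_def Dy_def)

lemma Cxy_nonneg [simp]: "0 \<le> Cxy s t"
  by (simp add: Cxy_def)

text \<open>Besides being Cauchy-Schwarz on the circle, this justifies the convention 0/0 = 0: a
  vanishing \<open>Dx s\<close> or \<open>Dy t\<close> forces \<open>Cxy s t = 0\<close>.\<close>

lemma Cxy_le: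
  assumes "s \<in> signs" "t \<in> signs"
  shows "Cxy s t \<le> sqrt (Dx s) * sqrt (Dy t)"
  using integral_Cauchy_Schwarz[of "\<lambda>\<theta>. ppow (\<alpha> / 2) s (cos \<theta>)" \<tau> "\<lambda>\<theta>. ppow (\<alpha> / 2) t (sin \<theta>)"] assms \<alpha>
  by (simp add: ppow_half_square integrable_ppow Cxy_def Dx_def Dy_def)

text \<open>The image of the Levy measure under a coordinate is a one-dimensional stable Levy
  measure, with one weight for each half-line. Stating it for a general \<open>pr\<close> with
  angular factor \<open>f\<close> treats \<open>fst\<close> with \<open>cos\<close> and
  \<open>snd\<close> with \<open>sin\<close> at once.\<close>

lemma levy_proj:
  fixes h :: "real \<Rightarrow> real" and pr :: "real \<times> real \<Rightarrow> real"
  assumes pr: "pr \<in> borel_measurable borel" "\<And>z. (pr z)\<^sup>2 \<le> (fst z)\<^sup>2 + (snd z)\<^sup>2"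
      "\<And>r \<theta>. pr (r * cos \<theta>, r * sin \<theta>) = r * f \<theta>"
    and f: "\<And>s. s \<in> signs \<Longrightarrow> integrable \<tau> (\<lambda>\<theta>. ppow \<alpha> s (f \<theta>))"
    and h: "h \<in> borel_measurable borel" "\<And>x. \<bar>h x\<bar> \<le> C * min 1 (x\<^sup>2)"
  shows "integrable \<nu> (\<lambda>z. h (pr z))"
    and "(\<integral>z. h (pr z) \<partial>\<nu>) = (\<Sum>s\<in>signs. (\<integral>\<theta>. ppow \<alpha> s (f \<theta>) \<partial>\<tau>) * (\<integral>r. h (s * r) \<partial>radial \<alpha>))"
proof -
  have C: "C \<ge> 0"
    using h(2)[of 1] by simp
  have h0: "h 0 = 0"
    using h(2)[of 0] by simp
  show int: "integrable \<nu> (\<lambda>z. h (pr z))"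
  proof (rule integrable_levyI)
    show "(\<lambda>z. h (pr z)) \<in> borel_measurable borel"
      by (rule measurable_compose[OF pr(1) h(1)])
    fix z :: "real \<times> real"
    have "C * min 1 ((pr z)\<^sup>2) \<le> C * min 1 ((fst z)\<^sup>2 + (snd z)\<^sup>2)"
      using C pr(2) by (intro mult_left_mono min.mono) auto
    then show "norm (h (pr z)) \<le> C * min 1 ((fst z)\<^sup>2 + (snd z)\<^sup>2)"
      using h(2)[of "pr z"] by simp
  qed
  show "(\<integral>z. h (pr z) \<partial>\<nu>) = (\<Sum>s\<in>signs. (\<integral>\<theta>. ppow \<alpha> s (f \<theta>) \<partial>\<tau>) * (\<integral>r. h (s * r) \<partial>radial \<alpha>))"
    unfolding integral_levy(1)[OF int] pr(3) radial_ray[OF h(1) h0] using f by (simp add: sum_signs)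
qed

lemma levy_fst:
  fixes h :: "real \<Rightarrow> real"
  assumes "h \<in> borel_measurable borel" "\<And>x. \<bar>h x\<bar> \<le> C * min 1 (x\<^sup>2)"
  shows "integrable \<nu> (\<lambda>z. h (fst z))"
    and "(\<integral>z. h (fst z) \<partial>\<nu>) = (\<Sum>s\<in>signs. Dx s * (\<integral>r. h (s * r) \<partial>radial \<alpha>))"
  using levy_proj[of fst cos h C] assms integrable_ppow(1)[of _ \<alpha>] \<alpha> borel_measurable_fst_snd(1)[of "\<lambda>x. x"]
  by (simp_all add: Dx_def)

lemma levy_snd:
  fixes h :: "real \<Rightarrow> real"
  assumes "h \<in> borel_measurable borel" "\<And>x. \<bar>h x\<bar> \<le> C * min 1 (x\<^sup>2)"
  shows "integrable \<nu> (\<lambda>z. h (snd z))"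
    and "(\<integral>z. h (snd z) \<partial>\<nu>) = (\<Sum>s\<in>signs. Dy s * (\<integral>r. h (s * r) \<partial>radial \<alpha>))"
  using levy_proj[of snd sin h C] assms integrable_ppow(2)[of _ \<alpha>] \<alpha> borel_measurable_fst_snd(2)[of "\<lambda>x. x"]
  by (simp_all add: Dy_def)

lemma integrable_radial_le:
  fixes h :: "real \<Rightarrow> real"
  assumes [measurable]: "h \<in> borel_measurable borel" and h: "\<And>x. \<bar>h x\<bar> \<le> C * min 1 (x\<^sup>2)"
    and c: "\<bar>c\<bar> \<le> 1"
  shows "integrable (radial \<alpha>) (\<lambda>r. h (r * c))"
proof (rule Bochner_Integration.integrable_bound)
  show "integrable (radial \<alpha>) (\<lambda>r. C * min 1 (r\<^sup>2))"
    using integrable_radial_min[OF \<alpha>] by simp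
  have C: "C \<ge> 0"
    using h[of 1] by simp
  have "\<bar>h (r * c)\<bar> \<le> C * min 1 (r\<^sup>2)" for r
  proof -
    have "(r * c)\<^sup>2 \<le> r\<^sup>2"
      using c by (simp add: power_mult_distrib mult_left_le abs_square_le_1)
    then have "C * min 1 ((r * c)\<^sup>2) \<le> C * min 1 (r\<^sup>2)"
      using C by (intro mult_left_mono min.mono) auto
    with h[of "r * c"] show ?thesis by linarith
  qed
  then show "AE r in radial \<alpha>. norm (h (r * c)) \<le> norm (C * min 1 (r\<^sup>2))"
    by (intro AE_I2) (metis abs_ge_self order_trans real_norm_def)
qed measurable

text \<open>Cauchy--Schwarz in the radial variable only, which produces the geometric mean
  \<open>|cos \<theta> sin \<theta>| powr (\<alpha> / 2)\<close>.\<close>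

lemma levy_cross_le:
  fixes a b :: "real \<Rightarrow> real"
  assumes [measurable]: "a \<in> borel_measurable borel" "b \<in> borel_measurable borel"
    and a: "\<And>x. (a x)\<^sup>2 \<le> C * min 1 (x\<^sup>2)" and b: "\<And>x. (b x)\<^sup>2 \<le> C * min 1 (x\<^sup>2)"
  defines "p s \<equiv> \<integral>r. (a (s * r))\<^sup>2 \<partial>radial \<alpha>" and "q s \<equiv> \<integral>r. (b (s * r))\<^sup>2 \<partial>radial \<alpha>"
  shows "(\<integral>z. a (fst z) * b (snd z) \<partial>\<nu>) \<le> (\<Sum>s\<in>signs. \<Sum>t\<in>signs. Cxy s t * (sqrt (p s) * sqrt (q t)))"
proof -
  have a0: "a 0 = 0" and b0: "b 0 = 0"
    using a[of 0] b[of 0] by simp_all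
  have ra: "integrable (radial \<alpha>) (\<lambda>r. (a (r * c))\<^sup>2)" if "\<bar>c\<bar> \<le> 1" for c
    using integrable_radial_le[of "\<lambda>x. (a x)\<^sup>2" C c] a that by simp
  have rb: "integrable (radial \<alpha>) (\<lambda>r. (b (r * c))\<^sup>2)" if "\<bar>c\<bar> \<le> 1" for c
    using integrable_radial_le[of "\<lambda>x. (b x)\<^sup>2" C c] b that by simp
  note [measurable] = borel_measurable_fst_snd(1)[OF assms(1)] borel_measurable_fst_snd(2)[OF assms(2)]
  have int: "integrable \<nu> (\<lambda>z. a (fst z) * b (snd z))"
    using levy_fst(1)[of "\<lambda>x. (a x)\<^sup>2" C] levy_snd(1)[of "\<lambda>x. (b x)\<^sup>2" C] a b
    by (intro integrable_mult_of_squares) auto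
  \<comment> \<open>The square root passes through the sum because at most one of the two signs
    gives a nonzero term.\<close>
  have eq: "sqrt (\<Sum>s\<in>signs. ppow \<alpha> s c * f s) = (\<Sum>s\<in>signs. ppow (\<alpha> / 2) s c * sqrt (f s))" for c f
    by (cases rule: ppow_cases[of c]) (auto simp: sum_signs real_sqrt_mult powr_half_sqrt_powr)
  have "(\<integral>z. a (fst z) * b (snd z) \<partial>\<nu>) = (\<integral>\<theta>. (\<integral>r. a (r * cos \<theta>) * b (r * sin \<theta>) \<partial>radial \<alpha>) \<partial>\<tau>)"
    using integral_levy(1)[OF int] by simp
  also have "\<dots> \<le> (\<integral>\<theta>. (\<Sum>s\<in>signs. \<Sum>t\<in>signs.
      ppow (\<alpha> / 2) s (cos \<theta>) * ppow (\<alpha> / 2) t (sin \<theta>) * (sqrt (p s) * sqrt (q t))) \<partial>\<tau>)"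
  proof (intro integral_mono)
    show "integrable \<tau> (\<lambda>\<theta>. \<integral>r. a (r * cos \<theta>) * b (r * sin \<theta>) \<partial>radial \<alpha>)"
      using integral_levy(2)[OF int] by simp
    show "integrable \<tau> (\<lambda>\<theta>. \<Sum>s\<in>signs. \<Sum>t\<in>signs.
      ppow (\<alpha> / 2) s (cos \<theta>) * ppow (\<alpha> / 2) t (sin \<theta>) * (sqrt (p s) * sqrt (q t)))"
      by (intro Bochner_Integration.integrable_sum integrable_mult_left integrable_ppow_mult)
    fix \<theta>
    have "(\<integral>r. a (r * cos \<theta>) * b (r * sin \<theta>) \<partial>radial \<alpha>) \<le>
        sqrt (\<integral>r. (a (r * cos \<theta>))\<^sup>2 \<partial>radial \<alpha>) * sqrt (\<integral>r. (b (r * sin \<theta>))\<^sup>2 \<partial>radial \<alpha>)"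
      by (intro integral_Cauchy_Schwarz ra rb) auto
    also have "(\<integral>r. (a (r * cos \<theta>))\<^sup>2 \<partial>radial \<alpha>) = (\<Sum>s\<in>signs. ppow \<alpha> s (cos \<theta>) * p s)"
      using radial_ray[of "\<lambda>x. (a x)\<^sup>2" "cos \<theta>"] a0 by (simp add: p_def)
    also have "(\<integral>r. (b (r * sin \<theta>))\<^sup>2 \<partial>radial \<alpha>) = (\<Sum>s\<in>signs. ppow \<alpha> s (sin \<theta>) * q s)"
      using radial_ray[of "\<lambda>x. (b x)\<^sup>2" "sin \<theta>"] b0 by (simp add: q_def)
    also have "sqrt (\<Sum>s\<in>signs. ppow \<alpha> s (cos \<theta>) * p s) * sqrt (\<Sum>s\<in>signs. ppow \<alpha> s (sin \<theta>) * q s) =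
      (\<Sum>s\<in>signs. \<Sum>t\<in>signs. ppow (\<alpha> / 2) s (cos \<theta>) * ppow (\<alpha> / 2) t (sin \<theta>) * (sqrt (p s) * sqrt (q t)))"
      unfolding eq sum_product by (intro sum.cong refl) (simp add: mult_ac)
    finally show "(\<integral>r. a (r * cos \<theta>) * b (r * sin \<theta>) \<partial>radial \<alpha>) \<le> (\<Sum>s\<in>signs. \<Sum>t\<in>signs.
      ppow (\<alpha> / 2) s (cos \<theta>) * ppow (\<alpha> / 2) t (sin \<theta>) * (sqrt (p s) * sqrt (q t)))" .
  qed
  also have "\<dots> = (\<Sum>s\<in>signs. \<Sum>t\<in>signs. Cxy s t * (sqrt (p s) * sqrt (q t)))"
    unfolding Cxy_def
    by (subst Bochner_Integration.integral_sum, (intro Bochner_Integration.integrable_sum integrable_mult_left integrable_ppow_mult; assumption),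
        intro sum.cong refl, subst Bochner_Integration.integral_sum, (intro integrable_mult_left integrable_ppow_mult; assumption), simp)
  finally show ?thesis .
qed

text \<open>Since \<open>x / 0 = 0\<close>, the entries with a vanishing denominator are \<open>0\<close> as in the convention of the theorem.\<close>

definition bilinear_bound :: "real \<Rightarrow> bool" where
  "bilinear_bound R \<longleftrightarrow> (\<forall>x y :: real \<Rightarrow> real.
     (\<Sum>s\<in>signs. \<Sum>t\<in>signs. x s * (Cxy s t / sqrt (Dx s * Dy t)) * y t)
       \<le> R * sqrt (\<Sum>s\<in>signs. (x s)\<^sup>2) * sqrt (\<Sum>t\<in>signs. (y t)\<^sup>2))"

lemma levy_sq_int:
  assumes "a \<in> borel_measurable borel" "\<And>x. (cmod (a x))\<^sup>2 \<le> C * min 1 (x\<^sup>2)"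
  shows "sq_int \<nu> (\<lambda>z. a (fst z))" "sq_int \<nu> (\<lambda>z. a (snd z))"
  unfolding sq_int_def using assms levy_fst(1)[of "\<lambda>x. (cmod (a x))\<^sup>2" C] levy_snd(1)[of "\<lambda>x. (cmod (a x))\<^sup>2" C]
  by (simp_all add: borel_measurable_fst_snd measurable_cong_sets[OF sets_levy refl])

lemma corr_form_levy_nonneg:
  assumes R: "bilinear_bound R" "0 \<le> R"
    and [measurable]: "a \<in> borel_measurable borel" "b \<in> borel_measurable borel"
    and a: "\<And>x. (cmod (a x))\<^sup>2 \<le> C * min 1 (x\<^sup>2)" and b: "\<And>x. (cmod (b x))\<^sup>2 \<le> C * min 1 (x\<^sup>2)"
  shows "0 \<le> corr_form \<nu> R (\<lambda>z. a (fst z)) (\<lambda>z. b (snd z))"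
proof -
  define p where "p s = (\<integral>r. (cmod (a (s * r)))\<^sup>2 \<partial>radial \<alpha>)" for s
  define q where "q s = (\<integral>r. (cmod (b (s * r)))\<^sup>2 \<partial>radial \<alpha>)" for s
  have A: "(sqnorm \<nu> (\<lambda>z. a (fst z))) = (\<Sum>s\<in>signs. (sqrt (Dx s * p s))\<^sup>2)"
    using levy_fst(2)[of "\<lambda>x. (cmod (a x))\<^sup>2" C] a by (simp add: p_def)
  have B: "(sqnorm \<nu> (\<lambda>z. b (snd z))) = (\<Sum>s\<in>signs. (sqrt (Dy s * q s))\<^sup>2)"
    using levy_snd(2)[of "\<lambda>x. (cmod (b x))\<^sup>2" C] b by (simp add: q_def)
  have "cmod (\<integral>z. a (fst z) * cnj (b (snd z)) \<partial>\<nu>) \<le> (\<integral>z. cmod (a (fst z)) * cmod (b (snd z)) \<partial>\<nu>)"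
    by (rule order_trans[OF integral_norm_bound]) (simp add: norm_mult)
  also have "\<dots> \<le> (\<Sum>s\<in>signs. \<Sum>t\<in>signs. Cxy s t * (sqrt (p s) * sqrt (q t)))"
    using levy_cross_le[of "\<lambda>x. cmod (a x)" "\<lambda>x. cmod (b x)" C] a b by (simp add: p_def q_def)
  \<comment> \<open>Inserting \<open>sqrt (Dx s)\<close> and \<open>sqrt (Dy t)\<close> and dividing
    by them makes the matrix entries appear. The vectors that remain have components
    \<open>sqrt (Dx s * p s)\<close> and \<open>sqrt (Dy t * q t)\<close>, whose squares sum to the
    two norms \<open>A\<close> and \<open>B\<close>.\<close>
  also have "\<dots> = (\<Sum>s\<in>signs. \<Sum>t\<in>signs. sqrt (Dx s * p s) * (Cxy s t / sqrt (Dx s * Dy t)) * sqrt (Dy t * q t))"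
  proof (intro sum.cong refl)
    fix s t assume st: "s \<in> signs" "t \<in> signs"
    show "Cxy s t * (sqrt (p s) * sqrt (q t)) =
        sqrt (Dx s * p s) * (Cxy s t / sqrt (Dx s * Dy t)) * sqrt (Dy t * q t)"
    proof (cases "Dx s = 0 \<or> Dy t = 0")
      case True
      then have "Cxy s t = 0"
        using Cxy_le[OF st] Cxy_nonneg[of s t] by (auto intro: antisym)
      then show ?thesis by simp
    next
      case False
      then show ?thesis by (simp add: real_sqrt_mult)
    qed
  qed
  also have "\<dots> \<le> R * sqrt (\<Sum>s\<in>signs. (sqrt (Dx s * p s))\<^sup>2) * sqrt (\<Sum>t\<in>signs. (sqrt (Dy t * q t))\<^sup>2)"
    using R(1) unfolding bilinear_bound_def
    by (elim allE[of _ "\<lambda>s. sqrt (Dx s * p s)"] allE[of _ "\<lambda>t. sqrt (Dy t * q t)"])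
  finally have le: "cmod (\<integral>z. a (fst z) * cnj (b (snd z)) \<partial>\<nu>) \<le>
      R * (sqrt (sqnorm \<nu> (\<lambda>z. a (fst z))) * sqrt (sqnorm \<nu> (\<lambda>z. b (snd z))))"
    unfolding A[symmetric] B[symmetric] by (simp add: mult.assoc)
  define u v where "u = sqrt (sqnorm \<nu> (\<lambda>z. a (fst z)))" and "v = sqrt (sqnorm \<nu> (\<lambda>z. b (snd z)))"
  have uv: "u\<^sup>2 = (sqnorm \<nu> (\<lambda>z. a (fst z)))" "v\<^sup>2 = (sqnorm \<nu> (\<lambda>z. b (snd z)))"
    by (simp_all add: u_def v_def)
  have "- Re (\<integral>z. a (fst z) * cnj (b (snd z)) \<partial>\<nu>) \<le> R * (u * v)"
    using le abs_Re_le_cmod[of "\<integral>z. a (fst z) * cnj (b (snd z)) \<partial>\<nu>"] unfolding u_def v_def by linarith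
  moreover have "R * (2 * (u * v)) \<le> R * (u\<^sup>2 + v\<^sup>2)"
    using sum_squares_bound[of u v] R(2) by (intro mult_left_mono) (auto simp: mult_ac)
  ultimately show ?thesis
    unfolding corr_form_def uv[symmetric] by simp
qed

end

section \<open>Test functions for the lower bound\<close>

context stable_spectrum
begin

definition window :: "(real \<Rightarrow> real) \<Rightarrow> real \<Rightarrow> real \<Rightarrow> real" where
  "window c T x = (\<Sum>s\<in>signs. c s * ppow (\<alpha> / 2) s x) * indicator {1..T} \<bar>x\<bar>"

lemma window_measurable [measurable]: "window c T \<in> borel_measurable borel"
  unfolding window_def by measurable

lemma window_bounds:
  assumes "T \<ge> 1"
  obtains K where "\<And>x. \<bar>window c T x\<bar> \<le> K" "\<And>x. (window c T x)\<^sup>2 \<le> K\<^sup>2 * min 1 (x\<^sup>2)"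
proof -
  define K where "K = (\<bar>c 1\<bar> + \<bar>c (-1)\<bar>) * T powr (\<alpha> / 2)"
  have K: "\<bar>window c T x\<bar> \<le> K * indicator {1..T} \<bar>x\<bar>" for x
  proof (cases "\<bar>x\<bar> \<in> {1..T}")
    case True
    have "ppow (\<alpha> / 2) s x \<le> T powr (\<alpha> / 2)" if "s \<in> signs" for s
      unfolding ppow_def using True that assms \<alpha> by (intro powr_mono2) auto
    then have "\<bar>c 1 * ppow (\<alpha> / 2) 1 x + c (-1) * ppow (\<alpha> / 2) (-1) x\<bar> \<le>
        \<bar>c 1\<bar> * T powr (\<alpha> / 2) + \<bar>c (-1)\<bar> * T powr (\<alpha> / 2)"
      by (intro order_trans[OF abs_triangle_ineq]) (auto simp: abs_mult intro!: add_mono mult_left_mono)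
    then show ?thesis
      using True by (simp add: window_def K_def distrib_right)
  qed (simp add: window_def)
  have K0: "0 \<le> K" by (simp add: K_def)
  show ?thesis
  proof
    show "\<bar>window c T x\<bar> \<le> K" for x
      using K[of x] K0 by (cases "\<bar>x\<bar> \<in> {1..T}") simp_all
    show "(window c T x)\<^sup>2 \<le> K\<^sup>2 * min 1 (x\<^sup>2)" for x
    proof (cases "\<bar>x\<bar> \<in> {1..T}")
      case True
      have "(window c T x)\<^sup>2 \<le> K\<^sup>2"
        using K[of x] K0 True by (metis abs_ge_zero indicator_simps(1) mult.right_neutral power2_abs power_mono)
      moreover have "1 \<le> x\<^sup>2"
        using True by (metis abs_le_square_iff abs_one atLeastAtMost_iff one_power2)
      ultimately show ?thesis by simp
    qed (simp add: window_def)
  qed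
qed

lemma ppow_mult: "0 \<le> r \<Longrightarrow> ppow \<beta> s (r * x) = r powr \<beta> * ppow \<beta> s x"
proof -
  assume r: "0 \<le> r"
  then have "max 0 (s * (r * x)) = r * max 0 (s * x)"
    by (simp add: max_mult_distrib_left[of r] mult_ac)
  with r show ?thesis
    by (simp add: ppow_def powr_mult)
qed

lemma window_norm:
  assumes "T \<ge> 1" "s \<in> signs"
  shows "(\<integral>r. (window c T (s * r))\<^sup>2 \<partial>radial \<alpha>) = (c s)\<^sup>2 * ln T"
proof -
  have "(\<integral>r. (window c T (s * r))\<^sup>2 \<partial>radial \<alpha>) = (\<integral>r. (c s)\<^sup>2 * (r powr \<alpha> * indicator {1..T} r) \<partial>radial \<alpha>)"
  proof (rule integral_cong_AE)
    show "AE r in radial \<alpha>. (window c T (s * r))\<^sup>2 = (c s)\<^sup>2 * (r powr \<alpha> * indicator {1..T} r)"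
      using AE_radial_pos
    proof eventually_elim
      case (elim r)
      have "window c T (s * r) = c s * r powr (\<alpha> / 2) * indicator {1..T} r"
        using elim assms by (auto simp: window_def ppow_def)
      then show ?case
        using elim by (simp add: power_mult_distrib power2_eq_square powr_add[symmetric] indicator_def)
    qed
  qed auto
  also have "\<dots> = (c s)\<^sup>2 * (ln T - ln 1)"
    using radial_window[of 1 T \<alpha>] assms by (simp add: has_bochner_integral_integral_eq)
  finally show ?thesis by simp
qed

text \<open>In the variable \<open>ln r\<close> the two constraints are intervals of length
  \<open>ln T\<close> shifted against each other by \<open>\<bar>ln x - ln y\<bar>\<close>, and the
  measure is Lebesgue measure; the value is the length of the overlap.\<close>

lemma radial_double_window:
  assumes "x > 0" "y > 0" "T \<ge> 1"
  shows "(\<integral>r. r powr \<alpha> * indicator {1..T} (r * x) * indicator {1..T} (r * y) \<partial>radial \<alpha>) =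
    max 0 (ln T - \<bar>ln x - ln y\<bar>)"
proof -
  define a where "a = max (1 / x) (1 / y)"
  define b where "b = min (T / x) (T / y)"
  have ab: "a > 0" "b > 0"
    using assms by (auto simp: a_def b_def less_max_iff_disj)
  have "ln a = max (ln (1 / x)) (ln (1 / y))" "ln b = min (ln (T / x)) (ln (T / y))"
    using assms by (auto simp: a_def b_def max_def min_def)
  then have ln: "ln b - ln a = ln T - \<bar>ln x - ln y\<bar>"
    using assms by (simp add: ln_div)
  have "(\<lambda>r. r powr \<alpha> * indicator {1..T} (r * x) * indicator {1..T} (r * y)) =
      (\<lambda>r. r powr \<alpha> * indicator {a..b} r)"
    using assms by (auto simp: fun_eq_iff indicator_def a_def b_def field_simps)
  moreover have "(\<integral>r. r powr \<alpha> * indicator {a..b} r \<partial>radial \<alpha>) = max 0 (ln b - ln a)"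
  proof (cases "a \<le> b")
    case True
    then show ?thesis
      using radial_window[OF ab(1) True] ab by (simp add: has_bochner_integral_integral_eq)
  next
    case False
    then show ?thesis using ab by simp
  qed
  ultimately show ?thesis
    using ln by simp
qed

lemma window_cross:
  assumes "T \<ge> 1"
  shows "(\<integral>r. window c T (r * x) * window d T (r * y) \<partial>radial \<alpha>) =
    (\<Sum>s\<in>signs. \<Sum>t\<in>signs. c s * d t * (ppow (\<alpha> / 2) s x * ppow (\<alpha> / 2) t y)) * max 0 (ln T - \<bar>ln \<bar>x\<bar> - ln \<bar>y\<bar>\<bar>)"
proof -
  define P where "P = (\<Sum>s\<in>signs. \<Sum>t\<in>signs. c s * d t * (ppow (\<alpha> / 2) s x * ppow (\<alpha> / 2) t y))"
  have P: "P = (\<Sum>s\<in>signs. c s * ppow (\<alpha> / 2) s x) * (\<Sum>t\<in>signs. d t * ppow (\<alpha> / 2) t y)"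
    unfolding P_def sum_product by (simp add: mult_ac)
  have "(\<integral>r. window c T (r * x) * window d T (r * y) \<partial>radial \<alpha>) =
      (\<integral>r. P * (r powr \<alpha> * indicator {1..T} (r * \<bar>x\<bar>) * indicator {1..T} (r * \<bar>y\<bar>)) \<partial>radial \<alpha>)"
  proof (rule integral_cong_AE)
    show "AE r in radial \<alpha>. window c T (r * x) * window d T (r * y) =
        P * (r powr \<alpha> * indicator {1..T} (r * \<bar>x\<bar>) * indicator {1..T} (r * \<bar>y\<bar>))"
      using AE_radial_pos
    proof eventually_elim
      case (elim r)
      have "r powr \<alpha> = r powr (\<alpha> / 2) * r powr (\<alpha> / 2)"
        by (simp add: powr_add[symmetric])
      with elim show ?case
        by (simp add: window_def P ppow_mult abs_mult algebra_simps)
    qed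
  qed auto
  also have "\<dots> = P * max 0 (ln T - \<bar>ln \<bar>x\<bar> - ln \<bar>y\<bar>\<bar>)"
  proof (cases "x = 0 \<or> y = 0")
    \<comment> \<open>The value assigned to \<open>ln 0\<close> does not matter here because the
      prefactor \<open>P\<close> vanishes.\<close>
    case True
    then have "P = 0" by (auto simp: P ppow_def)
    then show ?thesis by simp
  next
    case False
    then show ?thesis
      using radial_double_window[of "\<bar>x\<bar>" "\<bar>y\<bar>" T] assms by simp
  qed
  finally show ?thesis
    by (simp add: P_def)
qed

text \<open>The cutoff is \<open>exp (real (Suc n))\<close>, so that the logarithm to divide by is
  \<open>real (Suc n)\<close>, which is positive.\<close>

abbreviation window_mean :: "(real \<Rightarrow> real) \<Rightarrow> (real \<Rightarrow> real) \<Rightarrow> nat \<Rightarrow> real" where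
  "window_mean c d \<equiv> \<lambda>n. (\<integral>z. window c (exp (real (Suc n))) (fst z) * window d (exp (real (Suc n))) (snd z) \<partial>\<nu>) / real (Suc n)"

text \<open>After the radial integration the angle carries the weight \<open>W n \<theta>\<close>,
  the overlap of the two logarithmic windows relative to their length. It lies between 0 and 1 and
  tends to 1 for every fixed angle, so dominated convergence applies.\<close>

lemma window_cross_limit:
  "window_mean c d
     \<longlonglongrightarrow> (\<Sum>s\<in>signs. \<Sum>t\<in>signs. c s * d t * Cxy s t)"
proof -
  define P where "P \<theta> = (\<Sum>s\<in>signs. \<Sum>t\<in>signs. c s * d t * (ppow (\<alpha> / 2) s (cos \<theta>) * ppow (\<alpha> / 2) t (sin \<theta>)))" for \<theta>
  define W where "W n \<theta> = max 0 (real (Suc n) - \<bar>ln \<bar>cos \<theta>\<bar> - ln \<bar>sin \<theta>\<bar>\<bar>) / real (Suc n)" for n \<theta>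
  have Pm [measurable]: "P \<in> borel_measurable \<tau>"
    unfolding P_def by (rule measurable_tau) measurable
  have [measurable]: "W n \<in> borel_measurable \<tau>" for n
    unfolding W_def by (rule measurable_tau) measurable
  have Pint: "integrable \<tau> P"
    unfolding P_def by (intro Bochner_Integration.integrable_sum integrable_mult_right integrable_ppow_mult)
  have eq: "window_mean c d n =
      (\<integral>\<theta>. P \<theta> * W n \<theta> \<partial>\<tau>)" for n
  proof -
    let ?T = "exp (real (Suc n))"
    have T: "?T \<ge> 1" by simp
    obtain K where K: "\<And>x. (window c ?T x)\<^sup>2 \<le> K\<^sup>2 * min 1 (x\<^sup>2)"
      using window_bounds[OF T] by metis
    obtain L where L: "\<And>x. (window d ?T x)\<^sup>2 \<le> L\<^sup>2 * min 1 (x\<^sup>2)"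
      using window_bounds[OF T] by metis
    have int: "integrable \<nu> (\<lambda>z. window c ?T (fst z) * window d ?T (snd z))"
      using levy_fst(1)[of "\<lambda>x. (window c ?T x)\<^sup>2" "K\<^sup>2"] levy_snd(1)[of "\<lambda>x. (window d ?T x)\<^sup>2" "L\<^sup>2"] K L
      by (intro integrable_mult_of_squares)
        (auto simp: borel_measurable_fst_snd measurable_cong_sets[OF sets_levy refl])
    show ?thesis
      unfolding integral_levy(1)[OF int] fst_conv snd_conv window_cross[OF T] ln_exp
      by (simp add: P_def W_def del: of_nat_Suc)
  qed
  have "(\<lambda>n. \<integral>\<theta>. P \<theta> * W n \<theta> \<partial>\<tau>) \<longlonglongrightarrow> (\<integral>\<theta>. P \<theta> \<partial>\<tau>)"
  proof (rule integral_dominated_convergence[where w = "\<lambda>\<theta>. \<bar>P \<theta>\<bar>"])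
    have "0 \<le> W n \<theta>" "W n \<theta> \<le> 1" for n \<theta>
      by (auto simp: W_def divide_le_eq)
    then show "AE \<theta> in \<tau>. norm (P \<theta> * W n \<theta>) \<le> \<bar>P \<theta>\<bar>" for n
      by (intro AE_I2) (simp add: abs_mult mult_left_le)
    show "AE \<theta> in \<tau>. (\<lambda>n. P \<theta> * W n \<theta>) \<longlonglongrightarrow> P \<theta>"
    proof (rule AE_I2)
      fix \<theta> :: real
      define l where "l = \<bar>ln \<bar>cos \<theta>\<bar> - ln \<bar>sin \<theta>\<bar>\<bar>"
      have "(\<lambda>n. max 0 (1 - l * (1 / real (Suc n)))) \<longlonglongrightarrow> max 0 (1 - l * 0)"
        by (intro tendsto_intros LIMSEQ_Suc[OF lim_1_over_n])
      also have "(\<lambda>n. max 0 (1 - l * (1 / real (Suc n)))) = (\<lambda>n. W n \<theta>)"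
      proof
        fix n
        have "max 0 (1 - l * (1 / k)) = max 0 (k - l) / k" if "k > 0" for k :: real
          using that by (auto simp: max_def field_simps)
        from this[of "real (Suc n)"] show "max 0 (1 - l * (1 / real (Suc n))) = W n \<theta>"
          by (simp only: W_def l_def of_nat_0_less_iff zero_less_Suc)
      qed
      finally have "(\<lambda>n. P \<theta> * W n \<theta>) \<longlonglongrightarrow> P \<theta> * 1"
        by (intro tendsto_intros) simp
      then show "(\<lambda>n. P \<theta> * W n \<theta>) \<longlonglongrightarrow> P \<theta>" by simp
    qed
  qed (use Pint in auto)
  also have "(\<integral>\<theta>. P \<theta> \<partial>\<tau>) = (\<Sum>s\<in>signs. \<Sum>t\<in>signs. c s * d t * Cxy s t)"
    unfolding P_def Cxy_def
    by (subst Bochner_Integration.integral_sum, (intro Bochner_Integration.integrable_sum integrable_mult_right integrable_ppow_mult; assumption),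
        intro sum.cong refl, subst Bochner_Integration.integral_sum, (intro integrable_mult_right integrable_ppow_mult; assumption), simp)
  finally show ?thesis
    unfolding eq .
qed

text \<open>The minus sign on the first function turns nonnegativity of \<open>corr_form\<close>
  into an upper bound for the cross integral.\<close>

lemma corr_form_window:
  assumes "T \<ge> 1"
  shows "corr_form \<nu> R (\<lambda>z. of_real (- window c T (fst z))) (\<lambda>z. of_real (window d T (snd z))) =
    R * (ln T * ((\<Sum>s\<in>signs. Dx s * (c s)\<^sup>2) + (\<Sum>s\<in>signs. Dy s * (d s)\<^sup>2)))
      - 2 * (\<integral>z. window c T (fst z) * window d T (snd z) \<partial>\<nu>)"
proof -
  obtain K where K: "\<And>x. (window c T x)\<^sup>2 \<le> K\<^sup>2 * min 1 (x\<^sup>2)"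
    using window_bounds[OF assms] by metis
  obtain L where L: "\<And>x. (window d T x)\<^sup>2 \<le> L\<^sup>2 * min 1 (x\<^sup>2)"
    using window_bounds[OF assms] by metis
  have 1: "(\<integral>z. (window c T (fst z))\<^sup>2 \<partial>\<nu>) = ln T * (\<Sum>s\<in>signs. Dx s * (c s)\<^sup>2)"
    using levy_fst(2)[of "\<lambda>x. (window c T x)\<^sup>2" "K\<^sup>2"] K assms
    by (simp add: window_norm[of T 1, simplified] window_norm[of T "-1", simplified] algebra_simps)
  have 2: "(\<integral>z. (window d T (snd z))\<^sup>2 \<partial>\<nu>) = ln T * (\<Sum>s\<in>signs. Dy s * (d s)\<^sup>2)"
    using levy_snd(2)[of "\<lambda>x. (window d T x)\<^sup>2" "L\<^sup>2"] L assms
    by (simp add: window_norm[of T 1, simplified] window_norm[of T "-1", simplified] algebra_simps)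
  have 3: "(\<integral>z. complex_of_real (- window c T (fst z)) * cnj (of_real (window d T (snd z))) \<partial>\<nu>) =
      of_real (- (\<integral>z. window c T (fst z) * window d T (snd z) \<partial>\<nu>))"
    by (subst integral_minus[symmetric], subst integral_complex_of_real[symmetric]) simp
  show ?thesis
    unfolding corr_form_def 3 by (simp add: 1 2 distrib_left)
qed

lemma bilinear_boundI:
  assumes R: "0 \<le> R"
    and form: "\<And>c d T. T \<ge> 1 \<Longrightarrow>
      0 \<le> corr_form \<nu> R (\<lambda>z. of_real (- window c T (fst z))) (\<lambda>z. of_real (window d T (snd z)))"
  shows "bilinear_bound R"
proof -
  have *: "2 * (\<Sum>s\<in>signs. \<Sum>t\<in>signs. c s * d t * Cxy s t) \<le>
      R * ((\<Sum>s\<in>signs. Dx s * (c s)\<^sup>2) + (\<Sum>s\<in>signs. Dy s * (d s)\<^sup>2))" (is "2 * ?l \<le> R * ?q") for c d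
  proof (rule LIMSEQ_le_const2)
    show "(\<lambda>n. 2 * window_mean c d n)
       \<longlonglongrightarrow> 2 * ?l"
      by (intro tendsto_intros window_cross_limit)
    have "2 * window_mean c d n \<le> R * ?q" for n
    proof -
      define I where "I = (\<integral>z. window c (exp (real (Suc n))) (fst z) * window d (exp (real (Suc n))) (snd z) \<partial>\<nu>)"
      have "0 \<le> R * (real (Suc n) * ?q) - 2 * I"
        using form[of "exp (real (Suc n))" c d] unfolding I_def by (simp only: corr_form_window one_le_exp_iff of_nat_0_le_iff ln_exp)
      then have "2 * I \<le> R * ?q * real (Suc n)"
        by (simp add: mult_ac)
      then show ?thesis
        unfolding I_def[symmetric] times_divide_eq_right by (simp add: pos_divide_le_eq)
    qed
    then show "\<exists>N. \<forall>n\<ge>N. 2 * window_mean c d n \<le> R * ?q"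
      by blast
  qed
  show ?thesis
    unfolding bilinear_bound_def
  proof (intro allI)
    fix x y :: "real \<Rightarrow> real"
    define X where "X = sqrt (\<Sum>s\<in>signs. (x s)\<^sup>2)"
    define Y where "Y = sqrt (\<Sum>t\<in>signs. (y t)\<^sup>2)"
    have X2: "X\<^sup>2 = (\<Sum>s\<in>signs. (x s)\<^sup>2)" and Y2: "Y\<^sup>2 = (\<Sum>t\<in>signs. (y t)\<^sup>2)"
      by (auto simp: X_def Y_def)
    have XY: "X \<ge> 0" "Y \<ge> 0" by (auto simp: X_def Y_def)
    let ?b = "\<Sum>s\<in>signs. \<Sum>t\<in>signs. x s * (Cxy s t / sqrt (Dx s * Dy t)) * y t"
    show "?b \<le> R * X * Y"
    proof (cases "X = 0 \<or> Y = 0")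
      case True
      then have "(x 1 = 0 \<and> x (-1) = 0) \<or> (y 1 = 0 \<and> y (-1) = 0)"
        by (auto simp: X_def Y_def sum_signs add_nonneg_eq_0_iff)
      then show ?thesis
        using True by auto
    next
      case False
      \<comment> \<open>These weights normalize the test functions so that the weighted sums of
        squares are at most 1. Equality may fail: if \<open>Dx s = 0\<close>, division by zero makes
        \<open>c s = 0\<close>, in agreement with the zero entry of the matrix.\<close>
      define c where "c s = x s / (X * sqrt (Dx s))" for s
      define d where "d t = y t / (Y * sqrt (Dy t))" for t
      have Dc: "Dx s * (c s)\<^sup>2 \<le> (x s)\<^sup>2 / X\<^sup>2" "Dy s * (d s)\<^sup>2 \<le> (y s)\<^sup>2 / Y\<^sup>2" for s
        using D_nonneg[of s] by (auto simp: c_def d_def power_divide power_mult_distrib)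
      have "(\<Sum>s\<in>signs. Dx s * (c s)\<^sup>2) \<le> (\<Sum>s\<in>signs. (x s)\<^sup>2 / X\<^sup>2)"
        by (intro sum_mono Dc)
      also have "\<dots> = 1"
        using False unfolding sum_divide_distrib[symmetric] X2[symmetric] by simp
      finally have c1: "(\<Sum>s\<in>signs. Dx s * (c s)\<^sup>2) \<le> 1" .
      have "(\<Sum>s\<in>signs. Dy s * (d s)\<^sup>2) \<le> (\<Sum>s\<in>signs. (y s)\<^sup>2 / Y\<^sup>2)"
        by (intro sum_mono Dc)
      also have "\<dots> = 1"
        using False unfolding sum_divide_distrib[symmetric] Y2[symmetric] by simp
      finally have d1: "(\<Sum>s\<in>signs. Dy s * (d s)\<^sup>2) \<le> 1" .
      have "R * ((\<Sum>s\<in>signs. Dx s * (c s)\<^sup>2) + (\<Sum>s\<in>signs. Dy s * (d s)\<^sup>2)) \<le> R * (1 + 1)"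
        using c1 d1 R by (intro mult_left_mono add_mono)
      then have "2 * (\<Sum>s\<in>signs. \<Sum>t\<in>signs. c s * d t * Cxy s t) \<le> R * (1 + 1)"
        by (rule order_trans[OF *[of c d]])
      then have "(\<Sum>s\<in>signs. \<Sum>t\<in>signs. c s * d t * Cxy s t) \<le> R"
        by simp
      also have "(\<Sum>s\<in>signs. \<Sum>t\<in>signs. c s * d t * Cxy s t) = ?b / (X * Y)"
        unfolding sum_divide_distrib
        by (intro sum.cong refl) (simp add: c_def d_def real_sqrt_mult mult_ac)
      finally show ?thesis
        using False XY by (simp add: field_simps)
    qed
  qed
qed

end

section \<open>Gram kernels\<close>

text \<open>The real part of \<open>a x * cnj (b x)\<close> has no mixed terms. This connects
  correlations of real functions with kernels, which are tested on complex coefficients.\<close>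

lemma corr_form_Re_Im:
  assumes "sq_int N a" "sq_int N b"
  shows "corr_form N R a b = corr_form N R (\<lambda>x. of_real (Re (a x))) (\<lambda>x. of_real (Re (b x)))
    + corr_form N R (\<lambda>x. of_real (Im (a x))) (\<lambda>x. of_real (Im (b x)))"
proof -
  have [measurable]: "a \<in> borel_measurable N" "b \<in> borel_measurable N"
    using assms by auto
  have sq: "integrable N (\<lambda>x. (Re (f x))\<^sup>2)" "integrable N (\<lambda>x. (Im (f x))\<^sup>2)"
      "sqnorm N f = (\<integral>x. (Re (f x))\<^sup>2 \<partial>N) + (\<integral>x. (Im (f x))\<^sup>2 \<partial>N)" if f: "sq_int N f" for f
  proof -
    have [measurable]: "f \<in> borel_measurable N"
      using f by auto
    show 1: "integrable N (\<lambda>x. (Re (f x))\<^sup>2)" "integrable N (\<lambda>x. (Im (f x))\<^sup>2)"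
      by (rule Bochner_Integration.integrable_bound[OF sq_intD(2)[OF f]]; simp add: cmod_power2)+
    show "sqnorm N f = (\<integral>x. (Re (f x))\<^sup>2 \<partial>N) + (\<integral>x. (Im (f x))\<^sup>2 \<partial>N)"
      unfolding cmod_power2 using 1 by simp
  qed
  have "Re (\<integral>x. a x * cnj (b x) \<partial>N) = (\<integral>x. Re (a x) * Re (b x) + Im (a x) * Im (b x) \<partial>N)"
    using integral_Re[OF sq_int_integrable_mult[OF assms]] by simp
  also have "\<dots> = (\<integral>x. Re (a x) * Re (b x) \<partial>N) + (\<integral>x. Im (a x) * Im (b x) \<partial>N)"
    by (intro Bochner_Integration.integral_add integrable_mult_of_squares sq assms) auto
  finally show ?thesis
    unfolding corr_form_def sq(3)[OF assms(1)] sq(3)[OF assms(2)]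
    by (simp add: distrib_left flip: of_real_mult)
qed

lemma corr_form_covar:
  "corr_form M R (\<lambda>\<omega>. of_real (U \<omega> - (LINT \<omega>'|M. U \<omega>'))) (\<lambda>\<omega>. of_real (V \<omega> - (LINT \<omega>'|M. V \<omega>'))) =
    R * (covar M U U + covar M V V) + 2 * covar M U V"
  unfolding corr_form_def covar_def norm_of_real power2_abs complex_cnj_complex_of_real of_real_mult[symmetric]
    integral_complex_of_real Re_complex_of_real power2_eq_square by simp

lemma sesquilinear_sum:
  assumes "finite S" "\<And>i. sq_int N (E i)"
  shows "(\<integral>x. (\<Sum>i\<in>S. a i * E i x) * cnj (\<Sum>j\<in>S. b j * E j x) \<partial>N) =
    (\<Sum>i\<in>S. \<Sum>j\<in>S. a i * cnj (b j) * (\<integral>x. E i x * cnj (E j x) \<partial>N))"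
proof -
  have i: "integrable N (\<lambda>x. a i * cnj (b j) * (E i x * cnj (E j x)))" if "i \<in> S" "j \<in> S" for i j
    using sq_int_integrable_mult[OF assms(2) assms(2), of i j] by simp
  have "(\<integral>x. (\<Sum>i\<in>S. a i * E i x) * cnj (\<Sum>j\<in>S. b j * E j x) \<partial>N) =
      (\<integral>x. (\<Sum>i\<in>S. \<Sum>j\<in>S. a i * cnj (b j) * (E i x * cnj (E j x))) \<partial>N)"
    by (intro Bochner_Integration.integral_cong refl) (simp add: sum_product mult_ac)
  also have "\<dots> = (\<Sum>i\<in>S. \<Sum>j\<in>S. \<integral>x. a i * cnj (b j) * (E i x * cnj (E j x)) \<partial>N)"
    using i by (simp add: Bochner_Integration.integral_sum)
  finally show ?thesis by simp
qed

text \<open>Expand norms and inner product of the two partial sums. Pairs with equal flags receive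
  \<open>R\<close>; each mixed pair occurs in <A, B> or in <B, A>, and these two have the same real
  part, which accounts for the factor 2 in \<open>corr_form\<close>.\<close>

lemma Re_block_gram:
  fixes E :: "bool \<times> 'b \<Rightarrow> 'a \<Rightarrow> complex"
  assumes S: "finite S" "\<And>i. sq_int N (E i)"
  shows "Re (herm_form S a (\<lambda>i j. block R i j * (\<integral>x. E i x * cnj (E j x) \<partial>N))) =
    corr_form N R (\<lambda>x. \<Sum>i\<in>S. (of_bool (fst i) * a i) * E i x) (\<lambda>x. \<Sum>i\<in>S. (of_bool (\<not> fst i) * a i) * E i x)"
proof -
  define A where "A x = (\<Sum>i\<in>S. (of_bool (fst i) * a i) * E i x)" for x
  define B where "B x = (\<Sum>i\<in>S. (of_bool (\<not> fst i) * a i) * E i x)" for x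
  define G where "G i j = (\<integral>x. E i x * cnj (E j x) \<partial>N)" for i j
  have sq: "sqnorm N f = Re (\<integral>x. f x * cnj (f x) \<partial>N)" for f :: "'a \<Rightarrow> complex"
    by (simp add: complex_norm_square[symmetric] del: of_real_power)
  have "(\<integral>x. B x * cnj (A x) \<partial>N) = cnj (\<integral>x. A x * cnj (B x) \<partial>N)"
    using Bochner_Integration.integral_cnj[of N "\<lambda>x. A x * cnj (B x)"] by (simp add: mult.commute)
  then have BA: "Re (\<integral>x. A x * cnj (B x) \<partial>N) = Re (\<integral>x. B x * cnj (A x) \<partial>N)"
    by simp
  have "corr_form N R A B = Re (of_real R * (\<integral>x. A x * cnj (A x) \<partial>N) + of_real R * (\<integral>x. B x * cnj (B x) \<partial>N)
      + (\<integral>x. A x * cnj (B x) \<partial>N) + (\<integral>x. B x * cnj (A x) \<partial>N))"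
    unfolding corr_form_def sq by (simp add: BA distrib_left)
  also have "of_real R * (\<integral>x. A x * cnj (A x) \<partial>N) + of_real R * (\<integral>x. B x * cnj (B x) \<partial>N)
      + (\<integral>x. A x * cnj (B x) \<partial>N) + (\<integral>x. B x * cnj (A x) \<partial>N) =
      herm_form S a (\<lambda>i j. block R i j * G i j)"
    unfolding A_def B_def sesquilinear_sum[OF S] G_def[symmetric] sum_distrib_left sum.distrib[symmetric]
    by (intro sum.cong refl) (auto simp: block_def)
  finally show ?thesis
    by (simp add: A_def[abs_def] B_def[abs_def] G_def)
qed

lemma nonneg_form_blockI:
  fixes E :: "bool \<times> 'b \<Rightarrow> 'a \<Rightarrow> complex"
  assumes S: "finite S" "\<And>i. sq_int N (E i)"
    and "\<And>a. 0 \<le> corr_form N R (\<lambda>x. \<Sum>i\<in>S. (of_bool (fst i) * a i) * E i x)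
      (\<lambda>x. \<Sum>i\<in>S. (of_bool (\<not> fst i) * a i) * E i x)"
  shows "nonneg_form S (\<lambda>i j. block R i j * (\<integral>x. E i x * cnj (E j x) \<partial>N))"
  unfolding nonneg_form_def Re_block_gram[OF S] using assms(3) by blast

text \<open>The Schur product theorem is immediate when one factor is a Gram kernel: the form of the product is
  an integral of forms of the other factor.\<close>

lemma nonneg_form_mult_gram:
  assumes L: "nonneg_form S L" and S: "finite S" "\<And>i. sq_int N (E i)"
  shows "nonneg_form S (\<lambda>i j. L i j * (\<integral>x. E i x * cnj (E j x) \<partial>N))"
  unfolding nonneg_form_def
proof
  fix a
  have int: "integrable N (\<lambda>x. a i * cnj (a j) * L i j * (E i x * cnj (E j x)))" for i j
    using sq_int_integrable_mult[OF S(2) S(2), of i j] by simp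
  define Q where "Q x = (\<Sum>i\<in>S. \<Sum>j\<in>S. a i * cnj (a j) * L i j * (E i x * cnj (E j x)))" for x
  have Q: "integrable N Q"
    unfolding Q_def using int by simp
  have "herm_form S a (\<lambda>i j. L i j * (\<integral>x. E i x * cnj (E j x) \<partial>N)) = (\<integral>x. Q x \<partial>N)"
    unfolding Q_def using int by (simp add: Bochner_Integration.integral_sum mult.assoc)
  moreover have "0 \<le> Re (Q x)" for x
    using L[unfolded nonneg_form_def, rule_format, of "\<lambda>i. a i * E i x"] by (simp add: Q_def mult_ac)
  ultimately show "0 \<le> Re (herm_form S a (\<lambda>i j. L i j * (\<integral>x. E i x * cnj (E j x) \<partial>N)))"
    using integral_Re[OF Q] Bochner_Integration.integral_nonneg[of N "\<lambda>x. Re (Q x)"] by simp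
qed

text \<open>Induction starts at the first power, where \<open>K\<close> is the hypothesis; each
  further factor is a Gram kernel. At power 0 the claim would concern \<open>block R\<close> alone,
  whose form takes the value \<open>2 * R - 2\<close> for coefficients 1 and -1 on one index of each
  flag.\<close>

lemma nonneg_form_block_exp:
  fixes E :: "bool \<times> 'b \<Rightarrow> 'a \<Rightarrow> complex"
  assumes S: "finite S" "\<And>i. sq_int N (E i)"
    and K: "nonneg_form S (\<lambda>i j. block R i j * (\<integral>x. E i x * cnj (E j x) \<partial>N))"
  shows "nonneg_form S (\<lambda>i j. block R i j * (exp (\<integral>x. E i x * cnj (E j x) \<partial>N) - 1))"
proof -
  define G where "G i j = (\<integral>x. E i x * cnj (E j x) \<partial>N)" for i j
  have power: "nonneg_form S (\<lambda>i j. block R i j * G i j ^ Suc n)" for n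
  proof (induction n)
    case (Suc n)
    from nonneg_form_mult_gram[OF Suc S] show ?case
      by (simp add: G_def mult_ac)
  qed (use K in \<open>simp add: G_def\<close>)
  have "nonneg_form S (\<lambda>i j. block R i j * (exp (G i j) - 1))"
  proof (rule nonneg_form_limit)
    show "nonneg_form S (\<lambda>i j. \<Sum>k<n. of_real (1 / fact (Suc k)) * (block R i j * G i j ^ Suc k))" for n
      by (intro nonneg_form_sum nonneg_form_scale power) auto
    fix i j
    have "(\<lambda>n. G i j ^ n /\<^sub>R fact n) sums exp (G i j)"
      by (rule exp_converges)
    then have "(\<lambda>n. G i j ^ Suc n /\<^sub>R fact (Suc n)) sums (exp (G i j) - 1)"
      by (subst sums_Suc_iff) simp
    then have "(\<lambda>n. block R i j * (G i j ^ Suc n /\<^sub>R fact (Suc n))) sums (block R i j * (exp (G i j) - 1))"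
      by (rule sums_mult)
    then show "(\<lambda>n. \<Sum>k<n. of_real (1 / fact (Suc k)) * (block R i j * G i j ^ Suc k))
        \<longlonglongrightarrow> block R i j * (exp (G i j) - 1)"
      unfolding sums_def by (simp add: scaleR_conv_of_real divide_inverse mult_ac del: power_Suc)
  qed
  then show ?thesis
    by (simp add: G_def)
qed

text \<open>The flag makes the index set a disjoint union, so the two functions may use the same
  frequencies with independent coefficients.\<close>

lemma corr_form_of_nonneg_form:
  fixes E :: "bool \<times> 'b \<Rightarrow> 'a \<Rightarrow> complex"
  assumes form: "\<And>S. finite S \<Longrightarrow> nonneg_form S (\<lambda>i j. block R i j * (\<integral>x. E i x * cnj (E j x) \<partial>N))"
    and E: "\<And>i. sq_int N (E i)" and S: "finite S" "finite T"
  shows "0 \<le> corr_form N R (\<lambda>x. \<Sum>u\<in>S. a u * E (True, u) x) (\<lambda>x. \<Sum>v\<in>T. b v * E (False, v) x)"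
proof -
  define I where "I = Pair True ` S \<union> Pair False ` T"
  define c where "c i = (if fst i then a (snd i) else b (snd i))" for i :: "bool \<times> 'b"
  have fin: "finite I" using S by (simp add: I_def)
  have sum: "(\<Sum>i\<in>I. f i) = (\<Sum>u\<in>S. f (True, u)) + (\<Sum>v\<in>T. f (False, v))" for f :: "_ \<Rightarrow> complex"
    unfolding I_def using S
    by (subst sum.union_disjoint) (auto simp: sum.reindex inj_on_def)
  show ?thesis
    using form[OF fin, unfolded nonneg_form_def, rule_format, of c] unfolding Re_block_gram[OF fin E]
    by (simp add: sum c_def)
qed

section \<open>Approximation by trigonometric polynomials vanishing at the origin\<close>

lemma cmod_cis_minus_one_le: "cmod (cis t - 1) \<le> \<bar>t\<bar>"
  using iexp_approx1[of t 0] by (simp add: cis_conv_exp)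

lemma cmod_cis_minus_one_square: "(cmod (cis t - 1))\<^sup>2 = 2 - 2 * cos t"
proof -
  have "(cmod (cis t - 1))\<^sup>2 = (cos t - 1)\<^sup>2 + (sin t)\<^sup>2"
    by (simp add: cmod_power2)
  also have "\<dots> = ((sin t)\<^sup>2 + (cos t)\<^sup>2) + 1 - 2 * cos t"
    by (simp add: power2_diff del: sin_cos_squared_add)
  finally show ?thesis by simp
qed

text \<open>Functions vanishing at \<open>0\<close> are approximated by multiples of \<open>1 - cos (x / T)\<close>, whose square
  turns the infinite measure into a finite one to which the density of trigonometric polynomials applies.\<close>

lemma trig_poly_dense_zero:
  assumes [measurable]: "f \<in> borel_measurable N" and min: "integrable N (\<lambda>z. min 1 ((f z)\<^sup>2))"
    and [measurable]: "w \<in> borel_measurable borel"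
    and w: "\<And>x. (w x)\<^sup>2 \<le> C * min 1 (x\<^sup>2)" "\<And>x. \<bar>x\<bar> > T \<Longrightarrow> w x = 0" and T: "T \<ge> 1"
  obtains q where "\<And>n. trig_poly (q n)" "\<And>n. q n 0 = 0" "\<And>n. sq_int N (\<lambda>z. q n (f z))"
    "(\<lambda>n. sqnorm N (\<lambda>z. q n (f z) - of_real (w (f z)))) \<longlonglongrightarrow> 0"
proof -
  \<comment> \<open>The period \<open>2 * pi * T\<close> exceeds \<open>T\<close>, so 0 is the only
    zero of \<open>p\<close> with \<open>\<bar>x\<bar> \<le> T\<close>. The shape
    \<open>x - 0\<close> is that of \<open>trig_poly_cos\<close>.\<close>
  define p where "p x = 1 - cos (1 / T * (x - 0))" for x
  have [measurable]: "p \<in> borel_measurable borel"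
    unfolding p_def by measurable
  have p0: "0 \<le> p x" for x by (simp add: p_def)
  \<comment> \<open>From 0 <= p <= 2 follows p^2 <= 2 p, and 2 p is the squared chord |cis (x / T) -
    1|^2, which is at most x^2 since T >= 1.\<close>
  have p_le: "(p x)\<^sup>2 \<le> 4 * min 1 (x\<^sup>2)" for x
  proof -
    have p2: "p x \<le> 2"
      using cos_ge_minus_one[of "1 / T * x"] by (simp add: p_def)
    have "2 * p x = (cmod (cis (x / T) - 1))\<^sup>2"
      by (simp add: cmod_cis_minus_one_square p_def)
    also have "\<dots> \<le> \<bar>x / T\<bar>\<^sup>2"
      by (intro power_mono cmod_cis_minus_one_le) auto
    also have "\<dots> \<le> \<bar>x\<bar>\<^sup>2"
      using T mult_left_mono[of 1 T "\<bar>x\<bar>"] by (intro power_mono) (auto simp: abs_div divide_le_eq)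
    finally have "2 * p x \<le> x\<^sup>2" by simp
    moreover have "p x * p x \<le> 2 * p x" "p x * p x \<le> 2 * 2"
      using mult_right_mono[OF p2 p0[of x]] mult_mono[OF p2 p2] p0[of x] by simp_all
    ultimately have "(p x)\<^sup>2 \<le> x\<^sup>2" "(p x)\<^sup>2 \<le> 4"
      by (simp_all add: power2_eq_square)
    then show ?thesis
      using zero_le_power2[of x] unfolding min_def by (split if_split) linarith
  qed
  \<comment> \<open>Division by zero is harmless: the zeros of \<open>p\<close> are 0 and points
    beyond \<open>T\<close>, and \<open>w\<close> vanishes at all of them.\<close>
  have pw: "p x * (w x / p x) = w x" for x
  proof (cases "p x = 0")
    case True
    have "x = 0 \<or> \<bar>x\<bar> > T"
    proof (rule ccontr)
      assume "\<not> (x = 0 \<or> \<bar>x\<bar> > T)"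
      then have x: "\<bar>x\<bar> / T \<le> 1" "0 < \<bar>x\<bar> / T"
        using T by (auto simp: divide_le_eq)
      have "cos (\<bar>x\<bar> / T) < cos 0"
        using x pi_gt3 by (intro cos_monotone_0_pi) auto
      then have "p x > 0"
        by (cases "x \<ge> 0") (auto simp: p_def)
      with True show False by simp
    qed
    then have "w x = 0"
      using w(1)[of 0] w(2)[of x] by auto
    then show ?thesis by simp
  qed simp
  have int_p: "integrable N (\<lambda>z. (p (f z))\<^sup>2)"
  proof (rule Bochner_Integration.integrable_bound)
    show "integrable N (\<lambda>z. 4 * min 1 ((f z)\<^sup>2))"
      using min by simp
  qed (use p_le in auto)
  have int_w: "integrable N (\<lambda>z. (w (f z))\<^sup>2)"
  proof (rule Bochner_Integration.integrable_bound)
    show "integrable N (\<lambda>z. C * min 1 ((f z)\<^sup>2))"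
      using min by simp
    show "AE z in N. norm ((w (f z))\<^sup>2) \<le> norm (C * min 1 ((f z)\<^sup>2))"
      using w(1) by (intro AE_I2) (metis abs_ge_self abs_of_nonneg order_trans real_norm_def zero_le_power2)
  qed measurable
  define m where "m = distr (density N (\<lambda>z. ennreal ((p (f z))\<^sup>2))) borel f"
  have im: "(\<integral>x. g x \<partial>m) = (\<integral>z. (p (f z))\<^sup>2 * g (f z) \<partial>N)"
      "integrable m g \<longleftrightarrow> integrable N (\<lambda>z. (p (f z))\<^sup>2 * g (f z))"
    if [measurable]: "g \<in> borel_measurable borel" for g :: "real \<Rightarrow> real"
  proof -
    let ?D = "density N (\<lambda>z. ennreal ((p (f z))\<^sup>2))"
    have "(\<integral>x. g x \<partial>m) = (\<integral>z. g (f z) \<partial>?D)"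
      unfolding m_def by (rule integral_distr) simp_all
    also have "\<dots> = (\<integral>z. (p (f z))\<^sup>2 *\<^sub>R g (f z) \<partial>N)"
      by (rule integral_density) simp_all
    finally show "(\<integral>x. g x \<partial>m) = (\<integral>z. (p (f z))\<^sup>2 * g (f z) \<partial>N)"
      by simp
    have "integrable m g \<longleftrightarrow> integrable ?D (\<lambda>z. g (f z))"
      unfolding m_def by (rule integrable_distr_eq) simp_all
    also have "\<dots> \<longleftrightarrow> integrable N (\<lambda>z. (p (f z))\<^sup>2 *\<^sub>R g (f z))"
      by (rule integrable_density) simp_all
    finally show "integrable m g \<longleftrightarrow> integrable N (\<lambda>z. (p (f z))\<^sup>2 * g (f z))"
      by simp
  qed
  have "finite_measure m"
  proof
    have "emeasure m (space m) = (\<integral>\<^sup>+z. ennreal ((p (f z))\<^sup>2) \<partial>N)"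
      unfolding m_def by (subst emeasure_distr) (auto simp: emeasure_density intro!: nn_integral_cong)
    also have "\<dots> < \<infinity>"
      using int_p by (simp add: integrable_iff_bounded)
    finally show "emeasure m (space m) \<noteq> \<infinity>" by simp
  qed
  then interpret m: finite_real_measure m
    by (simp add: finite_real_measure_def finite_real_measure_axioms_def m_def)
  \<comment> \<open>This quotient is square-integrable for \<open>m\<close>, because the weight in
    \<open>m\<close> cancels the denominator and leaves the integral of the square of
    \<open>w\<close>.\<close>
  define g where "g x = w x / p x" for x
  have [measurable]: "g \<in> borel_measurable borel"
    unfolding g_def by measurable
  have "(\<lambda>z. (p (f z))\<^sup>2 * (g (f z))\<^sup>2) = (\<lambda>z. (w (f z))\<^sup>2)"
    by (simp only: power_mult_distrib[symmetric] g_def pw)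
  then have "integrable m (\<lambda>x. (g x)\<^sup>2)"
    using int_w by (subst im(2)) auto
  then obtain q where q: "\<And>n. trig_poly (q n)" "(\<lambda>n. sqnorm m (\<lambda>x. of_real (g x) - q n x)) \<longlonglongrightarrow> 0"
    using m.trig_poly_dense[of g] by auto
  \<comment> \<open>Multiplication by \<open>p\<close> is an isometry from L^2 of \<open>m\<close>
    into L^2 of \<open>N\<close> that sends \<open>g\<close> to \<open>w\<close> and, since
    \<open>p\<close> is a trigonometric polynomial vanishing at 0, sends \<open>q n\<close> to an
    admissible approximant.\<close>
  define r where "r n x = of_real (p x) * q n x" for n x
  have tp: "trig_poly (\<lambda>x. of_real (p x))"
  proof -
    have "trig_poly (\<lambda>x. 1 + (-1) * of_real (cos (1 / T * (x - 0))))"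
      by (intro trig_poly_add trig_poly_mult trig_poly_const trig_poly_cos)
    then show ?thesis by (simp add: p_def)
  qed
  have r: "trig_poly (r n)" for n
    unfolding r_def by (intro trig_poly_mult tp q)
  note [measurable] = trig_poly_measurable[OF r] trig_poly_measurable[OF q(1)]
  show ?thesis
  proof
    show "trig_poly (r n)" for n by (rule r)
    show "r n 0 = 0" for n by (simp add: r_def p_def)
    show "sq_int N (\<lambda>z. r n (f z))" for n
    proof -
      obtain K where K: "\<And>x. cmod (q n x) \<le> K"
        using trig_poly_bounded[OF q(1)] by blast
      have "integrable N (\<lambda>z. (cmod (r n (f z)))\<^sup>2)"
      proof (rule Bochner_Integration.integrable_bound)
        show "integrable N (\<lambda>z. K\<^sup>2 * (p (f z))\<^sup>2)"
          using int_p by simp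
        have "(cmod (r n x))\<^sup>2 \<le> K\<^sup>2 * (p x)\<^sup>2" for x
          using K[of x] by (auto simp: r_def norm_mult power_mult_distrib mult.commute[of "K\<^sup>2"]
              intro!: mult_left_mono power_mono)
        then show "AE z in N. norm ((cmod (r n (f z)))\<^sup>2) \<le> norm (K\<^sup>2 * (p (f z))\<^sup>2)"
          by simp
      qed measurable
      then show ?thesis
        by (simp add: sq_int_def)
    qed
    have "(sqnorm m (\<lambda>x. of_real (g x) - q n x)) = (sqnorm N (\<lambda>z. r n (f z) - of_real (w (f z))))" for n
    proof -
      have "(p x)\<^sup>2 * (cmod (of_real (g x) - q n x))\<^sup>2 = (cmod (r n x - of_real (w x)))\<^sup>2" for x
      proof -
        have "(p x)\<^sup>2 * (cmod (of_real (g x) - q n x))\<^sup>2 = (cmod (of_real (p x) * (of_real (g x) - q n x)))\<^sup>2"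
          by (simp add: norm_mult power_mult_distrib)
        also have "of_real (p x) * (of_real (g x) - q n x) = of_real (p x * g x) - r n x"
          by (simp add: r_def right_diff_distrib)
        also have "p x * g x = w x"
          unfolding g_def by (rule pw)
        finally show ?thesis
          by (simp add: norm_minus_commute)
      qed
      then show ?thesis
        by (subst im(1)) auto
    qed
    with q(2) show "(\<lambda>n. sqnorm N (\<lambda>z. r n (f z) - of_real (w (f z)))) \<longlonglongrightarrow> 0"
      by simp
  qed
qed

lemma borel_measurable_cis [measurable]: "cis \<in> borel_measurable borel"
proof (rule borel_measurable_continuous_onI)
  show "continuous_on UNIV cis"
    unfolding cis_conv_exp by (intro continuous_intros)
qed

lemma norm_pair_square: "(norm z)\<^sup>2 = (fst z)\<^sup>2 + (snd z)\<^sup>2" for z :: "real \<times> real"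
  by (simp add: norm_prod_def)

lemma min_norm_square: "(min 1 (norm z))\<^sup>2 = min 1 ((fst z)\<^sup>2 + (snd z)\<^sup>2)" for z :: "real \<times> real"
proof (cases "norm z \<le> 1")
  case True
  then have "(norm z)\<^sup>2 \<le> 1"
    by (simp add: abs_square_le_1)
  with True show ?thesis
    by (simp add: norm_pair_square[symmetric] min_absorb2)
next
  case False
  then have "1 \<le> (norm z)\<^sup>2"
    by (simp add: one_le_power)
  with False show ?thesis
    by (simp add: norm_pair_square[symmetric] min_absorb1)
qed

lemma cmod_cis_minus_one_min: "cmod (cis (u \<bullet> z) - 1) \<le> (2 + norm u) * min 1 (norm z)"
proof (cases "norm z \<le> 1")
  case True
  have "cmod (cis (u \<bullet> z) - 1) \<le> \<bar>u \<bullet> z\<bar>"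
    by (rule cmod_cis_minus_one_le)
  also have "\<dots> \<le> norm u * norm z"
    by (rule Cauchy_Schwarz_ineq2)
  also have "\<dots> \<le> (2 + norm u) * norm z"
    by (intro mult_right_mono) auto
  finally show ?thesis
    using True by (simp add: min_absorb2)
next
  case False
  have "cmod (cis (u \<bullet> z) - 1) \<le> cmod (cis (u \<bullet> z)) + cmod 1"
    by (rule norm_triangle_ineq4)
  with False show ?thesis by (simp add: min_absorb1 add_increasing2)
qed

text \<open>The index \<open>(True, u)\<close> stands for the function \<open>cis (u * x)\<close> of the first coordinate, the index
  \<open>(False, v)\<close> for \<open>cis (v * y)\<close>.\<close>

definition freq :: "bool \<times> real \<Rightarrow> real \<times> real" where
  "freq i = (if fst i then (snd i, 0) else (0, snd i))"

lemma freq_simps: "freq (True, u) \<bullet> z = u * fst z" "freq (False, u) \<bullet> z = u * snd z"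
  by (simp_all add: freq_def inner_prod_def)

section \<open>The Levy-Khintchine exponent and its Gram kernel\<close>

context stable_spectrum
begin

lemma sq_int_cis: "sq_int \<nu> (\<lambda>z. cis (u \<bullet> z) - 1)"
proof -
  have [measurable]: "(\<lambda>z. cis (u \<bullet> z) - 1) \<in> borel_measurable borel"
    by measurable
  have "integrable \<nu> (\<lambda>z. (cmod (cis (u \<bullet> z) - 1))\<^sup>2)"
  proof (rule integrable_levyI)
    fix z
    have "(cmod (cis (u \<bullet> z) - 1))\<^sup>2 \<le> ((2 + norm u) * min 1 (norm z))\<^sup>2"
      by (intro power_mono cmod_cis_minus_one_min) auto
    also have "\<dots> = (2 + norm u)\<^sup>2 * min 1 ((fst z)\<^sup>2 + (snd z)\<^sup>2)"
      by (simp only: power_mult_distrib min_norm_square)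
    finally show "norm ((cmod (cis (u \<bullet> z) - 1))\<^sup>2) \<le> (2 + norm u)\<^sup>2 * min 1 ((fst z)\<^sup>2 + (snd z)\<^sup>2)"
      by simp
  qed measurable
  then show ?thesis
    by (simp add: sq_int_def measurable_cong_sets[OF sets_levy refl])
qed

definition kern :: "real \<times> real \<Rightarrow> real \<times> real \<Rightarrow> complex" where
  "kern u v = (\<integral>z. (cis (u \<bullet> z) - 1) * cnj (cis (v \<bullet> z) - 1) \<partial>\<nu>)"

definition levy_integrand :: "real \<times> real \<Rightarrow> real \<times> real \<Rightarrow> complex" where
  "levy_integrand u z = cis (u \<bullet> z) - 1
     - \<i> * of_real (u \<bullet> z) * indicator {(x, y). 0 < x\<^sup>2 + y\<^sup>2 \<and> x\<^sup>2 + y\<^sup>2 \<le> 1} z"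

text \<open>Inside the unit ball the integrand is a Taylor remainder of second order; outside it is
  bounded by 2. The origin goes with the outer case because the truncation indicator excludes
  it.\<close>

lemma integrable_levy_integrand: "integrable \<nu> (levy_integrand u)"
proof (rule integrable_levyI)
  have [measurable]: "{(x, y). 0 < x\<^sup>2 + y\<^sup>2 \<and> x\<^sup>2 + y\<^sup>2 \<le> 1} \<in> sets (borel :: (real \<times> real) measure)"
  proof -
    have "{(x, y). 0 < x\<^sup>2 + y\<^sup>2 \<and> x\<^sup>2 + y\<^sup>2 \<le> 1} = {z :: real \<times> real. 0 < norm z \<and> norm z \<le> 1}"
      using norm_pair_square by (auto simp: norm_Pair sum_power2_gt_zero_iff zero_prod_def)
    also have "\<dots> \<in> sets borel"
      by measurable
    finally show ?thesis .
  qed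
  show "levy_integrand u \<in> borel_measurable borel"
    unfolding levy_integrand_def by measurable
  fix z
  show "norm (levy_integrand u z) \<le> (2 + (norm u)\<^sup>2) * min 1 ((fst z)\<^sup>2 + (snd z)\<^sup>2)"
  proof (cases "z = 0 \<or> norm z > 1")
    case True
    then have l: "levy_integrand u z = cis (u \<bullet> z) - 1"
    proof
      assume "norm z > 1"
      then have "1 < (norm z)\<^sup>2" by (simp add: one_less_power)
      then show ?thesis
        by (cases z) (auto simp: levy_integrand_def norm_pair_square)
    qed (simp add: levy_integrand_def)
    show ?thesis
    proof (cases "z = 0")
      case False
      then have m: "min 1 (norm z) = 1" using True by auto
      have "norm (levy_integrand u z) \<le> 2"
        unfolding l using norm_triangle_ineq4[of "cis (u \<bullet> z)" 1] by simp
      then show ?thesis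
        unfolding min_norm_square[symmetric] m by (simp add: add_increasing2)
    qed (simp add: levy_integrand_def)
  next
    case False
    then have z: "0 < norm z" "norm z \<le> 1" by auto
    then have z2: "0 < (norm z)\<^sup>2" "(norm z)\<^sup>2 \<le> 1"
      by (simp_all add: abs_square_le_1)
    have "levy_integrand u z = iexp (u \<bullet> z) - (\<Sum>k\<le>1. (\<i> * of_real (u \<bullet> z)) ^ k / fact k)"
      using z2 by (cases z) (simp add: levy_integrand_def cis_conv_exp norm_pair_square)
    then have "norm (levy_integrand u z) \<le> \<bar>u \<bullet> z\<bar>\<^sup>2 / 2"
      using iexp_approx1[of "u \<bullet> z" 1] by (simp add: numeral_2_eq_2)
    also have "\<dots> \<le> (norm u * norm z)\<^sup>2"
    proof -
      have "\<bar>u \<bullet> z\<bar>\<^sup>2 \<le> (norm u * norm z)\<^sup>2"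
        by (intro power_mono Cauchy_Schwarz_ineq2) auto
      then show ?thesis
        using zero_le_power2[of "norm u * norm z"] by linarith
    qed
    also have "\<dots> \<le> (2 + (norm u)\<^sup>2) * (min 1 (norm z))\<^sup>2"
      using z by (simp add: power_mult_distrib min_absorb2 mult_right_mono)
    finally show ?thesis
      unfolding min_norm_square .
  qed
qed

text \<open>With a and b the values of the two exponentials, ab - 1 = (a - 1) + (b - 1) + (a - 1)(b
  - 1); the compensator is linear in the frequency and therefore contributes nothing to the product
  term.\<close>

lemma levy_exponent_diff:
  "(\<integral>z. levy_integrand (u - v) z \<partial>\<nu>) =
     (\<integral>z. levy_integrand u z \<partial>\<nu>) + (\<integral>z. levy_integrand (- v) z \<partial>\<nu>) + kern u v"
proof -
  have i: "integrable \<nu> (\<lambda>z. (cis (u \<bullet> z) - 1) * cnj (cis (v \<bullet> z) - 1))"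
    by (intro sq_int_integrable_mult sq_int_cis)
  have "levy_integrand (u - v) z = levy_integrand u z + levy_integrand (- v) z
      + (cis (u \<bullet> z) - 1) * cnj (cis (v \<bullet> z) - 1)" for z
  proof -
    have "cis ((u - v) \<bullet> z) = cis (u \<bullet> z) * cis (- (v \<bullet> z))"
      by (simp add: cis_mult inner_diff_left)
    moreover have "cis (- (v \<bullet> z)) = cnj (cis (v \<bullet> z))"
      by (simp add: cis_cnj)
    ultimately show ?thesis
      by (simp add: levy_integrand_def inner_diff_left algebra_simps)
  qed
  then show ?thesis
    unfolding kern_def using integrable_levy_integrand i by simp
qed

lemma kern_scale:
  assumes "c > 0"
  shows "kern (c *\<^sub>R u) (c *\<^sub>R v) = of_real (c powr \<alpha>) * kern u v"
proof -
  have i: "integrable \<nu> (\<lambda>z. (cis (u \<bullet> z) - 1) * cnj (cis (v \<bullet> z) - 1))" for u v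
    by (intro sq_int_integrable_mult sq_int_cis)
  have "u \<bullet> (c * fst z, c * snd z) = (c *\<^sub>R u) \<bullet> z" for u z :: "real \<times> real"
    by (simp add: inner_prod_def algebra_simps)
  then show ?thesis
    using levy_scale[OF assms i[of u v]] i[of "c *\<^sub>R u" "c *\<^sub>R v"] by (simp add: kern_def scaleR_conv_of_real)
qed

lemma nonneg_form_block_kern:
  assumes R: "bilinear_bound R" "0 \<le> R" and S: "finite S"
  shows "nonneg_form S (\<lambda>i j. block R i j * kern (freq i) (freq j))"
  unfolding kern_def
proof (rule nonneg_form_blockI[OF S sq_int_cis])
  fix a :: "bool \<times> real \<Rightarrow> complex"
  define h where "h b x = (\<Sum>i\<in>S. (of_bool (fst i = b) * a i) * (cis (snd i * x) - 1))" for b x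
  define L where "L = (\<Sum>i\<in>S. cmod (a i) * (2 + \<bar>snd i\<bar>))"
  have [measurable]: "h b \<in> borel_measurable borel" for b
    unfolding h_def by measurable
  have "(cmod (h b x))\<^sup>2 \<le> L\<^sup>2 * min 1 (x\<^sup>2)" for b x
  proof -
    have "cmod (h b x) \<le> (\<Sum>i\<in>S. cmod (a i) * ((2 + \<bar>snd i\<bar>) * min 1 \<bar>x\<bar>))"
      unfolding h_def
    proof (rule sum_norm_le)
      fix i
      show "cmod ((of_bool (fst i = b) * a i) * (cis (snd i * x) - 1)) \<le> cmod (a i) * ((2 + \<bar>snd i\<bar>) * min 1 \<bar>x\<bar>)"
        using cmod_cis_minus_one_min[of "snd i" x] by (auto simp: norm_mult intro!: mult_left_mono)
    qed
    also have "\<dots> = L * min 1 \<bar>x\<bar>"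
      by (simp add: L_def sum_distrib_right mult.assoc)
    finally have "(cmod (h b x))\<^sup>2 \<le> (L * min 1 \<bar>x\<bar>)\<^sup>2"
      by (intro power_mono) auto
    also have "\<dots> = L\<^sup>2 * min 1 (x\<^sup>2)"
      using min_norm_square[of "(x, 0)"] by (simp add: power_mult_distrib)
    finally show ?thesis .
  qed
  with R have "0 \<le> corr_form \<nu> R (\<lambda>z. h True (fst z)) (\<lambda>z. h False (snd z))"
    by (intro corr_form_levy_nonneg[where C = "L\<^sup>2"]) auto
  moreover have "h True (fst z) = (\<Sum>i\<in>S. (of_bool (fst i) * a i) * (cis (freq i \<bullet> z) - 1))"
    "h False (snd z) = (\<Sum>i\<in>S. (of_bool (\<not> fst i) * a i) * (cis (freq i \<bullet> z) - 1))" for z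
    unfolding h_def by (intro sum.cong refl; auto simp: freq_def inner_prod_def)+
  ultimately show "0 \<le> corr_form \<nu> R (\<lambda>z. \<Sum>i\<in>S. (of_bool (fst i) * a i) * (cis (freq i \<bullet> z) - 1))
      (\<lambda>z. \<Sum>i\<in>S. (of_bool (\<not> fst i) * a i) * (cis (freq i \<bullet> z) - 1))" by simp
qed

lemma integrable_min_fst: "integrable \<nu> (\<lambda>z. min 1 ((fst z)\<^sup>2))"
  by (rule levy_fst(1)[of "\<lambda>x. min 1 (x\<^sup>2)" 1]) auto

lemma integrable_min_snd: "integrable \<nu> (\<lambda>z. min 1 ((snd z)\<^sup>2))"
  by (rule levy_snd(1)[of "\<lambda>x. min 1 (x\<^sup>2)" 1]) auto

text \<open>Since the coefficients sum to 0, subtracting 1 from each exponential changes nothing.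
  This puts the approximants into the span of the functions whose Gram kernel is
  \<open>kern\<close>.\<close>

lemma trig_poly_zero_eq:
  assumes "trig_poly q" "q 0 = 0"
  obtains S a where "finite S" "q = (\<lambda>x. \<Sum>u\<in>S. a u * (cis (u * x) - 1))"
proof -
  obtain S a where q: "finite S" "q = (\<lambda>x. \<Sum>u\<in>S. a u * cis (u * x))"
    using assms(1) by (auto simp: trig_poly_def)
  have "(\<Sum>u\<in>S. a u) = 0"
    using assms(2) by (simp add: q)
  then have "q = (\<lambda>x. \<Sum>u\<in>S. a u * (cis (u * x) - 1))"
    by (simp add: q right_diff_distrib sum_subtractf)
  with q(1) show ?thesis ..
qed

lemma bilinear_bound_of_nonneg_form:
  assumes R: "0 \<le> R"
    and form: "\<And>S. finite S \<Longrightarrow> nonneg_form S (\<lambda>i j. block R i j * kern (freq i) (freq j))"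
  shows "bilinear_bound R"
proof (rule bilinear_boundI[OF R])
  fix c d :: "real \<Rightarrow> real" and T :: real assume T: "T \<ge> 1"
  define w where "w x = - window c T x" for x
  obtain K where K: "\<And>x. (window c T x)\<^sup>2 \<le> K\<^sup>2 * min 1 (x\<^sup>2)"
    using window_bounds[OF T] by metis
  obtain L where L: "\<And>x. (window d T x)\<^sup>2 \<le> L\<^sup>2 * min 1 (x\<^sup>2)"
    using window_bounds[OF T] by metis
  have fs: "fst \<in> borel_measurable \<nu>" "snd \<in> borel_measurable \<nu>"
    using borel_measurable_fst_snd[of "\<lambda>x. x"] by (simp_all add: measurable_cong_sets[OF sets_levy refl])
  have w [measurable]: "w \<in> borel_measurable borel"
    unfolding w_def by measurable
  obtain q where q: "\<And>n. trig_poly (q n)" "\<And>n. q n 0 = 0" "\<And>n. sq_int \<nu> (\<lambda>z. q n (fst z))"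
    "(\<lambda>n. sqnorm \<nu> (\<lambda>z. q n (fst z) - of_real (w (fst z)))) \<longlonglongrightarrow> 0"
    by (rule trig_poly_dense_zero[OF fs(1) integrable_min_fst w, of "K\<^sup>2" T])
      (use K T in \<open>auto simp: w_def window_def\<close>)
  obtain r where r: "\<And>n. trig_poly (r n)" "\<And>n. r n 0 = 0" "\<And>n. sq_int \<nu> (\<lambda>z. r n (snd z))"
    "(\<lambda>n. sqnorm \<nu> (\<lambda>z. r n (snd z) - of_real (window d T (snd z)))) \<longlonglongrightarrow> 0"
    by (rule trig_poly_dense_zero[OF fs(2) integrable_min_snd window_measurable, of d T "L\<^sup>2" T])
      (use L T in \<open>auto simp: window_def\<close>)
  have "0 \<le> corr_form \<nu> R (\<lambda>z. of_real (w (fst z))) (\<lambda>z. of_real (window d T (snd z)))"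
  proof (rule corr_form_limit[OF q(3) _ r(3) _ q(4) r(4)])
    show "sq_int \<nu> (\<lambda>z. of_real (w (fst z)))"
      using K by (intro levy_sq_int(1)[where C = "K\<^sup>2"]) (auto simp: w_def)
    show "sq_int \<nu> (\<lambda>z. of_real (window d T (snd z)))"
      using L by (intro levy_sq_int(2)[where C = "L\<^sup>2"]) auto
    fix n
    obtain S a where S: "finite S" "q n = (\<lambda>x. \<Sum>u\<in>S. a u * (cis (u * x) - 1))"
      using trig_poly_zero_eq[OF q(1,2)] by metis
    obtain S' b where S': "finite S'" "r n = (\<lambda>x. \<Sum>u\<in>S'. b u * (cis (u * x) - 1))"
      using trig_poly_zero_eq[OF r(1,2)] by metis
    show "0 \<le> corr_form \<nu> R (\<lambda>z. q n (fst z)) (\<lambda>z. r n (snd z))"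
      using corr_form_of_nonneg_form[OF form[unfolded kern_def] sq_int_cis S(1) S'(1), of a b]
      by (simp add: S S' freq_simps)
  qed
  then show "0 \<le> corr_form \<nu> R (\<lambda>z. of_real (- window c T (fst z))) (\<lambda>z. of_real (window d T (snd z)))"
    by (simp add: w_def)
qed

end

section \<open>Covariances of the stable vector\<close>

lemma (in prob_space) integral_centred_le:
  assumes "sq_int M f"
  shows "(sqnorm M (\<lambda>\<omega>. f \<omega> - expectation f)) \<le> sqnorm M f"
proof -
  define e where "e = (\<integral>\<omega>. f \<omega> \<partial>M)"
  have const: "sq_int M (\<lambda>_. 1)"
    by (intro sq_int_bounded[of _ 1]) auto
  have int: "integrable M f"
    using sq_int_integrable_mult[OF assms const] by simp
  then have int': "integrable M (\<lambda>\<omega>. Re (f \<omega> * cnj e))"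
    by (intro integrable_Re) simp
  have "(sqnorm M (\<lambda>\<omega>. f \<omega> - e)) = (\<integral>\<omega>. (cmod (f \<omega>))\<^sup>2 - 2 * Re (f \<omega> * cnj e) + (cmod e)\<^sup>2 \<partial>M)"
    by (intro Bochner_Integration.integral_cong) (auto simp: cmod_power2 power2_diff algebra_simps)
  also have "\<dots> = sqnorm M f - 2 * (\<integral>\<omega>. Re (f \<omega> * cnj e) \<partial>M) + (cmod e)\<^sup>2"
    using assms int' by (simp add: sq_int_def prob_space del: times_complex.sel cnj.sel)
  also have "(\<integral>\<omega>. Re (f \<omega> * cnj e) \<partial>M) = Re (\<integral>\<omega>. f \<omega> * cnj e \<partial>M)"
    using int by (intro integral_Re) simp
  also have "\<dots> = Re (e * cnj e)"
    using int by (simp add: e_def)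
  also have "\<dots> = (cmod e)\<^sup>2"
    unfolding cmod_power2 by (simp add: power2_eq_square)
  finally show ?thesis
    by (simp add: e_def)
qed

lemma (in prob_space) sq_int_centred:
  assumes "sq_int M f"
  shows "sq_int M (\<lambda>\<omega>. f \<omega> - expectation f)"
  by (intro sq_int_diff assms sq_int_bounded[where C = "cmod (expectation f)"]) auto

lemma (in prob_space) sq_int_imp_integrable:
  assumes "sq_int M f"
  shows "integrable M f"
proof -
  have "sq_int M (\<lambda>_. 1)"
    by (intro sq_int_bounded[of _ 1]) auto
  from sq_int_integrable_mult[OF assms this] show ?thesis
    by simp
qed

lemma (in prob_space) trig_poly_dense_rv:
  assumes [measurable]: "X \<in> borel_measurable M" "\<phi> \<in> borel_measurable borel"
    and \<phi>: "square_integrable M (\<phi> \<circ> X)"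
  obtains q where "\<And>n. trig_poly (q n)" "\<And>n. sq_int M (\<lambda>\<omega>. q n (X \<omega>))"
    "(\<lambda>n. sqnorm M (\<lambda>\<omega>. q n (X \<omega>) - of_real (\<phi> (X \<omega>)))) \<longlonglongrightarrow> 0"
proof -
  interpret D: prob_space "distr M borel X"
    by (rule prob_space_distr) simp
  interpret D: finite_real_measure "distr M borel X"
    by unfold_locales simp
  have "integrable (distr M borel X) (\<lambda>x. (\<phi> x)\<^sup>2)"
    using \<phi> by (subst integrable_distr_eq) (auto simp: square_integrable_def)
  then obtain q where q: "\<And>n. trig_poly (q n)"
      "(\<lambda>n. \<integral>x. (cmod (of_real (\<phi> x) - q n x))\<^sup>2 \<partial>distr M borel X) \<longlonglongrightarrow> 0"
    using D.trig_poly_dense[of \<phi>] by auto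
  note [measurable] = trig_poly_measurable[OF q(1)]
  show ?thesis
  proof
    show "trig_poly (q n)" for n by (rule q)
    show "sq_int M (\<lambda>\<omega>. q n (X \<omega>))" for n
    proof -
      obtain C where "\<And>x. cmod (q n x) \<le> C"
        using trig_poly_bounded[OF q(1)] by blast
      then show ?thesis
        by (intro sq_int_bounded[of _ C]) auto
    qed
    have "(\<integral>x. (cmod (of_real (\<phi> x) - q n x))\<^sup>2 \<partial>distr M borel X) =
        (sqnorm M (\<lambda>\<omega>. q n (X \<omega>) - of_real (\<phi> (X \<omega>))))" for n
      by (subst integral_distr) (auto simp: norm_minus_commute)
    with q(2) show "(\<lambda>n. sqnorm M (\<lambda>\<omega>. q n (X \<omega>) - of_real (\<phi> (X \<omega>)))) \<longlonglongrightarrow> 0"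
      by simp
  qed
qed

locale stable_pair = stable_spectrum \<alpha> \<tau> + prob_space M
  for \<alpha> :: real and \<tau> :: "real measure" and M :: "'a measure" +
  fixes X Y :: "'a \<Rightarrow> real"
  assumes stable: "stable_vector M X Y \<alpha> \<tau>"
begin

lemma measurable_XY [measurable]: "X \<in> borel_measurable M" "Y \<in> borel_measurable M"
  using stable by (auto simp: stable_vector_def)

text \<open>The characteristic function of the vector \<open>(X, Y)\<close>.\<close>

definition Phi :: "real \<times> real \<Rightarrow> complex" where
  "Phi u = (\<integral>\<omega>. cis (u \<bullet> (X \<omega>, Y \<omega>)) \<partial>M)"

lemma sq_int_cis_XY: "sq_int M (\<lambda>\<omega>. cis (u \<bullet> (X \<omega>, Y \<omega>)))"
  unfolding inner_prod_def by (intro sq_int_bounded[of _ 1]) auto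

lemma Phi_uminus: "Phi (- u) = cnj (Phi u)"
  unfolding Phi_def Bochner_Integration.integral_cnj[symmetric] by (simp add: cis_cnj)

lemma Phi_exp: "\<exists>b. \<forall>u. Phi u = exp (\<i> * of_real (b \<bullet> u) + (\<integral>z. levy_integrand u z \<partial>\<nu>))"
proof -
  obtain b1 b2 :: real where b: "\<And>u1 u2. (LINT \<omega>|M. exp (\<i> * of_real (u1 * X \<omega> + u2 * Y \<omega>))) =
        exp (\<i> * of_real (b1 * u1 + b2 * u2) +
          (LINT z:UNIV - {(0, 0)}|\<nu>.
             (case z of (x, y) \<Rightarrow>
               exp (\<i> * of_real (u1 * x + u2 * y)) - 1
               - \<i> * of_real (u1 * x + u2 * y)
                 * indicator {(x, y). 0 < x\<^sup>2 + y\<^sup>2 \<and> x\<^sup>2 + y\<^sup>2 \<le> 1} (x, y))))"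
    using stable unfolding stable_vector_def by blast
  have "Phi u = exp (\<i> * of_real ((b1, b2) \<bullet> u) + (\<integral>z. levy_integrand u z \<partial>\<nu>))" for u
  proof -
    \<comment> \<open>Restricting the domain to the punctured plane has no effect, as
      \<open>levy_integrand u\<close> vanishes at the origin.\<close>
    have "(LINT z:UNIV - {(0, 0)}|\<nu>.
             (case z of (x, y) \<Rightarrow>
               exp (\<i> * of_real (fst u * x + snd u * y)) - 1
               - \<i> * of_real (fst u * x + snd u * y)
                 * indicator {(x, y). 0 < x\<^sup>2 + y\<^sup>2 \<and> x\<^sup>2 + y\<^sup>2 \<le> 1} (x, y))) = (\<integral>z. levy_integrand u z \<partial>\<nu>)"
      unfolding set_lebesgue_integral_def
      by (intro Bochner_Integration.integral_cong refl)
        (auto simp: levy_integrand_def indicator_def inner_prod_def cis_conv_exp)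
    then show ?thesis
      using b[of "fst u" "snd u"] by (simp add: Phi_def cis_conv_exp inner_prod_def)
  qed
  then show ?thesis by blast
qed

lemma Phi_diff: "Phi (u - v) = Phi u * cnj (Phi v) * exp (kern u v)"
proof -
  obtain b where b: "\<And>u. Phi u = exp (\<i> * of_real (b \<bullet> u) + (\<integral>z. levy_integrand u z \<partial>\<nu>))"
    using Phi_exp by blast
  have "Phi (u - v) = Phi u * Phi (- v) * exp (kern u v)"
    unfolding b levy_exponent_diff exp_add[symmetric]
    by (simp add: inner_diff_right algebra_simps)
  then show ?thesis
    by (simp add: Phi_uminus)
qed

definition cov :: "real \<times> real \<Rightarrow> real \<times> real \<Rightarrow> complex" where
  "cov u v = (\<integral>\<omega>. (cis (u \<bullet> (X \<omega>, Y \<omega>)) - Phi u) * cnj (cis (v \<bullet> (X \<omega>, Y \<omega>)) - Phi v) \<partial>M)"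

lemma cov_eq: "cov u v = Phi u * cnj (Phi v) * (exp (kern u v) - 1)"
proof -
  let ?e = "\<lambda>u \<omega>. cis (u \<bullet> (X \<omega>, Y \<omega>))"
  have i: "integrable M (?e u)" "integrable M (\<lambda>\<omega>. ?e u \<omega> * cnj (?e v \<omega>))" for u v
    by (intro sq_int_imp_integrable sq_int_integrable_mult sq_int_cis_XY)+
  have "cov u v = (\<integral>\<omega>. ?e u \<omega> * cnj (?e v \<omega>) - ?e u \<omega> * cnj (Phi v) - Phi u * cnj (?e v \<omega>) + Phi u * cnj (Phi v) \<partial>M)"
    unfolding cov_def by (intro Bochner_Integration.integral_cong refl) (simp add: algebra_simps)
  also have "\<dots> = (\<integral>\<omega>. ?e u \<omega> * cnj (?e v \<omega>) \<partial>M) - Phi u * cnj (Phi v) - Phi u * cnj (Phi v) + Phi u * cnj (Phi v)"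
    using i by (simp add: prob_space Phi_def)
  also have "(\<integral>\<omega>. ?e u \<omega> * cnj (?e v \<omega>) \<partial>M) = Phi (u - v)"
    unfolding Phi_def by (intro Bochner_Integration.integral_cong refl) (simp add: cis_cnj cis_mult inner_diff_left)
  finally show ?thesis
    by (simp add: Phi_diff algebra_simps)
qed

text \<open>An additive version of \<open>covar <= R * sd * sd\<close>. Since it is required for all
  test functions, replacing these by multiples, one of them negative, recovers the product version;
  vanishing variances need no exception.\<close>

definition corr_bound :: "real \<Rightarrow> bool" where
  "corr_bound R \<longleftrightarrow> (\<forall>\<phi> \<psi>. \<phi> \<in> borel_measurable borel \<longrightarrow> \<psi> \<in> borel_measurable borel \<longrightarrow>
     square_integrable M (\<phi> \<circ> X) \<longrightarrow> square_integrable M (\<psi> \<circ> Y) \<longrightarrow>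
     0 \<le> R * (covar M (\<phi> \<circ> X) (\<phi> \<circ> X) + covar M (\<psi> \<circ> Y) (\<psi> \<circ> Y)) + 2 * covar M (\<phi> \<circ> X) (\<psi> \<circ> Y))"

lemma sq_int_wave_centred: "sq_int M (\<lambda>\<omega>. cis (u \<bullet> (X \<omega>, Y \<omega>)) - Phi u)"
  unfolding Phi_def by (intro sq_int_centred sq_int_cis_XY)

lemma corr_boundI:
  assumes R: "bilinear_bound R" "0 \<le> R"
  shows "corr_bound R"
proof -
  have form: "nonneg_form S (\<lambda>i j. block R i j * cov (freq i) (freq j))" if S: "finite S" for S
  proof -
    have "nonneg_form S (\<lambda>i j. block R i j * (exp (kern (freq i) (freq j)) - 1))"
      unfolding kern_def using nonneg_form_block_kern[OF R S]
      by (intro nonneg_form_block_exp S sq_int_cis) (simp add: kern_def)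
    \<comment> \<open>By \<open>cov_eq\<close> the covariance kernel differs from
      \<open>exp (kern u v) - 1\<close> only by the factors \<open>Phi u\<close> and
      \<open>cnj (Phi v)\<close>.\<close>
    from nonneg_form_congruence[OF this, of "\<lambda>i. Phi (freq i)"] show ?thesis
      by (rule nonneg_form_cong[rotated]) (simp add: cov_eq mult_ac)
  qed
  show ?thesis
    unfolding corr_bound_def
  proof (intro allI impI)
    fix \<phi> \<psi> :: "real \<Rightarrow> real"
    assume [measurable]: "\<phi> \<in> borel_measurable borel" "\<psi> \<in> borel_measurable borel"
      and sq: "square_integrable M (\<phi> \<circ> X)" "square_integrable M (\<psi> \<circ> Y)"
    obtain q where q: "\<And>n. trig_poly (q n)" "\<And>n. sq_int M (\<lambda>\<omega>. q n (X \<omega>))"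
      "(\<lambda>n. sqnorm M (\<lambda>\<omega>. q n (X \<omega>) - of_real (\<phi> (X \<omega>)))) \<longlonglongrightarrow> 0"
      using trig_poly_dense_rv[OF _ _ sq(1)] by auto
    obtain r where r: "\<And>n. trig_poly (r n)" "\<And>n. sq_int M (\<lambda>\<omega>. r n (Y \<omega>))"
      "(\<lambda>n. sqnorm M (\<lambda>\<omega>. r n (Y \<omega>) - of_real (\<psi> (Y \<omega>)))) \<longlonglongrightarrow> 0"
      using trig_poly_dense_rv[OF _ _ sq(2)] by auto
    have s: "sq_int M (\<lambda>\<omega>. of_real ((\<phi> \<circ> X) \<omega>))" "sq_int M (\<lambda>\<omega>. of_real ((\<psi> \<circ> Y) \<omega>))"
      using sq by (auto simp: sq_int_def square_integrable_def)
    \<comment> \<open>Centring does not increase the L^2 norm, so convergence of the approximants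
      implies convergence of their centred versions.\<close>
    have lim: "(\<lambda>n. sqnorm M (\<lambda>\<omega>. (f n \<omega> - expectation (f n)) - of_real (g \<omega> - expectation g))) \<longlonglongrightarrow> 0"
      if f: "\<And>n. sq_int M (f n)" and g: "sq_int M (\<lambda>\<omega>. of_real (g \<omega>))"
        and fg: "(\<lambda>n. sqnorm M (\<lambda>\<omega>. f n \<omega> - of_real (g \<omega>))) \<longlonglongrightarrow> 0" for f g
    proof (rule tendsto_sandwich[OF _ _ tendsto_const fg])
      show "\<forall>\<^sub>F n in sequentially. (sqnorm M (\<lambda>\<omega>. (f n \<omega> - expectation (f n)) - of_real (g \<omega> - expectation g)))
          \<le> (sqnorm M (\<lambda>\<omega>. f n \<omega> - of_real (g \<omega>)))"
      proof (rule always_eventually, rule allI)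
        fix n
        have "(\<integral>\<omega>. f n \<omega> - of_real (g \<omega>) \<partial>M) = (\<integral>\<omega>. f n \<omega> \<partial>M) - of_real (\<integral>\<omega>. g \<omega> \<partial>M)"
          using sq_int_imp_integrable[OF f] sq_int_imp_integrable[OF g] by simp
        then have eq: "(f n \<omega> - expectation (f n)) - of_real (g \<omega> - expectation g) =
            (f n \<omega> - of_real (g \<omega>)) - (\<integral>\<omega>. f n \<omega> - of_real (g \<omega>) \<partial>M)" for \<omega>
          by simp
        show "(sqnorm M (\<lambda>\<omega>. (f n \<omega> - expectation (f n)) - of_real (g \<omega> - expectation g)))
          \<le> (sqnorm M (\<lambda>\<omega>. f n \<omega> - of_real (g \<omega>)))"
          unfolding eq by (rule integral_centred_le[OF sq_int_diff[OF f g]])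
      qed
    qed simp
    have sc: "sq_int M (\<lambda>\<omega>. of_real (g \<omega> - expectation g))" if "sq_int M (\<lambda>\<omega>. of_real (g \<omega>))" for g
      using sq_int_centred[OF that] by simp
    have "0 \<le> corr_form M R (\<lambda>\<omega>. of_real ((\<phi> \<circ> X) \<omega> - expectation (\<phi> \<circ> X)))
        (\<lambda>\<omega>. of_real ((\<psi> \<circ> Y) \<omega> - expectation (\<psi> \<circ> Y)))"
    proof (rule corr_form_limit[OF sq_int_centred[OF q(2)] sc[OF s(1)] sq_int_centred[OF r(2)] sc[OF s(2)] lim lim])
      fix n
      obtain S a where S: "finite S" "q n = (\<lambda>x. \<Sum>u\<in>S. a u * cis (u * x))"
        using q(1)[of n] by (auto simp: trig_poly_def)
      obtain T b where T: "finite T" "r n = (\<lambda>x. \<Sum>u\<in>T. b u * cis (u * x))"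
        using r(1)[of n] by (auto simp: trig_poly_def)
      have wave: "cis (u * X \<omega>) = cis (freq (True, u) \<bullet> (X \<omega>, Y \<omega>))" "cis (u * Y \<omega>) = cis (freq (False, u) \<bullet> (X \<omega>, Y \<omega>))" for u \<omega>
        by (simp_all add: freq_simps)
      note int = sq_int_imp_integrable[OF sq_int_cis_XY]
      have "q n (X \<omega>) - expectation (\<lambda>\<omega>. q n (X \<omega>)) = (\<Sum>u\<in>S. a u * (cis (freq (True, u) \<bullet> (X \<omega>, Y \<omega>)) - Phi (freq (True, u))))" for \<omega>
        unfolding S wave using int by (simp add: Phi_def right_diff_distrib sum_subtractf)
      moreover have "r n (Y \<omega>) - expectation (\<lambda>\<omega>. r n (Y \<omega>)) = (\<Sum>u\<in>T. b u * (cis (freq (False, u) \<bullet> (X \<omega>, Y \<omega>)) - Phi (freq (False, u))))" for \<omega>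
        unfolding T wave using int by (simp add: Phi_def right_diff_distrib sum_subtractf)
      ultimately show "0 \<le> corr_form M R (\<lambda>\<omega>. q n (X \<omega>) - expectation (\<lambda>\<omega>. q n (X \<omega>))) (\<lambda>\<omega>. r n (Y \<omega>) - expectation (\<lambda>\<omega>. r n (Y \<omega>)))"
        using corr_form_of_nonneg_form[OF form[unfolded cov_def] sq_int_wave_centred S(1) T(1), of a b] by simp
    qed (use q r s in auto)
    then show "0 \<le> R * (covar M (\<phi> \<circ> X) (\<phi> \<circ> X) + covar M (\<psi> \<circ> Y) (\<psi> \<circ> Y)) + 2 * covar M (\<phi> \<circ> X) (\<psi> \<circ> Y)"
      unfolding corr_form_covar .
  qed
qed

section \<open>From bounds on correlations back to the Levy measure\<close>

lemma corr_boundD_complex: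
  assumes R: "corr_bound R" and [measurable]: "f \<in> borel_measurable borel" "g \<in> borel_measurable borel"
    and bd: "\<And>x. cmod (f x) \<le> C" "\<And>x. cmod (g x) \<le> C"
  shows "0 \<le> corr_form M R (\<lambda>\<omega>. f (X \<omega>) - expectation (\<lambda>\<omega>. f (X \<omega>))) (\<lambda>\<omega>. g (Y \<omega>) - expectation (\<lambda>\<omega>. g (Y \<omega>)))"
proof -
  have sq: "sq_int M (\<lambda>\<omega>. f (X \<omega>))" "sq_int M (\<lambda>\<omega>. g (Y \<omega>))"
    using bd by (auto intro!: sq_int_bounded[of _ C])
  note i = sq_int_imp_integrable[OF sq(1)] sq_int_imp_integrable[OF sq(2)]
  have real: "square_integrable M (h \<circ> Z)" if [measurable]: "Z \<in> borel_measurable M" "h \<in> borel_measurable borel"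
    and "\<And>x. \<bar>h x\<bar> \<le> C" for h Z
    unfolding square_integrable_def
  proof (intro conjI integrable_const_bound[where B = "C\<^sup>2"] AE_I2)
    show "norm (((h \<circ> Z) \<omega>)\<^sup>2) \<le> C\<^sup>2" for \<omega>
      using power_mono[OF that(3)[of "Z \<omega>"], of 2] by simp
  qed (simp_all add: comp_def)
  \<comment> \<open>\<open>p\<close> will be \<open>Re\<close> and \<open>Im\<close>: the hypothesis
    speaks of real test functions, and the two parts of a complex pair add up by
    \<open>corr_form_Re_Im\<close>.\<close>
  have part: "0 \<le> corr_form M R (\<lambda>\<omega>. of_real (p (f (X \<omega>)) - expectation (\<lambda>\<omega>. p (f (X \<omega>)))))
      (\<lambda>\<omega>. of_real (p (g (Y \<omega>)) - expectation (\<lambda>\<omega>. p (g (Y \<omega>)))))"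
    if [measurable]: "p \<in> borel_measurable borel" and "\<And>z. \<bar>p z\<bar> \<le> cmod z" for p
    using R[unfolded corr_bound_def, rule_format, of "\<lambda>x. p (f x)" "\<lambda>x. p (g x)"]
      real[of X "\<lambda>x. p (f x)"] real[of Y "\<lambda>x. p (g x)"] order_trans[OF that(2) bd(1)] order_trans[OF that(2) bd(2)]
    unfolding corr_form_covar by (simp add: comp_def)
  have "0 \<le> corr_form M R (\<lambda>\<omega>. of_real (Re (f (X \<omega>)) - expectation (\<lambda>\<omega>. Re (f (X \<omega>)))))
         (\<lambda>\<omega>. of_real (Re (g (Y \<omega>)) - expectation (\<lambda>\<omega>. Re (g (Y \<omega>)))))
      + corr_form M R (\<lambda>\<omega>. of_real (Im (f (X \<omega>)) - expectation (\<lambda>\<omega>. Im (f (X \<omega>)))))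
         (\<lambda>\<omega>. of_real (Im (g (Y \<omega>)) - expectation (\<lambda>\<omega>. Im (g (Y \<omega>)))))"
    by (intro add_nonneg_nonneg part abs_Re_le_cmod abs_Im_le_cmod) auto
  also have "\<dots> = corr_form M R (\<lambda>\<omega>. f (X \<omega>) - expectation (\<lambda>\<omega>. f (X \<omega>))) (\<lambda>\<omega>. g (Y \<omega>) - expectation (\<lambda>\<omega>. g (Y \<omega>)))"
    unfolding corr_form_Re_Im[OF sq_int_centred[OF sq(1)] sq_int_centred[OF sq(2)]]
    by (simp add: integral_Re[OF i(1)] integral_Re[OF i(2)] integral_Im[OF i(1)] integral_Im[OF i(2)])
  finally show ?thesis .
qed

lemma nonneg_form_cov_scaled:
  assumes R: "corr_bound R" and S: "finite S"
  shows "nonneg_form S (\<lambda>i j. block R i j * cov (c *\<^sub>R freq i) (c *\<^sub>R freq j))"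
  unfolding cov_def
proof (rule nonneg_form_blockI[OF S sq_int_wave_centred])
  fix a :: "bool \<times> real \<Rightarrow> complex"
  define h where "h b x = (\<Sum>i\<in>S. (of_bool (fst i = b) * a i) * cis (c * snd i * x))" for b x
  define L where "L = (\<Sum>i\<in>S. cmod (a i))"
  have [measurable]: "h b \<in> borel_measurable borel" for b
    unfolding h_def by measurable
  have "cmod (h b x) \<le> L" for b x
    unfolding h_def L_def by (intro sum_norm_le) (simp add: norm_mult)
  then have "0 \<le> corr_form M R (\<lambda>\<omega>. h True (X \<omega>) - expectation (\<lambda>\<omega>. h True (X \<omega>))) (\<lambda>\<omega>. h False (Y \<omega>) - expectation (\<lambda>\<omega>. h False (Y \<omega>)))"
    by (intro corr_boundD_complex R) auto
  moreover have "h True (X \<omega>) = (\<Sum>i\<in>S. (of_bool (fst i) * a i) * cis ((c *\<^sub>R freq i) \<bullet> (X \<omega>, Y \<omega>)))"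
      "h False (Y \<omega>) = (\<Sum>i\<in>S. (of_bool (\<not> fst i) * a i) * cis ((c *\<^sub>R freq i) \<bullet> (X \<omega>, Y \<omega>)))" for \<omega>
    unfolding h_def by (intro sum.cong refl; auto simp: freq_def inner_prod_def)+
  moreover have "(\<Sum>i\<in>S. b i * cis ((c *\<^sub>R freq i) \<bullet> (X \<omega>, Y \<omega>))) - (\<integral>\<omega>'. (\<Sum>i\<in>S. b i * cis ((c *\<^sub>R freq i) \<bullet> (X \<omega>', Y \<omega>'))) \<partial>M) =
      (\<Sum>i\<in>S. b i * (cis ((c *\<^sub>R freq i) \<bullet> (X \<omega>, Y \<omega>)) - Phi (c *\<^sub>R freq i)))" for b \<omega>
    using sq_int_imp_integrable[OF sq_int_cis_XY]
    by (simp add: Phi_def right_diff_distrib sum_subtractf del: inner_scaleR_left)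
  ultimately show "0 \<le> corr_form M R (\<lambda>\<omega>. \<Sum>i\<in>S. (of_bool (fst i) * a i) * (cis ((c *\<^sub>R freq i) \<bullet> (X \<omega>, Y \<omega>)) - Phi (c *\<^sub>R freq i)))
     (\<lambda>\<omega>. \<Sum>i\<in>S. (of_bool (\<not> fst i) * a i) * (cis ((c *\<^sub>R freq i) \<bullet> (X \<omega>, Y \<omega>)) - Phi (c *\<^sub>R freq i)))"
    by (simp only:)
qed

lemma Phi_tendsto_one:
  assumes "c \<longlonglongrightarrow> 0"
  shows "(\<lambda>n. Phi (c n *\<^sub>R u)) \<longlonglongrightarrow> 1"
proof -
  have "(\<lambda>n. Phi (c n *\<^sub>R u)) \<longlonglongrightarrow> (\<integral>\<omega>. 1 \<partial>M)"
    unfolding Phi_def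
  proof (rule integral_dominated_convergence[where w = "\<lambda>_. 1"])
    show "AE \<omega> in M. (\<lambda>n. cis ((c n *\<^sub>R u) \<bullet> (X \<omega>, Y \<omega>))) \<longlonglongrightarrow> 1"
    proof (rule AE_I2)
      fix \<omega>
      have "(\<lambda>n. exp (\<i> * of_real (c n * (u \<bullet> (X \<omega>, Y \<omega>))))) \<longlonglongrightarrow> exp (\<i> * of_real (0 * (u \<bullet> (X \<omega>, Y \<omega>))))"
        by (intro tendsto_intros assms)
      then show "(\<lambda>n. cis ((c n *\<^sub>R u) \<bullet> (X \<omega>, Y \<omega>))) \<longlonglongrightarrow> 1"
        by (simp add: cis_conv_exp)
    qed
  qed (use sq_intD(1)[OF sq_int_cis_XY] in \<open>auto simp del: inner_scaleR_left\<close>)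
  then show ?thesis
    by (simp add: prob_space)
qed

text \<open>Low frequencies: the covariance kernel at scale \<open>c\<close> is \<open>c powr \<alpha>\<close> times the kernel of the Levy
  measure, up to lower order terms.\<close>

lemma bilinear_bound_of_corr_bound:
  assumes R: "corr_bound R" "0 \<le> R"
  shows "bilinear_bound R"
proof (rule bilinear_bound_of_nonneg_form[OF R(2)])
  fix S :: "(bool \<times> real) set" assume S: "finite S"
  define c where "c n = 1 / real (Suc n)" for n
  define t where "t n = c n powr \<alpha>" for n
  have c: "c n > 0" for n by (simp add: c_def)
  have t: "t n > 0" for n using c[of n] by (simp add: t_def)
  have c0: "c \<longlonglongrightarrow> 0"
    unfolding c_def by (rule LIMSEQ_Suc[OF lim_1_over_n])
  have "t \<longlonglongrightarrow> 0 powr \<alpha>"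
    unfolding t_def using \<alpha> c by (intro tendsto_powr2 c0 tendsto_const) (auto intro: less_imp_le always_eventually)
  then have t0: "t \<longlonglongrightarrow> 0" by simp
  show "nonneg_form S (\<lambda>i j. block R i j * kern (freq i) (freq j))"
  proof (rule nonneg_form_limit)
    show "nonneg_form S (\<lambda>i j. of_real (1 / t n) * (block R i j * cov (c n *\<^sub>R freq i) (c n *\<^sub>R freq j)))" for n
      using t by (intro nonneg_form_scale nonneg_form_cov_scaled R S) (simp add: less_imp_le)
  next
    fix i j assume "i \<in> S" "j \<in> S"
    define k where "k = kern (freq i) (freq j)"
    \<comment> \<open>By \<open>kern_scale\<close> the kernel at scale \<open>c n\<close> is
      \<open>t n * k\<close>. After division by \<open>t n\<close> the limit is the derivative of
      \<open>exp (z * k)\<close> at 0, while the factors \<open>Phi\<close> tend to 1.\<close>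
    have "((\<lambda>z. exp (z * k)) has_field_derivative exp (0 * k) * k) (at 0)"
      by (auto intro!: derivative_eq_intros)
    then have "(\<lambda>h. (exp (h * k) - 1) / h) \<midarrow>0\<rightarrow> k"
      unfolding has_field_derivative_def by (subst (asm) DERIV_def[unfolded has_field_derivative_def]) simp
    moreover have "filterlim (\<lambda>n. complex_of_real (t n)) (at 0) sequentially"
      using t t0 by (intro filterlim_atI) (auto intro!: always_eventually tendsto_of_real_iff[THEN iffD2] simp: less_imp_neq[OF t, symmetric] tendsto_of_real_iff[of t 0, simplified])
    ultimately have lim: "(\<lambda>n. (exp (of_real (t n) * k) - 1) / of_real (t n)) \<longlonglongrightarrow> k"
      by (rule filterlim_compose)
    have eq: "of_real (1 / t n) * (block R i j * cov (c n *\<^sub>R freq i) (c n *\<^sub>R freq j)) =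
        block R i j * (Phi (c n *\<^sub>R freq i) * cnj (Phi (c n *\<^sub>R freq j)) * ((exp (of_real (t n) * k) - 1) / of_real (t n)))" for n
      by (simp add: cov_eq kern_scale[OF c] t_def[symmetric] k_def)
    have "(\<lambda>n. block R i j * (Phi (c n *\<^sub>R freq i) * cnj (Phi (c n *\<^sub>R freq j)) * ((exp (of_real (t n) * k) - 1) / of_real (t n))))
        \<longlonglongrightarrow> block R i j * (1 * cnj 1 * k)"
      by (intro tendsto_intros Phi_tendsto_one c0 lim)
    then show "(\<lambda>n. of_real (1 / t n) * (block R i j * cov (c n *\<^sub>R freq i) (c n *\<^sub>R freq j)))
        \<longlonglongrightarrow> block R i j * kern (freq i) (freq j)"
      unfolding eq k_def[symmetric] by simp
  qed
qed

end

section \<open>The maximal correlation\<close>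

lemma covar_scale: "covar M (\<lambda>\<omega>. c * U \<omega>) (\<lambda>\<omega>. d * V \<omega>) = c * d * covar M U V"
proof -
  have "(c * a - c * a') * (d * b - d * b') = (c * d) * ((a - a') * (b - b'))" for a a' b b' :: real
    by (simp add: algebra_simps)
  then show ?thesis
    by (simp add: covar_def)
qed

lemma covar_nonneg: "0 \<le> covar M U U"
  unfolding covar_def by (simp add: power2_eq_square[symmetric])

lemma covar_commute: "covar M U V = covar M V U"
  by (simp add: covar_def mult.commute)

lemma (in prob_space) integrable_centred_square:
  assumes "square_integrable M U"
  shows "integrable M (\<lambda>\<omega>. (U \<omega> - expectation U)\<^sup>2)"
proof -
  have "sq_int M (\<lambda>\<omega>. of_real (U \<omega>))"
    using assms by (auto simp: sq_int_def square_integrable_def)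
  from sq_int_centred[OF this] show ?thesis
    by (simp add: sq_int_def flip: of_real_diff)
qed

lemma (in prob_space) covar_self_zero_AE:
  assumes "square_integrable M U" "covar M U U = 0"
  shows "AE \<omega> in M. U \<omega> = expectation U"
proof -
  have "(\<integral>\<omega>. (U \<omega> - expectation U)\<^sup>2 \<partial>M) = 0"
    using assms(2) by (simp add: covar_def power2_eq_square)
  then have "AE \<omega> in M. (U \<omega> - expectation U)\<^sup>2 = 0"
    by (subst (asm) integral_nonneg_eq_0_iff_AE[OF integrable_centred_square[OF assms(1)]]) auto
  then show ?thesis by simp
qed

lemma (in prob_space) covar_AE_const:
  assumes "U \<in> borel_measurable M" "AE \<omega> in M. U \<omega> = c"
  shows "covar M U V = 0"
proof -
  have "expectation U = (\<integral>\<omega>. c \<partial>M)"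
    using assms by (intro integral_cong_AE) auto
  then have "expectation U = c"
    by (simp add: prob_space)
  then show ?thesis
    unfolding covar_def using assms(2) by (intro integral_eq_zero_AE) auto
qed

text \<open>A bounded injective function turns any nondegenerate variable into an admissible test
  function, even if the variable itself has no second moment. This shows that the set of
  correlations is nonempty.\<close>

lemma (in prob_space) covar_arctan_pos:
  assumes [measurable]: "X \<in> borel_measurable M" and "\<not> degenerate M X"
  shows "square_integrable M (arctan \<circ> X)" "0 < covar M (arctan \<circ> X) (arctan \<circ> X)"
proof -
  show sq: "square_integrable M (arctan \<circ> X)"
    unfolding square_integrable_def
  proof (intro conjI integrable_const_bound[where B = "(pi / 2)\<^sup>2"] AE_I2)
    show "norm (((arctan \<circ> X) \<omega>)\<^sup>2) \<le> (pi / 2)\<^sup>2" for \<omega>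
      using power_mono[of "\<bar>arctan (X \<omega>)\<bar>" "pi / 2" 2] arctan_lbound[of "X \<omega>"] arctan_ubound[of "X \<omega>"] by simp
  qed (simp_all add: comp_def)
  have "covar M (arctan \<circ> X) (arctan \<circ> X) \<noteq> 0"
  proof
    assume "covar M (arctan \<circ> X) (arctan \<circ> X) = 0"
    from covar_self_zero_AE[OF sq this] have "AE \<omega> in M. X \<omega> = tan (expectation (arctan \<circ> X))"
      by eventually_elim (metis comp_apply tan_arctan)
    with assms(2) show False
      by (auto simp: degenerate_def)
  qed
  then show "0 < covar M (arctan \<circ> X) (arctan \<circ> X)"
    using covar_nonneg[of M "arctan \<circ> X"] by simp
qed

context stable_pair
begin

definition correlations :: "real set" where
  "correlations = {pearson_correlation M (\<phi> \<circ> X) (\<psi> \<circ> Y) | \<phi> \<psi>.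
     \<phi> \<in> borel_measurable borel \<and> \<psi> \<in> borel_measurable borel \<and>
     square_integrable M (\<phi> \<circ> X) \<and> covar M (\<phi> \<circ> X) (\<phi> \<circ> X) > 0 \<and>
     square_integrable M (\<psi> \<circ> Y) \<and> covar M (\<psi> \<circ> Y) (\<psi> \<circ> Y) > 0}"

lemma max_correlation_eq:
  "max_correlation M borel borel X Y = (if degenerate M X \<or> degenerate M Y then 0 else Sup correlations)"
  by (simp add: max_correlation_def correlations_def)

lemma correlations_le:
  assumes R: "corr_bound R" and r: "r \<in> correlations"
  shows "r \<le> R"
proof -
  obtain \<phi> \<psi> where [measurable]: "\<phi> \<in> borel_measurable borel" "\<psi> \<in> borel_measurable borel"
    and sq: "square_integrable M (\<phi> \<circ> X)" "square_integrable M (\<psi> \<circ> Y)"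
    and pos: "covar M (\<phi> \<circ> X) (\<phi> \<circ> X) > 0" "covar M (\<psi> \<circ> Y) (\<psi> \<circ> Y) > 0"
    and r_eq: "r = pearson_correlation M (\<phi> \<circ> X) (\<psi> \<circ> Y)"
    using r by (auto simp: correlations_def)
  define U V where "U = \<phi> \<circ> X" and "V = \<psi> \<circ> Y"
  define a b where "a = sqrt (covar M U U)" and "b = sqrt (covar M V V)"
  have ab: "a > 0" "b > 0" "covar M U U = a\<^sup>2" "covar M V V = b\<^sup>2"
    using pos by (auto simp: a_def b_def U_def V_def)
  \<comment> \<open>Scaling to unit variances makes the additive bound equal to the quotient bound;
    the negative sign converts the lower bound for the covariance into an upper one.\<close>
  let ?\<phi> = "\<lambda>x. 1 / a * \<phi> x" and ?\<psi> = "\<lambda>x. - 1 / b * \<psi> x"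
  have "0 \<le> R * (covar M (?\<phi> \<circ> X) (?\<phi> \<circ> X) + covar M (?\<psi> \<circ> Y) (?\<psi> \<circ> Y)) + 2 * covar M (?\<phi> \<circ> X) (?\<psi> \<circ> Y)"
    using sq by (intro R[unfolded corr_bound_def, rule_format])
      (auto simp: square_integrable_def power_mult_distrib comp_def power_divide)
  moreover have "?\<phi> \<circ> X = (\<lambda>\<omega>. 1 / a * U \<omega>)" "?\<psi> \<circ> Y = (\<lambda>\<omega>. - 1 / b * V \<omega>)"
    by (auto simp: U_def V_def)
  ultimately have "0 \<le> R * (1 / a * (1 / a) * a\<^sup>2 + (- 1 / b) * (- 1 / b) * b\<^sup>2)
      + 2 * (1 / a * (- 1 / b) * covar M U V)"
    by (simp only: covar_scale ab)
  then have "covar M U V / (a * b) \<le> R"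
    using ab by (simp add: power2_eq_square)
  then show ?thesis
    using ab by (simp add: r_eq pearson_correlation_def real_sqrt_mult flip: U_def V_def)
qed

lemma max_correlation_le:
  assumes "bilinear_bound s" "0 \<le> s"
  shows "max_correlation M borel borel X Y \<le> s"
proof (cases "degenerate M X \<or> degenerate M Y")
  case True
  then show ?thesis using assms by (simp add: max_correlation_eq)
next
  case False
  have "r \<le> s" if "r \<in> correlations" for r
    using correlations_le[OF corr_boundI that] assms by blast
  moreover have "pearson_correlation M (arctan \<circ> X) (arctan \<circ> Y) \<in> correlations"
    unfolding correlations_def using covar_arctan_pos[of X] covar_arctan_pos[of Y] False by force
  ultimately show ?thesis
    using False by (auto simp: max_correlation_eq intro!: cSup_least)
qed

text \<open>The assumed bound \<open>s\<close> guarantees that the set of correlations is bounded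
  above, so that its \<open>Sup\<close> dominates every element. Nonnegativity of \<open>R\<close>
  comes from the pair of arctangents, whose absolute covariance is at most \<open>R\<close> times a
  positive number.\<close>

lemma max_correlation_bounds:
  assumes "bilinear_bound s" "0 \<le> s"
  defines "R \<equiv> max_correlation M borel borel X Y"
  shows "0 \<le> R" and "corr_bound R"
proof -
  have bdd: "bdd_above correlations"
    using correlations_le[OF corr_boundI[OF assms(1,2)]] by (auto simp: bdd_above_def)
  have le: "\<bar>covar M U V\<bar> \<le> R * (sqrt (covar M U U) * sqrt (covar M V V))"
    if nd: "\<not> (degenerate M X \<or> degenerate M Y)"
      and UV: "U = \<phi> \<circ> X" "V = \<psi> \<circ> Y"
      and [measurable]: "\<phi> \<in> borel_measurable borel" "\<psi> \<in> borel_measurable borel"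
      and sq: "square_integrable M U" "square_integrable M V"
      and pos: "covar M U U > 0" "covar M V V > 0" for \<phi> \<psi> U V
  proof -
    \<comment> \<open>Both a test function and its negative are admissible, which yields the
      absolute value.\<close>
    have *: "c * covar M U V / sqrt (covar M U U * covar M V V) \<le> R" if c: "c \<in> {1, -1}" for c
    proof -
      let ?\<phi> = "\<lambda>x. c * \<phi> x"
      have eq: "?\<phi> \<circ> X = (\<lambda>\<omega>. c * U \<omega>)"
        by (auto simp: UV)
      have cov: "covar M (\<lambda>\<omega>. c * U \<omega>) (\<lambda>\<omega>. c * U \<omega>) = covar M U U" "covar M (\<lambda>\<omega>. c * U \<omega>) V = c * covar M U V"
        using covar_scale[of M c U c U] covar_scale[of M c U 1 V] c by auto
      have "square_integrable M (\<lambda>\<omega>. c * U \<omega>)"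
        using sq(1) by (auto simp: square_integrable_def power_mult_distrib)
      then have "pearson_correlation M (?\<phi> \<circ> X) (\<psi> \<circ> Y) \<in> correlations"
        unfolding correlations_def using sq(2) pos cov(1) that(1) UV(2)
        by (intro CollectI exI[of _ ?\<phi>] exI[of _ \<psi>] conjI) (simp_all add: eq)
      then show ?thesis
        using nd bdd unfolding eq pearson_correlation_def UV(2)[symmetric] cov
        by (auto simp: R_def max_correlation_eq intro: cSup_upper)
    qed
    have "\<bar>covar M U V\<bar> / (sqrt (covar M U U) * sqrt (covar M V V)) \<le> R"
      using *[of 1] *[of "-1"] unfolding real_sqrt_mult by (auto simp: abs_if)
    then show ?thesis
      using pos by (simp add: pos_divide_le_eq)
  qed
  show R0: "0 \<le> R"
  proof (cases "degenerate M X \<or> degenerate M Y")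
    case False
    then have "\<not> degenerate M X" "\<not> degenerate M Y"
      by auto
    note ap = covar_arctan_pos[OF measurable_XY(1) this(1)] covar_arctan_pos[OF measurable_XY(2) this(2)]
    from le[OF False refl refl _ _ ap(1,3,2,4)]
    have "0 \<le> R * (sqrt (covar M (arctan \<circ> X) (arctan \<circ> X)) * sqrt (covar M (arctan \<circ> Y) (arctan \<circ> Y)))"
      by (auto intro: order_trans[OF abs_ge_zero])
    moreover have "0 < sqrt (covar M (arctan \<circ> X) (arctan \<circ> X)) * sqrt (covar M (arctan \<circ> Y) (arctan \<circ> Y))"
      using ap by simp
    ultimately show ?thesis
      by (metis mult_neg_pos not_le)
  qed (simp add: R_def max_correlation_eq)
  show "corr_bound R"
    unfolding corr_bound_def
  proof (intro allI impI)
    fix \<phi> \<psi> :: "real \<Rightarrow> real"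
    assume [measurable]: "\<phi> \<in> borel_measurable borel" "\<psi> \<in> borel_measurable borel"
      and sq: "square_integrable M (\<phi> \<circ> X)" "square_integrable M (\<psi> \<circ> Y)"
    let ?U = "\<phi> \<circ> X" and ?V = "\<psi> \<circ> Y"
    have Um: "?U \<in> borel_measurable M" "?V \<in> borel_measurable M"
      using sq by (auto simp: square_integrable_def)
    \<comment> \<open>If one of the two composed functions is almost surely constant, the covariance
      is 0 and only nonnegative terms remain. Otherwise neither \<open>X\<close> nor
      \<open>Y\<close> is degenerate, so \<open>R\<close> is the supremum and \<open>le\<close>
      applies.\<close>
    show "0 \<le> R * (covar M ?U ?U + covar M ?V ?V) + 2 * covar M ?U ?V"
    proof (cases "(\<exists>c. AE \<omega> in M. ?U \<omega> = c) \<or> (\<exists>c. AE \<omega> in M. ?V \<omega> = c)")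
      case True
      then have "covar M ?U ?V = 0"
        using covar_AE_const[OF Um(1)] covar_AE_const[OF Um(2)] covar_commute[of M ?U ?V] by metis
      then show ?thesis
        using R0 covar_nonneg[of M ?U] covar_nonneg[of M ?V] by simp
    next
      case False
      have "AE \<omega> in M. (f \<circ> Z) \<omega> = f c" if "AE \<omega> in M. Z \<omega> = c" for f :: "real \<Rightarrow> real" and Z c
        using that by eventually_elim simp
      then have nd: "\<not> (degenerate M X \<or> degenerate M Y)"
        using False unfolding degenerate_def by blast
      have "covar M ?U ?U \<noteq> 0" "covar M ?V ?V \<noteq> 0"
        using False covar_self_zero_AE[OF sq(1)] covar_self_zero_AE[OF sq(2)] by blast+
      then have pos: "covar M ?U ?U > 0" "covar M ?V ?V > 0"
        using covar_nonneg[of M ?U] covar_nonneg[of M ?V] by linarith+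
      define a b where "a = sqrt (covar M ?U ?U)" and "b = sqrt (covar M ?V ?V)"
      have ab: "covar M ?U ?U = a\<^sup>2" "covar M ?V ?V = b\<^sup>2"
        using pos by (auto simp: a_def b_def)
      have "\<bar>covar M ?U ?V\<bar> \<le> R * (a * b)"
        unfolding a_def b_def by (rule le[OF nd refl refl _ _ sq pos]) auto
      moreover have "R * (2 * (a * b)) \<le> R * (a\<^sup>2 + b\<^sup>2)"
        using sum_squares_bound[of a b] R0 by (intro mult_left_mono) (auto simp: mult_ac)
      ultimately show ?thesis
        unfolding ab by (simp add: abs_le_iff)
    qed
  qed
qed

text \<open>The upper half uses that \<open>s\<close> itself satisfies
  \<open>bilinear_bound\<close>; the lower half uses that the maximal correlation satisfies it too,
  by the low-frequency limit.\<close>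

lemma max_correlation_eqI:
  assumes "0 \<le> s" and "\<And>R. 0 \<le> R \<Longrightarrow> bilinear_bound R \<longleftrightarrow> s \<le> R"
  shows "max_correlation M borel borel X Y = s"
proof (rule antisym)
  show "max_correlation M borel borel X Y \<le> s"
    using assms by (intro max_correlation_le) auto
  have "bilinear_bound s"
    using assms by simp
  note R = max_correlation_bounds[OF this assms(1)]
  show "s \<le> max_correlation M borel borel X Y"
    using assms(2)[OF R(1)] bilinear_bound_of_corr_bound[OF R(2,1)] by blast
qed

end

section \<open>Arcs, signs and the matrix\<close>

lemma circle_arc_representative:
  assumes "\<theta> \<in> circle_arc a b"
  obtains \<theta>' where "\<theta>' \<in> {a..b}" "cos \<theta>' = cos \<theta>" "sin \<theta>' = sin \<theta>"
proof -
  obtain k :: int where k: "\<theta> + 2 * pi * of_int k \<in> {a..b}"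
    using assms by (auto simp: circle_arc_def)
  moreover have "cos (\<theta> + 2 * pi * of_int k) = cos \<theta>" "sin (\<theta> + 2 * pi * of_int k) = sin \<theta>"
    using cos.plus_of_int[of \<theta> k] sin.plus_of_int[of \<theta> k] by (simp_all add: mult_ac)
  ultimately show ?thesis
    using that by blast
qed

lemma mem_circle_arc: "\<theta> \<in> {0..<2 * pi} \<Longrightarrow> \<theta> + 2 * pi * of_int k \<in> {a..b} \<Longrightarrow> \<theta> \<in> circle_arc a b"
  by (auto simp: circle_arc_def)

lemma sin_nonpos: "pi \<le> x \<Longrightarrow> x \<le> 2 * pi \<Longrightarrow> sin x \<le> 0"
  using sin_ge_zero[of "x - pi"] by (simp add: sin_diff)

lemma cos_nonpos: "pi / 2 \<le> x \<Longrightarrow> x \<le> 3 * pi / 2 \<Longrightarrow> cos x \<le> 0"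
  using cos_ge_zero[of "x - pi"] by (simp add: cos_diff)

lemma cos_nonneg_upper: "3 * pi / 2 \<le> x \<Longrightarrow> x \<le> 2 * pi \<Longrightarrow> 0 \<le> cos x"
  using cos_ge_zero[of "x - 2 * pi"] by (simp add: cos_diff)

context stable_spectrum
begin

text \<open>Weak inequalities on the arc and strict inequalities off it fit together because both
  integrands vanish where \<open>cos\<close> or \<open>sin\<close> does, which settles the
  endpoints.\<close>

lemma arc_integral_Cxy:
  assumes st: "s \<in> signs" "t \<in> signs"
    and sub: "\<And>\<theta>. \<theta> \<in> {a..b} \<Longrightarrow> 0 \<le> s * cos \<theta> \<and> 0 \<le> t * sin \<theta>"
    and sup: "\<And>\<theta>. \<theta> \<in> {0..<2 * pi} \<Longrightarrow> 0 < s * cos \<theta> \<Longrightarrow> 0 < t * sin \<theta> \<Longrightarrow> \<theta> \<in> circle_arc a b"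
  shows "(LINT \<theta>:circle_arc a b|\<tau>. \<bar>cos \<theta> * sin \<theta>\<bar> powr (\<alpha> / 2)) = Cxy s t"
  unfolding set_lebesgue_integral_def Cxy_def
proof (rule Bochner_Integration.integral_cong[OF refl])
  fix \<theta> assume "\<theta> \<in> space \<tau>"
  then have \<theta>: "\<theta> \<in> {0..<2 * pi}" by (simp add: space_tau)
  show "indicator (circle_arc a b) \<theta> *\<^sub>R \<bar>cos \<theta> * sin \<theta>\<bar> powr (\<alpha> / 2) =
      ppow (\<alpha> / 2) s (cos \<theta>) * ppow (\<alpha> / 2) t (sin \<theta>)"
  proof (cases "\<theta> \<in> circle_arc a b")
    case True
    then have "0 \<le> s * cos \<theta>" "0 \<le> t * sin \<theta>"
      using sub by (metis circle_arc_representative)+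
    then have "max 0 (s * cos \<theta>) = \<bar>cos \<theta>\<bar>" "max 0 (t * sin \<theta>) = \<bar>sin \<theta>\<bar>"
      using st by auto
    then show ?thesis
      using True by (simp add: ppow_def abs_mult powr_mult)
  next
    case False
    then have "s * cos \<theta> \<le> 0 \<or> t * sin \<theta> \<le> 0"
      using sup[OF \<theta>] by force
    then show ?thesis
      using False by (auto simp: ppow_def)
  qed
qed

lemma arc_integral_D:
  assumes s: "s \<in> signs" and f: "f = cos \<or> f = sin"
    and sub: "\<And>\<theta>. \<theta> \<in> {a..b} \<Longrightarrow> 0 \<le> s * f \<theta>"
    and sup: "\<And>\<theta>. \<theta> \<in> {0..<2 * pi} \<Longrightarrow> 0 < s * f \<theta> \<Longrightarrow> \<theta> \<in> circle_arc a b"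
  shows "(LINT \<theta>:circle_arc a b|\<tau>. \<bar>f \<theta>\<bar> powr \<alpha>) = (\<integral>\<theta>. ppow \<alpha> s (f \<theta>) \<partial>\<tau>)"
  unfolding set_lebesgue_integral_def
proof (rule Bochner_Integration.integral_cong[OF refl])
  fix \<theta> assume "\<theta> \<in> space \<tau>"
  then have \<theta>: "\<theta> \<in> {0..<2 * pi}" by (simp add: space_tau)
  show "indicator (circle_arc a b) \<theta> *\<^sub>R \<bar>f \<theta>\<bar> powr \<alpha> = ppow \<alpha> s (f \<theta>)"
  proof (cases "\<theta> \<in> circle_arc a b")
    case True
    then have "0 \<le> s * f \<theta>"
      using sub f by (metis circle_arc_representative)
    then have "max 0 (s * f \<theta>) = \<bar>f \<theta>\<bar>"
      using s by auto
    then show ?thesis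
      using True by (simp add: ppow_def)
  next
    case False
    then have "s * f \<theta> \<le> 0"
      using sup[OF \<theta>] by force
    then show ?thesis
      using False by (auto simp: ppow_def)
  qed
qed

lemma quadrants:
  assumes "\<theta> \<in> {0..<2 * pi}"
  shows "cos \<theta> > 0 \<Longrightarrow> \<theta> \<le> pi / 2 \<or> 3 * pi / 2 \<le> \<theta>" "cos \<theta> < 0 \<Longrightarrow> pi / 2 \<le> \<theta> \<and> \<theta> \<le> 3 * pi / 2"
    "sin \<theta> > 0 \<Longrightarrow> \<theta> \<le> pi" "sin \<theta> < 0 \<Longrightarrow> pi \<le> \<theta>"
proof -
  show "cos \<theta> > 0 \<Longrightarrow> \<theta> \<le> pi / 2 \<or> 3 * pi / 2 \<le> \<theta>"
    using cos_nonpos[of \<theta>] by linarith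
  show "cos \<theta> < 0 \<Longrightarrow> pi / 2 \<le> \<theta> \<and> \<theta> \<le> 3 * pi / 2"
    using assms cos_nonneg_upper[of \<theta>] cos_ge_zero[of \<theta>] by force
  show "sin \<theta> > 0 \<Longrightarrow> \<theta> \<le> pi"
    using assms sin_nonpos[of \<theta>] by force
  show "sin \<theta> < 0 \<Longrightarrow> pi \<le> \<theta>"
    using assms sin_ge_zero[of \<theta>] by force
qed

lemma arc_integrals:
  "(LINT \<theta>:circle_arc 0 (pi / 2)|\<tau>. \<bar>cos \<theta> * sin \<theta>\<bar> powr (\<alpha> / 2)) = Cxy 1 1"
  "(LINT \<theta>:circle_arc (3 * pi / 2) (2 * pi)|\<tau>. \<bar>cos \<theta> * sin \<theta>\<bar> powr (\<alpha> / 2)) = Cxy 1 (-1)"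
  "(LINT \<theta>:circle_arc (pi / 2) pi|\<tau>. \<bar>cos \<theta> * sin \<theta>\<bar> powr (\<alpha> / 2)) = Cxy (-1) 1"
  "(LINT \<theta>:circle_arc pi (3 * pi / 2)|\<tau>. \<bar>cos \<theta> * sin \<theta>\<bar> powr (\<alpha> / 2)) = Cxy (-1) (-1)"
  "(LINT \<theta>:circle_arc (- (pi / 2)) (pi / 2)|\<tau>. \<bar>cos \<theta>\<bar> powr \<alpha>) = Dx 1"
  "(LINT \<theta>:circle_arc (pi / 2) (3 * pi / 2)|\<tau>. \<bar>cos \<theta>\<bar> powr \<alpha>) = Dx (-1)"
  "(LINT \<theta>:circle_arc 0 pi|\<tau>. \<bar>sin \<theta>\<bar> powr \<alpha>) = Dy 1"
  "(LINT \<theta>:circle_arc pi (2 * pi)|\<tau>. \<bar>sin \<theta>\<bar> powr \<alpha>) = Dy (-1)"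
proof -
  show "(LINT \<theta>:circle_arc 0 (pi / 2)|\<tau>. \<bar>cos \<theta> * sin \<theta>\<bar> powr (\<alpha> / 2)) = Cxy 1 1"
  proof (rule arc_integral_Cxy)
    fix \<theta> :: real
    show "0 \<le> 1 * cos \<theta> \<and> 0 \<le> 1 * sin \<theta>" if "\<theta> \<in> {0..pi / 2}"
      using that pi_gt_zero cos_ge_zero[of \<theta>] sin_ge_zero[of \<theta>] by auto
    show "\<theta> \<in> circle_arc 0 (pi / 2)" if "\<theta> \<in> {0..<2 * pi}" "0 < 1 * cos \<theta>" "0 < 1 * sin \<theta>"
      using that quadrants[of \<theta>] pi_gt_zero by (intro mem_circle_arc[where k = 0]) auto
  qed auto
  show "(LINT \<theta>:circle_arc (3 * pi / 2) (2 * pi)|\<tau>. \<bar>cos \<theta> * sin \<theta>\<bar> powr (\<alpha> / 2)) = Cxy 1 (-1)"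
  proof (rule arc_integral_Cxy)
    fix \<theta> :: real
    show "0 \<le> 1 * cos \<theta> \<and> 0 \<le> (-1) * sin \<theta>" if "\<theta> \<in> {3 * pi / 2..2 * pi}"
      using that pi_gt_zero cos_nonneg_upper[of \<theta>] sin_nonpos[of \<theta>] by auto
    show "\<theta> \<in> circle_arc (3 * pi / 2) (2 * pi)" if "\<theta> \<in> {0..<2 * pi}" "0 < 1 * cos \<theta>" "0 < (-1) * sin \<theta>"
      using that quadrants[of \<theta>] pi_gt_zero by (intro mem_circle_arc[where k = 0]) auto
  qed auto
  show "(LINT \<theta>:circle_arc (pi / 2) pi|\<tau>. \<bar>cos \<theta> * sin \<theta>\<bar> powr (\<alpha> / 2)) = Cxy (-1) 1"
  proof (rule arc_integral_Cxy)
    fix \<theta> :: real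
    show "0 \<le> (-1) * cos \<theta> \<and> 0 \<le> 1 * sin \<theta>" if "\<theta> \<in> {pi / 2..pi}"
      using that pi_gt_zero cos_nonpos[of \<theta>] sin_ge_zero[of \<theta>] by auto
    show "\<theta> \<in> circle_arc (pi / 2) pi" if "\<theta> \<in> {0..<2 * pi}" "0 < (-1) * cos \<theta>" "0 < 1 * sin \<theta>"
      using that quadrants[of \<theta>] pi_gt_zero by (intro mem_circle_arc[where k = 0]) auto
  qed auto
  show "(LINT \<theta>:circle_arc pi (3 * pi / 2)|\<tau>. \<bar>cos \<theta> * sin \<theta>\<bar> powr (\<alpha> / 2)) = Cxy (-1) (-1)"
  proof (rule arc_integral_Cxy)
    fix \<theta> :: real
    show "0 \<le> (-1) * cos \<theta> \<and> 0 \<le> (-1) * sin \<theta>" if "\<theta> \<in> {pi..3 * pi / 2}"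
      using that pi_gt_zero cos_nonpos[of \<theta>] sin_nonpos[of \<theta>] by auto
    show "\<theta> \<in> circle_arc pi (3 * pi / 2)" if "\<theta> \<in> {0..<2 * pi}" "0 < (-1) * cos \<theta>" "0 < (-1) * sin \<theta>"
      using that quadrants[of \<theta>] pi_gt_zero by (intro mem_circle_arc[where k = 0]) auto
  qed auto
  show "(LINT \<theta>:circle_arc (pi / 2) (3 * pi / 2)|\<tau>. \<bar>cos \<theta>\<bar> powr \<alpha>) = Dx (-1)"
  unfolding Dx_def
  proof (rule arc_integral_D)
    fix \<theta> :: real
    show "0 \<le> (-1) * cos \<theta>" if "\<theta> \<in> {pi / 2..3 * pi / 2}"
      using that pi_gt_zero cos_nonpos[of \<theta>] by auto
    show "\<theta> \<in> circle_arc (pi / 2) (3 * pi / 2)" if "\<theta> \<in> {0..<2 * pi}" "0 < (-1) * cos \<theta>"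
      using that quadrants[of \<theta>] pi_gt_zero by (intro mem_circle_arc[where k = 0]) auto
  qed auto
  show "(LINT \<theta>:circle_arc 0 pi|\<tau>. \<bar>sin \<theta>\<bar> powr \<alpha>) = Dy 1"
  unfolding Dy_def
  proof (rule arc_integral_D)
    fix \<theta> :: real
    show "0 \<le> 1 * sin \<theta>" if "\<theta> \<in> {0..pi}"
      using that pi_gt_zero sin_ge_zero[of \<theta>] by auto
    show "\<theta> \<in> circle_arc 0 pi" if "\<theta> \<in> {0..<2 * pi}" "0 < 1 * sin \<theta>"
      using that quadrants[of \<theta>] pi_gt_zero by (intro mem_circle_arc[where k = 0]) auto
  qed auto
  show "(LINT \<theta>:circle_arc pi (2 * pi)|\<tau>. \<bar>sin \<theta>\<bar> powr \<alpha>) = Dy (-1)"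
  unfolding Dy_def
  proof (rule arc_integral_D)
    fix \<theta> :: real
    show "0 \<le> (-1) * sin \<theta>" if "\<theta> \<in> {pi..2 * pi}"
      using that pi_gt_zero sin_nonpos[of \<theta>] by auto
    show "\<theta> \<in> circle_arc pi (2 * pi)" if "\<theta> \<in> {0..<2 * pi}" "0 < (-1) * sin \<theta>"
      using that quadrants[of \<theta>] pi_gt_zero by (intro mem_circle_arc[where k = 0]) auto
  qed auto
  show "(LINT \<theta>:circle_arc (- (pi / 2)) (pi / 2)|\<tau>. \<bar>cos \<theta>\<bar> powr \<alpha>) = Dx 1"
  unfolding Dx_def
  proof (rule arc_integral_D)
    fix \<theta> assume \<theta>: "\<theta> \<in> {0..<2 * pi}" and "0 < 1 * cos \<theta>"
    then consider "\<theta> \<le> pi / 2" | "3 * pi / 2 \<le> \<theta>"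
      using quadrants(1)[OF \<theta>] by auto
    then show "\<theta> \<in> circle_arc (- (pi / 2)) (pi / 2)"
    proof cases
      case 1
      then show ?thesis
        using \<theta> pi_gt_zero by (intro mem_circle_arc[OF \<theta>, where k = 0]) auto
    next
      \<comment> \<open>This arc crosses the angle 0: representatives from \<open>3 * pi / 2\<close>
        onwards reach it only after subtracting a full turn.\<close>
      case 2
      then show ?thesis
        using \<theta> pi_gt_zero by (intro mem_circle_arc[OF \<theta>, where k = "-1"]) auto
    qed
  qed (auto intro!: cos_ge_zero)
qed

text \<open>The spectral norm is the least nonnegative constant bounding the bilinear form of
  \<open>A\<close>; sign 1 corresponds to matrix index 1 and sign -1 to index 2.\<close>

lemma bilinear_bound_iff_spectral_norm:
  fixes A :: "real ^ 2 ^ 2"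
  assumes "0 \<le> R" and A: "A = vector [vector [Cxy 1 1 / sqrt (Dx 1 * Dy 1), Cxy 1 (-1) / sqrt (Dx 1 * Dy (-1))],
               vector [Cxy (-1) 1 / sqrt (Dx (-1) * Dy 1), Cxy (-1) (-1) / sqrt (Dx (-1) * Dy (-1))]]"
  shows "bilinear_bound R \<longleftrightarrow> spectral_norm A \<le> R"
proof -
  have norm: "norm x = sqrt ((x $ 1)\<^sup>2 + (x $ 2)\<^sup>2)" for x :: "real ^ 2"
    by (simp add: norm_vec_def L2_set_def sum_2)
  have inner: "x \<bullet> (A *v y) = (\<Sum>s\<in>signs. \<Sum>t\<in>signs.
      (if s = 1 then x $ 1 else x $ 2) * (Cxy s t / sqrt (Dx s * Dy t)) * (if t = 1 then y $ 1 else y $ 2))" for x y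
    by (simp add: A inner_vec_def matrix_vector_mult_def sum_2 algebra_simps)
  show ?thesis
  proof
    assume b: "bilinear_bound R"
    show "spectral_norm A \<le> R"
    proof (rule spectral_norm_le[OF assms(1)])
      fix x y :: "real ^ 2"
      show "x \<bullet> (A *v y) \<le> R * norm x * norm y"
        using b[unfolded bilinear_bound_def, rule_format, of "\<lambda>s. if s = 1 then x $ 1 else x $ 2" "\<lambda>t. if t = 1 then y $ 1 else y $ 2"]
        unfolding inner norm by simp
    qed
  next
    assume R: "spectral_norm A \<le> R"
    show "bilinear_bound R"
      unfolding bilinear_bound_def
    proof (intro allI)
      fix x y :: "real \<Rightarrow> real"
      define u v where "u = (vector [x 1, x (-1)] :: real ^ 2)" and "v = (vector [y 1, y (-1)] :: real ^ 2)"
      have "u \<bullet> (A *v v) \<le> spectral_norm A * norm u * norm v"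
        by (rule bilinear_le_spectral_norm)
      also have "\<dots> \<le> R * norm u * norm v"
        using R by (intro mult_right_mono) auto
      finally show "(\<Sum>s\<in>signs. \<Sum>t\<in>signs. x s * (Cxy s t / sqrt (Dx s * Dy t)) * y t)
          \<le> R * sqrt (\<Sum>s\<in>signs. (x s)\<^sup>2) * sqrt (\<Sum>t\<in>signs. (y t)\<^sup>2)"
        unfolding inner norm by (simp add: u_def v_def)
    qed
  qed
qed

end

theorem theorem1p3:
  fixes M :: "'a measure" and X Y :: "'a \<Rightarrow> real" and \<alpha> :: real and \<tau> :: "real measure"
    and C\<^sub>p\<^sub>p C\<^sub>p\<^sub>m C\<^sub>m\<^sub>p C\<^sub>m\<^sub>m Dx\<^sub>p Dx\<^sub>m Dy\<^sub>p Dy\<^sub>m :: real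
  assumes "prob_space M"
    and "0 < \<alpha>" and "\<alpha> < 2"
    and "spectral_measure \<tau>"
    and "stable_vector M X Y \<alpha> \<tau>"
    and "C\<^sub>p\<^sub>p = (LINT \<theta>:circle_arc 0 (pi / 2)|\<tau>. \<bar>cos \<theta> * sin \<theta>\<bar> powr (\<alpha> / 2))"
    and "C\<^sub>p\<^sub>m = (LINT \<theta>:circle_arc (3 * pi / 2) (2 * pi)|\<tau>. \<bar>cos \<theta> * sin \<theta>\<bar> powr (\<alpha> / 2))"
    and "C\<^sub>m\<^sub>p = (LINT \<theta>:circle_arc (pi / 2) pi|\<tau>. \<bar>cos \<theta> * sin \<theta>\<bar> powr (\<alpha> / 2))"
    and "C\<^sub>m\<^sub>m = (LINT \<theta>:circle_arc pi (3 * pi / 2)|\<tau>. \<bar>cos \<theta> * sin \<theta>\<bar> powr (\<alpha> / 2))"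
    and "Dx\<^sub>p = (LINT \<theta>:circle_arc (- (pi / 2)) (pi / 2)|\<tau>. \<bar>cos \<theta>\<bar> powr \<alpha>)"
    and "Dx\<^sub>m = (LINT \<theta>:circle_arc (pi / 2) (3 * pi / 2)|\<tau>. \<bar>cos \<theta>\<bar> powr \<alpha>)"
    and "Dy\<^sub>p = (LINT \<theta>:circle_arc 0 pi|\<tau>. \<bar>sin \<theta>\<bar> powr \<alpha>)"
    and "Dy\<^sub>m = (LINT \<theta>:circle_arc pi (2 * pi)|\<tau>. \<bar>sin \<theta>\<bar> powr \<alpha>)"
  shows "max_correlation M borel borel X Y =
    spectral_norm
      (vector [vector [C\<^sub>p\<^sub>p / sqrt (Dx\<^sub>p * Dy\<^sub>p), C\<^sub>p\<^sub>m / sqrt (Dx\<^sub>p * Dy\<^sub>m)],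
               vector [C\<^sub>m\<^sub>p / sqrt (Dx\<^sub>m * Dy\<^sub>p), C\<^sub>m\<^sub>m / sqrt (Dx\<^sub>m * Dy\<^sub>m)]] :: real ^ 2 ^ 2)"
proof -
  interpret stable_pair \<alpha> \<tau> M X Y
    using assms(1-5) by (intro stable_pair.intro stable_spectrum.intro stable_pair_axioms.intro)
  show ?thesis
    unfolding assms(6-13) arc_integrals
    by (intro max_correlation_eqI spectral_norm_nonneg bilinear_bound_iff_spectral_norm refl)
qed

end
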